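(* Let $\rho>0$, $1<s<2$, $0<\eta<2-s$, and let $\alpha\in\Omega(\eta)$. Then the map $A\mapsto L(\alpha,A)$ is continuous on $G^{s}_{\rho}(\mathbb{T},\mathrm{SL}(2,\mathbb{R}))$ (with the topology induced by the norm $\|\cdot\|_{s,\rho}$).
   Context: $\mathbb{T}=\mathbb{R}/\mathbb{Z}$. For $\rho>0$ and $s>1$, $G^{s}_{\rho}(\mathbb{T},* )$ is the space of $*$-valued functions $f(\theta)=\sum_{k\in\mathbb{Z}}\hat f_k e^{2\pi i k\theta}$ on $\mathbb{T}$ with $\|f\|_{s,\rho}:=\sum_{k\in\mathbb{Z}}|\hat f_k|e^{\rho|2\pi k|^{1/s}}<\infty$ (for matrix-valued $f$, $|\cdot|$ is a matrix norm). For irrational $\alpha\in\mathbb{R}$ let $p_n/q_n$ be its continued fraction convergents. For $0<\eta<1$, $\Omega(\eta)$ is the set of $\alpha\in\mathbb{R}\setminus\mathbb{Q}$ for which there is $C_\alpha>0$ with $\ln q_{n+1}\leq C_\alpha q_n^{\eta}$ for all $n$. For $\alpha\in\mathbb{R}\setminus\mathbb{Q}$, $A:\mathbb{T}\to\mathrm{SL}(2,\mathbb{R})$ and $N\geq1$, put $A_N(\theta)=A(\theta+(N-1)\alpha)\cdots A(\theta+\alpha)A(\theta)$, $L_N(\alpha,A)=\frac1N\int_{\mathbb{T}}\ln\|A_N(\theta)\|\,d\theta$, and define the Lyapunov exponent $L(\alpha,A)=\lim_{N\to\infty}L_N(\alpha,A)=\inf_{N\geq1}L_N(\alpha,A)$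 (the limit exists by subadditivity). *)

theory Defs
  imports "HOL-Analysis.Analysis"
begin

text \<open>A function on the circle \<open>\<real>/\<int>\<close> is encoded as a 1-periodic function on \<open>\<real>\<close>.\<close>

definition fourier_coeff :: "(real \<Rightarrow> complex) \<Rightarrow> int \<Rightarrow> complex" where
  "fourier_coeff f k =
     (LINT \<theta>:{0..1}|lborel. f \<theta> * exp (- 2 * of_real pi * \<i> * of_int k * of_real \<theta>))"

text \<open>The matrix Fourier coefficients are taken entrywise; they are complex even though
  the function is real.\<close>

definition mfourier :: "(real \<Rightarrow> real^2^2) \<Rightarrow> int \<Rightarrow> complex^2^2" where
  "mfourier f k = (\<chi> i j. fourier_coeff (\<lambda>\<theta>. of_real (f \<theta> $ i $ j)) k)"

definition gevrey_weight :: "real \<Rightarrow> real \<Rightarrow> int \<Rightarrow> real" where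
  "gevrey_weight s \<rho> k = exp (\<rho> * \<bar>2 * pi * of_int k\<bar> powr (1 / s))"

text \<open>On \<open>complex^2^2\<close> the library's \<open>norm\<close> is the Frobenius norm. Another matrix norm would
  give an equivalent Gevrey norm, hence the same space and the same topology.\<close>

definition gevrey_norm :: "real \<Rightarrow> real \<Rightarrow> (real \<Rightarrow> real^2^2) \<Rightarrow> real" where
  "gevrey_norm s \<rho> f = (\<Sum>\<^sub>\<infinity>k\<in>UNIV. norm (mfourier f k) * gevrey_weight s \<rho> k)"

text \<open>\<open>infsum\<close> is 0 for a divergent sum, so finiteness of the norm is stated as summability.\<close>

definition gevrey :: "real \<Rightarrow> real \<Rightarrow> (real \<Rightarrow> real^2^2) set" where
  "gevrey s \<rho> = {f.
     (\<forall>\<theta>. f (\<theta> + 1) = f \<theta>) \<and>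
     (\<forall>\<theta> i j. ((\<lambda>k. mfourier f k $ i $ j * exp (2 * of_real pi * \<i> * of_int k * of_real \<theta>))
        has_sum of_real (f \<theta> $ i $ j)) UNIV) \<and>
     (\<lambda>k. norm (mfourier f k) * gevrey_weight s \<rho> k) summable_on UNIV}"

definition gevrey_SL2 :: "real \<Rightarrow> real \<Rightarrow> (real \<Rightarrow> real^2^2) set" where
  "gevrey_SL2 s \<rho> = {A \<in> gevrey s \<rho>. \<forall>\<theta>. det (A \<theta>) = 1}"

definition gevrey_dist :: "real \<Rightarrow> real \<Rightarrow> (real \<Rightarrow> real^2^2) \<Rightarrow> (real \<Rightarrow> real^2^2) \<Rightarrow> real" where
  "gevrey_dist s \<rho> A B = gevrey_norm s \<rho> (\<lambda>\<theta>. A \<theta> - B \<theta>)"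

definition gevrey_SL2_topology :: "real \<Rightarrow> real \<Rightarrow> (real \<Rightarrow> real^2^2) topology" where
  "gevrey_SL2_topology s \<rho> = Metric_space.mtopology (gevrey_SL2 s \<rho>) (gevrey_dist s \<rho>)"

text \<open>Complete quotients \<open>x\<^sub>n\<close> and partial quotients \<open>a\<^sub>n = \<lfloor>x\<^sub>n\<rfloor>\<close> of the continued fraction
  \<open>[a\<^sub>0; a\<^sub>1, a\<^sub>2, \<dots>]\<close>, and the denominators \<open>q\<^sub>n\<close> of its convergents, with \<open>q\<^sub>0 = 1\<close>.\<close>

primrec cf_complete :: "real \<Rightarrow> nat \<Rightarrow> real" where
  "cf_complete \<alpha> 0 = \<alpha>"
| "cf_complete \<alpha> (Suc n) = 1 / frac (cf_complete \<alpha> n)"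

definition cf_partial :: "real \<Rightarrow> nat \<Rightarrow> int" where
  "cf_partial \<alpha> n = \<lfloor>cf_complete \<alpha> n\<rfloor>"

fun cf_denom :: "real \<Rightarrow> nat \<Rightarrow> int" where
  "cf_denom \<alpha> 0 = 1"
| "cf_denom \<alpha> (Suc 0) = cf_partial \<alpha> 1"
| "cf_denom \<alpha> (Suc (Suc n)) =
     cf_partial \<alpha> (Suc (Suc n)) * cf_denom \<alpha> (Suc n) + cf_denom \<alpha> n"

definition Omega :: "real \<Rightarrow> real set" where
  "Omega \<eta> = {\<alpha>. \<alpha> \<notin> \<rat> \<and>
     (\<exists>C>0. \<forall>n. ln (of_int (cf_denom \<alpha> (Suc n))) \<le> C * of_int (cf_denom \<alpha> n) powr \<eta>)}"

primrec cocycle :: "real \<Rightarrow> (real \<Rightarrow> real^2^2) \<Rightarrow> nat \<Rightarrow> real \<Rightarrow> real^2^2" where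
  "cocycle \<alpha> A 0 \<theta> = mat 1"
| "cocycle \<alpha> A (Suc N) \<theta> = A (\<theta> + of_nat N * \<alpha>) ** cocycle \<alpha> A N \<theta>"

definition lyap_N :: "real \<Rightarrow> (real \<Rightarrow> real^2^2) \<Rightarrow> nat \<Rightarrow> real" where
  "lyap_N \<alpha> A N =
     1 / of_nat N * (LINT \<theta>:{0..1}|lborel. ln (onorm (\<lambda>v. cocycle \<alpha> A N \<theta> *v v)))"

definition lyapunov :: "real \<Rightarrow> (real \<Rightarrow> real^2^2) \<Rightarrow> real" where
  "lyapunov \<alpha> A = lim (lyap_N \<alpha> A)"

text \<open>The rest of this theory shows that \<open>gevrey_dist\<close> is a metric on the Gevrey space, so that
  \<open>gevrey_SL2_topology\<close> is the metric topology it is meant to be.\<close>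

lemma gevrey_weight_ge_1: "\<rho> \<ge> 0 \<Longrightarrow> gevrey_weight s \<rho> k \<ge> 1"
  by (simp add: gevrey_weight_def)

lemma norm_exp_fourier [simp]:
  "norm (exp (2 * of_real pi * \<i> * of_int k * of_real \<theta>)) = 1"
  "norm (exp (- 2 * of_real pi * \<i> * of_int k * of_real \<theta>)) = 1"
  by (simp_all add: norm_exp_eq_Re)

lemma gevrey_abs_summable:
  assumes "f \<in> gevrey s \<rho>" "\<rho> \<ge> 0"
  shows "(\<lambda>k. norm (mfourier f k)) summable_on UNIV"
proof (rule summable_on_comparison_test)
  show "(\<lambda>k. norm (mfourier f k) * gevrey_weight s \<rho> k) summable_on UNIV"
    using assms by (simp add: gevrey_def)
  show "norm (mfourier f k) \<le> norm (mfourier f k) * gevrey_weight s \<rho> k" for k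
    using gevrey_weight_ge_1[OF assms(2), of s k]
    by (metis mult.right_neutral mult_left_mono norm_ge_zero)
qed auto

lemma gevrey_continuous_entry:
  assumes f: "f \<in> gevrey s \<rho>" and r: "\<rho> \<ge> 0"
  shows "continuous_on UNIV (\<lambda>\<theta>. of_real (f \<theta> $ i $ j) :: complex)"
proof -
  let ?g = "\<lambda>k \<theta>. mfourier f k $ i $ j * exp (2 * of_real pi * \<i> * of_int k * of_real \<theta>)"
  have "uniform_limit UNIV (\<lambda>X \<theta>. \<Sum>k\<in>X. ?g k \<theta>) (\<lambda>\<theta>. \<Sum>\<^sub>\<infinity>k\<in>UNIV. ?g k \<theta>)
          (finite_subsets_at_top UNIV)"
  proof (rule Weierstrass_m_test_general)
    show "(\<lambda>k. norm (mfourier f k)) summable_on UNIV"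
      by (rule gevrey_abs_summable[OF f r])
    show "norm (?g k \<theta>) \<le> norm (mfourier f k)" for k \<theta>
      unfolding norm_mult norm_exp_fourier
      using Finite_Cartesian_Product.norm_nth_le[of "mfourier f k $ i" j]
        Finite_Cartesian_Product.norm_nth_le[of "mfourier f k" i] by simp
  qed
  moreover have "(\<lambda>\<theta>. \<Sum>\<^sub>\<infinity>k\<in>UNIV. ?g k \<theta>) = (\<lambda>\<theta>. of_real (f \<theta> $ i $ j))"
    using f by (auto simp: gevrey_def intro!: infsumI)
  ultimately have "uniform_limit UNIV (\<lambda>X \<theta>. \<Sum>k\<in>X. ?g k \<theta>) (\<lambda>\<theta>. of_real (f \<theta> $ i $ j))
          (finite_subsets_at_top UNIV)" by simp
  then show ?thesis
    by (rule uniform_limit_theorem[rotated])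
       (auto intro!: always_eventually continuous_intros)
qed

lemma mfourier_diff:
  assumes "f \<in> gevrey s \<rho>" "g \<in> gevrey s \<rho>" "\<rho> \<ge> 0"
  shows "mfourier (\<lambda>\<theta>. f \<theta> - g \<theta>) k = mfourier f k - mfourier g k"
proof -
  have int: "set_integrable lborel {0..1}
      (\<lambda>\<theta>. of_real (h \<theta> $ i $ j) * exp (- 2 * of_real pi * \<i> * of_int k * of_real \<theta>))"
    if "h \<in> gevrey s \<rho>" for h i j
    by (intro borel_integrable_atLeastAtMost' continuous_on_mult
          continuous_on_subset[OF gevrey_continuous_entry[OF that assms(3), of i j]])
       (auto intro!: continuous_intros)
  show ?thesis
    unfolding mfourier_def fourier_coeff_def vec_eq_iff
    using set_integral_diff(2)[OF int[OF assms(1)] int[OF assms(2)]]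
    by (simp add: algebra_simps)
qed

lemma gevrey_dist_eq:
  assumes "f \<in> gevrey s \<rho>" "g \<in> gevrey s \<rho>" "\<rho> \<ge> 0"
  shows "gevrey_dist s \<rho> f g =
    (\<Sum>\<^sub>\<infinity>k\<in>UNIV. norm (mfourier f k - mfourier g k) * gevrey_weight s \<rho> k)"
  by (simp add: gevrey_dist_def gevrey_norm_def mfourier_diff[OF assms])

lemma gevrey_dist_summable:
  assumes "f \<in> gevrey s \<rho>" "g \<in> gevrey s \<rho>"
  shows "(\<lambda>k. norm (mfourier f k - mfourier g k) * gevrey_weight s \<rho> k) summable_on UNIV"
proof (rule summable_on_comparison_test)
  show "(\<lambda>k. norm (mfourier f k) * gevrey_weight s \<rho> k + norm (mfourier g k) * gevrey_weight s \<rho> k)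
          summable_on UNIV"
    using assms by (intro summable_on_add) (simp_all add: gevrey_def)
  show "norm (mfourier f k - mfourier g k) * gevrey_weight s \<rho> k
     \<le> norm (mfourier f k) * gevrey_weight s \<rho> k + norm (mfourier g k) * gevrey_weight s \<rho> k" for k
    unfolding distrib_right[symmetric]
    by (intro mult_right_mono norm_triangle_ineq4) (simp add: gevrey_weight_def)
qed (simp_all add: gevrey_weight_def)

lemma Metric_space_gevrey:
  assumes r: "\<rho> \<ge> 0"
  shows "Metric_space (gevrey s \<rho>) (gevrey_dist s \<rho>)"
proof
  show "0 \<le> gevrey_dist s \<rho> f g" for f g
    unfolding gevrey_dist_def gevrey_norm_def
    by (intro infsum_nonneg) (simp add: gevrey_weight_def)
  show "gevrey_dist s \<rho> f g = gevrey_dist s \<rho> g f" for f g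
  proof -
    have "mfourier (\<lambda>\<theta>. f \<theta> - g \<theta>) k = - mfourier (\<lambda>\<theta>. g \<theta> - f \<theta>) k" for k
    proof -
      have "fourier_coeff (\<lambda>\<theta>. of_real (f \<theta> $ i $ j - g \<theta> $ i $ j)) k
         = - fourier_coeff (\<lambda>\<theta>. of_real (g \<theta> $ i $ j - f \<theta> $ i $ j)) k" for i j
        unfolding fourier_coeff_def set_lebesgue_integral_def
        by (subst Bochner_Integration.integral_minus[symmetric])
           (simp add: algebra_simps)
      then show ?thesis by (simp add: mfourier_def vec_eq_iff)
    qed
    then show ?thesis by (simp add: gevrey_dist_def gevrey_norm_def)
  qed
  show "gevrey_dist s \<rho> f g = 0 \<longleftrightarrow> f = g" if fg: "f \<in> gevrey s \<rho>" "g \<in> gevrey s \<rho>" for f g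
  proof
    assume "gevrey_dist s \<rho> f g = 0"
    then have "norm (mfourier f k - mfourier g k) * gevrey_weight s \<rho> k = 0" for k
      using nonneg_infsum_le_0D[OF _ gevrey_dist_summable[OF fg], of k]
      by (simp add: gevrey_dist_eq[OF fg r] gevrey_weight_def)
    then have eq: "mfourier f = mfourier g"
      by (auto simp: gevrey_weight_def)
    have "complex_of_real (f \<theta> $ i $ j) = of_real (g \<theta> $ i $ j)" for \<theta> i j
    proof (rule has_sum_unique)
      let ?g = "\<lambda>k. mfourier g k $ i $ j * exp (2 * of_real pi * \<i> * of_int k * of_real \<theta>)"
      show "(?g has_sum of_real (f \<theta> $ i $ j)) UNIV"
        unfolding eq[symmetric] using fg(1) unfolding gevrey_def by blast
      show "(?g has_sum of_real (g \<theta> $ i $ j)) UNIV"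
        using fg(2) unfolding gevrey_def by blast
    qed
    then show "f = g" by (simp add: fun_eq_iff vec_eq_iff)
  qed (use fg r in \<open>simp add: gevrey_dist_eq\<close>)
  show "gevrey_dist s \<rho> f h \<le> gevrey_dist s \<rho> f g + gevrey_dist s \<rho> g h"
    if f: "f \<in> gevrey s \<rho>" and g: "g \<in> gevrey s \<rho>" and h: "h \<in> gevrey s \<rho>" for f g h
  proof -
    have "gevrey_dist s \<rho> f h \<le> (\<Sum>\<^sub>\<infinity>k\<in>UNIV. norm (mfourier f k - mfourier g k) * gevrey_weight s \<rho> k
        + norm (mfourier g k - mfourier h k) * gevrey_weight s \<rho> k)"
      unfolding gevrey_dist_eq[OF f h r]
    proof (rule infsum_mono)
      show "norm (mfourier f k - mfourier h k) * gevrey_weight s \<rho> k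
         \<le> norm (mfourier f k - mfourier g k) * gevrey_weight s \<rho> k
           + norm (mfourier g k - mfourier h k) * gevrey_weight s \<rho> k" for k
        unfolding distrib_right[symmetric]
        by (intro mult_right_mono) (auto simp: gevrey_weight_def intro: norm_diff_triangle_le)
    qed (intro summable_on_add gevrey_dist_summable f g h)+
    then show ?thesis
      by (simp add: gevrey_dist_eq r f g h infsum_add gevrey_dist_summable)
  qed
qed

lemma Metric_space_gevrey_SL2:
  assumes "\<rho> \<ge> 0"
  shows "Metric_space (gevrey_SL2 s \<rho>) (gevrey_dist s \<rho>)"
  by (rule Metric_space.subspace[OF Metric_space_gevrey[OF assms]]) (auto simp: gevrey_SL2_def)

lemma continuous_map_gevrey_SL2_iff:
  fixes F :: "(real \<Rightarrow> real^2^2) \<Rightarrow> real"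
  assumes "\<rho> \<ge> 0"
  shows "continuous_map (gevrey_SL2_topology s \<rho>) euclideanreal F \<longleftrightarrow>
    (\<forall>A\<in>gevrey_SL2 s \<rho>. \<forall>\<epsilon>>0. \<exists>\<delta>>0. \<forall>B\<in>gevrey_SL2 s \<rho>.
       gevrey_norm s \<rho> (\<lambda>\<theta>. A \<theta> - B \<theta>) < \<delta> \<longrightarrow> \<bar>F A - F B\<bar> < \<epsilon>)"
proof -
  interpret Metric_space "gevrey_SL2 s \<rho>" "gevrey_dist s \<rho>"
    by (rule Metric_space_gevrey_SL2[OF assms])
  show ?thesis
    using metric_continuous_map[OF Met_TC.Metric_space_axioms, of F]
    unfolding gevrey_SL2_topology_def gevrey_dist_def[symmetric]
    by (simp add: dist_real_def Ball_def imp_conjL)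
qed

end

theory Submission
  imports Defs "HOL-Complex_Analysis.Riemann_Mapping" "HOL-Real_Asymp.Real_Asymp"
begin

text \<open>Since \<open>L\<close> is the infimum of the continuous functions \<open>L\<^sub>N\<close> and is nonnegative, only lower
  semicontinuity at a cocycle \<open>A\<close> with \<open>L(A) > 0\<close> is at stake.

  Write \<open>S\<^sub>N(B)\<close> for the maximum over \<open>\<theta>\<close> of \<open>ln \<bar>B\<^sub>N(\<theta>)\<bar>\<close>. Truncating the Fourier series of \<open>B\<close> at
  \<open>\<bar>k\<bar> \<approx> N\<^sup>s\<close> replaces \<open>B\<^sub>N\<close> by an entire matrix function which is at most exponentially large in the
  strip of width \<open>h \<approx> N powr (1 - s)\<close>. Take an entry and a point \<open>x\<close> of the real line where the entries of
  this function reach their largest modulus. By the three lines theorem its modulus increases by at most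
  \<open>exp (C N / (q h))\<close> on the disc of radius \<open>O(1/q)\<close> around \<open>x\<close>, so a Cartan estimate bounds it from below near
  \<open>x\<close> off a few tiny intervals. For a convergent denominator \<open>q\<close> with \<open>q \<lless> N\<close>, every \<open>\<theta>\<close> reaches this
  neighbourhood in fewer than \<open>q\<close> steps, which change \<open>ln \<bar>B\<^sub>N\<bar>\<close> by only \<open>O(q)\<close>. Hence \<open>ln \<bar>B\<^sub>N(\<theta>)\<bar>\<close> is
  almost equal to \<open>S\<^sub>N(B)\<close> outside a set of measure \<open>exp (- q powr \<sigma>)\<close>, where \<open>\<sigma>\<close> may be any number
  below \<open>2 - s\<close> if \<open>N\<close> is a slightly larger power of \<open>q\<close>.

  The avalanche principle then gives \<open>S\<^sub>n\<^sub>N / (n N) \<ge> 2 S\<^sub>2\<^sub>N / (2 N) - S\<^sub>N / N - error\<close> as long as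
  \<open>n N \<le> exp (q powr \<sigma> / 2)\<close>. As \<open>\<eta> < \<sigma>\<close>, this range contains the scales attached to a much larger convergent
  denominator, and the step can be iterated with summable losses, uniformly for \<open>B\<close> near \<open>A\<close>.\<close>

section \<open>Two-by-two matrices and the avalanche principle\<close>

text \<open>The condition s < 2 enters through the cost of one deviation estimate. A Gevrey cocycle
  has no strip of fixed width: an approximation good enough for a product of length N forces the
  strip to shrink like \<open>N powr (1 - s)\<close>, so an entry may have of the order of N^s / q
  zeros near its maximum. Staying exp(-H) away from them costs N^s H / q, and reaching the maximum
  along the orbit costs q. Both must be small against N. The second demands N well above q, and with
  N close to q the first becomes H << q^(2-s), whence \<sigma> < 2 - s.

  A single entry is followed because it is holomorphic, while the norm is not. The maximum S_N
  replaces the mean because a lower bound for it needs only one starting point whose orbit avoids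
  the exceptional set, so the number n of blocks is limited only by the measure of that set. The
  mean returns at the very end, at scales inside a window, where it almost equals the maximum.

  All thresholds depend on B only through a bound for its Gevrey norm. The first denominator can
  therefore be fixed before the neighbourhood of A is chosen.\<close>

definition entry_sum :: "'a::real_normed_field^2^2 \<Rightarrow> real" where
  "entry_sum M = (\<Sum>i\<in>UNIV. \<Sum>j\<in>UNIV. norm (M $ i $ j))"

lemma entry_sum_2: "entry_sum M = norm (M$1$1) + norm (M$1$2) + norm (M$2$1) + norm (M$2$2)"
  by (simp add: entry_sum_def sum_2)

lemma entry_sum_nonneg: "0 \<le> entry_sum M"
  by (simp add: entry_sum_2)

lemma norm_entry_le_entry_sum: "norm (M $ i $ j) \<le> entry_sum M"
  using exhaust_2[of i] exhaust_2[of j] by (auto simp: entry_sum_2)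

lemma entry_sum_le:
  assumes "\<And>i j. norm (M $ i $ j) \<le> b"
  shows "entry_sum M \<le> 4 * b"
  using assms[of 1 1] assms[of 1 2] assms[of 2 1] assms[of 2 2] by (simp add: entry_sum_2)

lemma matrix_mul_2:
  fixes X Y :: "'a::comm_ring_1^2^2"
  shows "(X ** Y) $ i $ j = X$i$1 * Y$1$j + X$i$2 * Y$2$j"
  by (simp add: matrix_matrix_mult_def sum_2)

text \<open>Submultiplicativity makes this entrywise norm usable for real and complex products
  alike. It differs from the operator norm by a factor of at most 4, which is lost after taking
  logarithms and dividing by N.\<close>

lemma entry_sum_mult: "entry_sum (X ** Y) \<le> entry_sum X * entry_sum Y"
proof -
  have "norm ((X ** Y)$i$j) \<le> norm (X$i$1) * norm (Y$1$j) + norm (X$i$2) * norm (Y$2$j)" for i j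
    unfolding matrix_mul_2 by (rule order.trans[OF norm_triangle_ineq]) (simp add: norm_mult)
  from this[of 1 1] this[of 1 2] this[of 2 1] this[of 2 2]
  have "entry_sum (X ** Y) \<le> (norm (X$1$1) + norm (X$2$1)) * (norm (Y$1$1) + norm (Y$1$2))
     + (norm (X$1$2) + norm (X$2$2)) * (norm (Y$2$1) + norm (Y$2$2))"
    by (simp add: entry_sum_2 algebra_simps)
  also have "\<dots> \<le> entry_sum X * entry_sum Y"
    by (simp add: entry_sum_2 algebra_simps)
  finally show ?thesis .
qed

lemma entry_sum_triangle: "entry_sum (X + Y) \<le> entry_sum X + entry_sum Y"
  using norm_triangle_ineq[of "X$1$1" "Y$1$1"] norm_triangle_ineq[of "X$1$2" "Y$1$2"]
    norm_triangle_ineq[of "X$2$1" "Y$2$1"] norm_triangle_ineq[of "X$2$2" "Y$2$2"]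
  by (simp add: entry_sum_2)

lemma entry_sum_minus: "entry_sum (- X) = entry_sum X"
  by (simp add: entry_sum_2)

lemma entry_sum_mat_1: "entry_sum (mat 1 :: 'a::real_normed_field^2^2) = 2"
  by (simp add: entry_sum_2 mat_def)

text \<open>With all entries below 1, the quadratic form ad - bc would be dominated by the entry sum
  itself. The bound makes all logarithms of norms of cocycles nonnegative.\<close>

lemma entry_sum_ge_1:
  fixes X :: "'a::real_normed_field^2^2"
  assumes "det X = 1"
  shows "1 \<le> entry_sum X"
proof (rule ccontr)
  assume "\<not> ?thesis"
  then have lt: "entry_sum X < 1" by simp
  have "1 = norm (X$1$1 * X$2$2 - X$1$2 * X$2$1)"
    using assms by (simp add: det_2)
  also have "\<dots> \<le> norm (X$1$1) * norm (X$2$2) + norm (X$1$2) * norm (X$2$1)"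
    by (rule order.trans[OF norm_triangle_ineq4]) (simp add: norm_mult)
  also have "\<dots> \<le> norm (X$1$1) * 1 + norm (X$1$2) * 1"
    using lt norm_entry_le_entry_sum[of X 2 2] norm_entry_le_entry_sum[of X 2 1]
    by (intro add_mono mult_left_mono) auto
  also have "\<dots> \<le> entry_sum X" by (simp add: entry_sum_2)
  finally show False using lt by simp
qed

text \<open>The adjugate has the same entries up to order and sign, so inverting costs nothing in
  this norm. This pays for moving the base point along the orbit.\<close>

lemma SL2_inverse:
  fixes X :: "'a::real_normed_field^2^2"
  assumes "det X = 1"
  obtains Y where "Y ** X = mat 1" "det Y = 1" "entry_sum Y = entry_sum X"
proof
  define Y :: "'a^2^2" where "Y = vector [vector [X$2$2, - X$1$2], vector [- X$2$1, X$1$1]]"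
  have e: "Y$1$1 = X$2$2" "Y$1$2 = - X$1$2" "Y$2$1 = - X$2$1" "Y$2$2 = X$1$1"
    by (simp_all add: Y_def vector_2)
  have d: "X$1$1 * X$2$2 - X$1$2 * X$2$1 = 1" using assms by (simp add: det_2)
  show "Y ** X = mat 1"
    using d by (simp add: vec_eq_iff forall_2 matrix_mul_2 e mat_def algebra_simps)
  show "det Y = 1" using d by (simp add: det_2 e algebra_simps)
  show "entry_sum Y = entry_sum X" by (simp add: entry_sum_2 e)
qed

text \<open>Arbitrary factors over either field, so that one set of bounds serves the real cocycle,
  its complex truncation and the products of blocks of length N.\<close>

primrec matrix_prod :: "(nat \<Rightarrow> 'a::real_normed_field^2^2) \<Rightarrow> nat \<Rightarrow> 'a^2^2" where
  "matrix_prod f 0 = mat 1"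
| "matrix_prod f (Suc n) = f n ** matrix_prod f n"

lemma det_matrix_prod: "(\<And>n. det (f n) = 1) \<Longrightarrow> det (matrix_prod f n) = 1"
  by (induction n) (simp_all add: det_mul det_I)

lemma matrix_prod_add:
  "matrix_prod f (m + n) = matrix_prod (\<lambda>i. f (i + n)) m ** matrix_prod f n"
  by (induction m) (simp_all add: matrix_mul_assoc)

text \<open>The factor 2 is the entry sum of the empty product.\<close>

lemma entry_sum_matrix_prod:
  assumes "\<And>n. entry_sum (f n) \<le> g" "0 \<le> g"
  shows "entry_sum (matrix_prod f n) \<le> 2 * g ^ n"
proof (induction n)
  case (Suc n)
  have "entry_sum (matrix_prod f (Suc n)) \<le> entry_sum (f n) * entry_sum (matrix_prod f n)"
    by (simp add: entry_sum_mult)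
  also have "\<dots> \<le> g * (2 * g ^ n)"
    using Suc assms by (intro mult_mono) (auto simp: entry_sum_nonneg)
  finally show ?case by simp
qed (simp add: entry_sum_mat_1)

text \<open>Telescoping: factors are exchanged one at a time, and each exchange costs \<delta> times
  the size of the remaining product.\<close>

lemma entry_sum_matrix_prod_diff:
  assumes f: "\<And>n. entry_sum (f n) \<le> g" and h: "\<And>n. entry_sum (h n) \<le> g"
    and d: "\<And>n. entry_sum (f n - h n) \<le> \<delta>" and g: "1 \<le> g"
  shows "entry_sum (matrix_prod f n - matrix_prod h n) \<le> 2 * real n * g ^ n * \<delta>"
proof (induction n)
  case 0
  show ?case by (simp add: entry_sum_2)
next
  case (Suc n)
  have d0: "0 \<le> \<delta>" using d[of 0] entry_sum_nonneg order.trans by blast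
  have "matrix_prod f (Suc n) - matrix_prod h (Suc n)
      = f n ** (matrix_prod f n - matrix_prod h n) + (f n - h n) ** matrix_prod h n"
    by (simp add: vec_eq_iff matrix_mul_2 algebra_simps)
  then have "entry_sum (matrix_prod f (Suc n) - matrix_prod h (Suc n))
      \<le> entry_sum (f n) * entry_sum (matrix_prod f n - matrix_prod h n)
        + entry_sum (f n - h n) * entry_sum (matrix_prod h n)"
    by (simp only:) (intro order.trans[OF entry_sum_triangle] add_mono entry_sum_mult)
  also have "\<dots> \<le> g * (2 * real n * g ^ n * \<delta>) + \<delta> * (2 * g ^ n)"
    using Suc f d g d0 entry_sum_matrix_prod[of h g n, OF h]
    by (intro add_mono mult_mono) (auto simp: entry_sum_nonneg)
  also have "\<dots> \<le> g * (2 * real n * g ^ n * \<delta>) + \<delta> * (2 * g ^ Suc n)"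
    using g d0 by (intro add_left_mono mult_left_mono) (auto intro: power_increasing)
  also have "\<dots> = 2 * real (Suc n) * g ^ Suc n * \<delta>" by (simp add: algebra_simps)
  finally show ?case .
qed

section \<open>Expanded vectors and the wedge product\<close>

lemma norm_vec_2: "norm (x::real^2) = sqrt ((x$1)\<^sup>2 + (x$2)\<^sup>2)"
  by (simp add: norm_vec_def L2_set_def sum_2)

lemma norm_mult_entry_sum:
  fixes M :: "real^2^2"
  shows "norm (M *v x) \<le> entry_sum M * norm x"
proof -
  have a: "\<bar>(M *v x)$i\<bar> \<le> (\<bar>M$i$1\<bar> + \<bar>M$i$2\<bar>) * norm x" for i
  proof -
    have "\<bar>(M *v x)$i\<bar> \<le> \<bar>M$i$1\<bar> * \<bar>x$1\<bar> + \<bar>M$i$2\<bar> * \<bar>x$2\<bar>"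
      by (simp add: matrix_vector_mult_def sum_2 abs_mult[symmetric] abs_triangle_ineq)
    also have "\<dots> \<le> \<bar>M$i$1\<bar> * norm x + \<bar>M$i$2\<bar> * norm x"
      using Finite_Cartesian_Product.norm_nth_le[of x] by (intro add_mono mult_left_mono) auto
    finally show ?thesis by (simp add: algebra_simps)
  qed
  have "norm (M *v x) \<le> \<bar>(M *v x)$1\<bar> + \<bar>(M *v x)$2\<bar>"
    using norm_le_l1_cart[of "M *v x"] by (simp add: sum_2)
  also have "\<dots> \<le> entry_sum M * norm x"
    using a[of 1] a[of 2] by (simp add: entry_sum_2 algebra_simps)
  finally show ?thesis .
qed

text \<open>A unit coordinate vector is enough: the two column norms bound all four entries, so one
  of them reaches a quarter of the entry sum.\<close>

lemma exists_expanded_vector: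
  fixes M :: "real^2^2"
  obtains e where "norm e = 1" "entry_sum M / 4 \<le> norm (M *v e)"
proof -
  have c: "(M *v axis j 1)$i = M$i$j" for i j
    using exhaust_2[of j] by (auto simp: matrix_vector_mult_def sum_2 axis_def)
  have n: "norm (axis j (1::real) :: real^2) = 1" for j by simp
  have "\<bar>M$1$j\<bar> \<le> norm (M *v axis j 1)" "\<bar>M$2$j\<bar> \<le> norm (M *v axis j 1)" for j
    using Finite_Cartesian_Product.norm_nth_le[of "M *v axis j 1" 1]
      Finite_Cartesian_Product.norm_nth_le[of "M *v axis j 1" 2] by (simp_all add: c)
  from this[of 1] this[of 2]
  have "entry_sum M / 4 \<le> norm (M *v axis 1 1) \<or> entry_sum M / 4 \<le> norm (M *v axis 2 1)"
    by (simp add: entry_sum_2) linarith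
  then show ?thesis using that n by blast
qed

text \<open>The area form of the plane. It is invariant under SL(2), and relative to the product of
  the lengths it measures the angle between two lines.\<close>

definition wedge :: "real^2 \<Rightarrow> real^2 \<Rightarrow> real" where
  "wedge x y = x$1 * y$2 - x$2 * y$1"

lemma wedge_SL2:
  assumes "det M = 1"
  shows "wedge (M *v x) (M *v y) = wedge x y"
proof -
  have "wedge (M *v x) (M *v y) = det M * wedge x y"
    by (simp add: wedge_def matrix_vector_mult_def sum_2 det_2 algebra_simps)
  then show ?thesis using assms by simp
qed

lemma lagrange_wedge: "(wedge x y)\<^sup>2 + (x \<bullet> y)\<^sup>2 = (norm x)\<^sup>2 * (norm y)\<^sup>2"
proof -
  have "(norm x)\<^sup>2 = (x$1)\<^sup>2 + (x$2)\<^sup>2" for x :: "real^2" by (simp add: norm_vec_2)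
  then show ?thesis
    by (simp add: wedge_def inner_vec_def sum_2) (simp add: power2_eq_square algebra_simps)
qed

lemma wedge_le: "\<bar>wedge x y\<bar> \<le> norm x * norm y"
proof -
  have "(wedge x y)\<^sup>2 \<le> (norm x * norm y)\<^sup>2"
    using lagrange_wedge[of x y] zero_le_power2[of "x \<bullet> y"] unfolding power_mult_distrib by linarith
  then show ?thesis using abs_le_square_iff[of "wedge x y" "norm x * norm y"] by (simp add: abs_mult)
qed

text \<open>Split x = c y + z with z orthogonal to y. The wedge product is the area spanned by z and
  y, so z is at most 2/g^2 times as long as x. The part c y is expanded by g, and
  \<open>8 * a \<le> g ^ 3\<close> makes the expansion of z by up to a eat at most half of
  this.\<close>

lemma expansion_near:
  fixes M :: "real^2^2"
  assumes g: "3 \<le> g" and Mle: "\<And>v. norm (M *v v) \<le> a * norm v" and ga: "8 * a \<le> g ^ 3"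
    and y: "y \<noteq> 0" "g * norm y \<le> norm (M *v y)"
    and w: "\<bar>wedge x y\<bar> \<le> 2 / g\<^sup>2 * (norm x * norm y)"
  shows "g / 2 * norm x \<le> norm (M *v x)"
proof -
  define c where "c = (x \<bullet> y) / (norm y)\<^sup>2"
  define z where "z = x - c *\<^sub>R y"
  have ny: "0 < norm y" using y by simp
  have a0: "0 \<le> a" using Mle[of y] ny by (meson norm_ge_zero order.trans zero_le_mult_iff not_less)
  have z2: "(norm z)\<^sup>2 * (norm y)\<^sup>2 = (wedge x y)\<^sup>2"
  proof -
    have "(norm z)\<^sup>2 = (norm x)\<^sup>2 - 2 * c * (x \<bullet> y) + c\<^sup>2 * (norm y)\<^sup>2"
      unfolding power2_norm_eq_inner z_def
      by (simp add: inner_diff inner_commute algebra_simps power2_eq_square)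
    then have "(norm z)\<^sup>2 * (norm y)\<^sup>2 = (norm x)\<^sup>2 * (norm y)\<^sup>2 - (x \<bullet> y)\<^sup>2"
      using ny by (simp add: c_def field_simps power2_eq_square)
    then show ?thesis using lagrange_wedge[of x y] by simp
  qed
  then have "norm z * norm y = \<bar>wedge x y\<bar>"
    by (metis abs_of_nonneg norm_ge_zero power2_abs power_mult_distrib real_sqrt_abs zero_le_mult_iff)
  with w have "norm z * norm y \<le> (2 / g\<^sup>2 * norm x) * norm y" by (simp only: mult.assoc)
  then have zx: "norm z \<le> 2 / g\<^sup>2 * norm x" using ny by (rule mult_right_le_imp_le)
  have "2 / g\<^sup>2 \<le> 1/2"
    using power_mono[of 2 g 2] g by (simp add: field_simps)
  have cy: "norm x - norm z \<le> norm (c *\<^sub>R y)"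
    using norm_triangle_ineq2[of x "z"] norm_triangle_ineq[of "c *\<^sub>R y" z] by (simp add: z_def)
  have Mx: "M *v x = c *\<^sub>R (M *v y) + M *v z"
    by (simp add: z_def matrix_vector_mult_diff_distrib matrix_vector_mult_scaleR)
  have "g * norm (c *\<^sub>R y) \<le> norm (c *\<^sub>R (M *v y))"
    using mult_left_mono[OF y(2), of "\<bar>c\<bar>"] by (simp add: mult.left_commute)
  moreover have "norm (c *\<^sub>R (M *v y)) \<le> norm (M *v x) + norm (M *v z)"
    unfolding Mx using norm_triangle_ineq4[of "c *\<^sub>R (M *v y) + M *v z" "M *v z"] by simp
  moreover have "norm (M *v z) \<le> a * norm z" by (rule Mle)
  moreover have "g * (norm x - norm z) \<le> g * norm (c *\<^sub>R y)" using cy g by simp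
  ultimately have "g * norm x - (g + a) * norm z \<le> norm (M *v x)" by (simp add: algebra_simps)
  moreover have "(g + a) * norm z \<le> g / 2 * norm x"
  proof -
    have "(g + a) * norm z \<le> (g + a) * (2 / g\<^sup>2 * norm x)"
      using zx g a0 by (intro mult_left_mono) auto
    also have "(g + a) * 2 / g\<^sup>2 \<le> g / 2"
    proof -
      have "8 * g \<le> (g * g) * g"
        using mult_mono[of 3 g 3 g] g by (intro mult_right_mono) auto
      then have "(g + a) * 2 * 2 \<le> g * g\<^sup>2"
        using ga by (simp add: power3_eq_cube power2_eq_square algebra_simps)
      then show ?thesis using g by (simp add: field_simps)
    qed
    then have "(g + a) * (2 / g\<^sup>2 * norm x) \<le> g / 2 * norm x"
      using mult_right_mono[of "(g + a) * 2 / g\<^sup>2" "g/2" "norm x"] g by (simp add: field_simps)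
    finally show ?thesis .
  qed
  ultimately show ?thesis by simp
qed

text \<open>A vector \<open>x j\<close> is carried along the product. It stays close to the direction \<open>A j e\<^sub>j\<close> expanded
  by the next factor, because the wedge product of the two is preserved while both vectors grow.\<close>

lemma avalanche_lower:
  fixes A :: "nat \<Rightarrow> real^2^2"
  assumes det: "\<And>j. det (A j) = 1" and a: "\<And>j. entry_sum (A j) \<le> a"
    and b: "\<And>j. Suc j < n \<Longrightarrow> 4 * (g * a) \<le> entry_sum (A (Suc j) ** A j)"
    and g: "3 \<le> g" "8 * a \<le> g ^ 3" and n: "2 \<le> n"
  shows "(g / 2) ^ n \<le> entry_sum (matrix_prod A n)"
proof -
  have a1: "1 \<le> a" using entry_sum_ge_1[OF det] a order.trans by blast
  have le: "norm (A j *v v) \<le> a * norm v" for j v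
    using norm_mult_entry_sum[of "A j" v] mult_right_mono[OF a norm_ge_zero, of j v] by simp
  \<comment> \<open>A unit vector for each j that is expanded strongly by two consecutive factors.
    The vectors for different j are unrelated; the wedge product links them below.\<close>
  have "\<exists>e. norm e = 1 \<and> (Suc j < n \<longrightarrow> g * a \<le> norm (A (Suc j) *v (A j *v e)))" for j
  proof -
    obtain e where "norm e = 1" "entry_sum (A (Suc j) ** A j) / 4 \<le> norm ((A (Suc j) ** A j) *v e)"
      using exists_expanded_vector by blast
    then show ?thesis
      using b[of j] by (intro exI[of _ e]) (auto simp: matrix_vector_mul_assoc)
  qed
  then obtain e where e: "\<And>j. norm (e j) = 1"
      "\<And>j. Suc j < n \<Longrightarrow> g * a \<le> norm (A (Suc j) *v (A j *v e j))"
    by metis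
  \<comment> \<open>No factor expands by more than a, so a two-step expansion by g a forces each of
    the two steps to expand by at least g.\<close>
  have yg: "g \<le> norm (A j *v e j)" and ye: "g * norm (A j *v e j) \<le> norm (A (Suc j) *v (A j *v e j))"
    if "Suc j < n" for j
  proof -
    have "g * a \<le> norm (A j *v e j) * a"
      using e(2)[OF that] le[of "Suc j" "A j *v e j"] by (simp add: mult.commute)
    then show "g \<le> norm (A j *v e j)" using a1 by simp
    have "g * norm (A j *v e j) \<le> g * a" using le[of j "e j"] e(1)[of j] g by simp
    then show "g * norm (A j *v e j) \<le> norm (A (Suc j) *v (A j *v e j))"
      using e(2)[OF that] by simp
  qed
  define x where "x j = matrix_prod A j *v e 0" for j
  have xS: "x (Suc j) = A j *v x j" for j by (simp add: x_def matrix_vector_mul_assoc)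
  have grow: "j < n \<Longrightarrow> g / 2 * norm (x j) \<le> norm (x (Suc j))" for j
  proof (induction j)
    case 0
    have "x 0 = e 0" by (simp add: x_def)
    then show ?case using yg[of 0] n g xS[of 0] e(1)[of 0] by simp
  next
    case (Suc j)
    define y where "y = A j *v e j"
    have j: "Suc j < n" by fact
    have gy: "g \<le> norm y" using yg[OF j] by (simp add: y_def)
    have "\<bar>wedge (x (Suc j)) y\<bar> = \<bar>wedge (x j) (e j)\<bar>"
      by (simp add: xS y_def wedge_SL2[OF det])
    also have "\<dots> \<le> norm (x j)" using wedge_le[of "x j" "e j"] e(1)[of j] by simp
    also have "\<dots> \<le> 2 / g * norm (x (Suc j))" using Suc g by (simp add: field_simps)
    also have "\<dots> = 2 / g\<^sup>2 * (norm (x (Suc j)) * g)" using g by (simp add: power2_eq_square)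
    also have "\<dots> \<le> 2 / g\<^sup>2 * (norm (x (Suc j)) * norm y)"
      using gy by (intro mult_left_mono) auto
    finally have w: "\<bar>wedge (x (Suc j)) y\<bar> \<le> 2 / g\<^sup>2 * (norm (x (Suc j)) * norm y)" .
    have "g / 2 * norm (x (Suc j)) \<le> norm (A (Suc j) *v x (Suc j))"
      by (rule expansion_near[OF g(1) le g(2) _ _ w]) (use gy g ye[OF j] in \<open>auto simp: y_def\<close>)
    then show ?case by (simp add: xS)
  qed
  have "j \<le> n \<Longrightarrow> (g / 2) ^ j \<le> norm (x j)" for j
  proof (induction j)
    case 0
    show ?case by (simp add: x_def e)
  next
    case (Suc j)
    have "(g / 2) ^ Suc j \<le> g / 2 * norm (x j)" using Suc g by (simp add: mult_left_mono)
    then show ?case using grow[of j] Suc by simp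
  qed
  from this[of n] have "(g / 2) ^ n \<le> norm (x n)" by simp
  also have "\<dots> \<le> entry_sum (matrix_prod A n)"
    using norm_mult_entry_sum[of "matrix_prod A n" "e 0"] e(1)[of 0] by (simp add: x_def)
  finally show ?thesis .
qed

section \<open>Convergents and the density of finite orbits\<close>

lemma frac_in_Rats_iff: "frac x \<in> \<rat> \<longleftrightarrow> x \<in> \<rat>"
  unfolding frac_def by (metis Rats_add Rats_diff Rats_of_int diff_add_cancel)

lemma cf_complete_irrational: "\<alpha> \<notin> \<rat> \<Longrightarrow> cf_complete \<alpha> n \<notin> \<rat>"
proof (induction n)
  case (Suc n)
  then have "frac (cf_complete \<alpha> n) \<notin> \<rat>" by (simp add: frac_in_Rats_iff)
  then show ?case using Rats_inverse[of "inverse (frac (cf_complete \<alpha> n))"] by (auto simp: inverse_eq_divide)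
qed simp

lemma cf_complete_gt_1:
  assumes "\<alpha> \<notin> \<rat>"
  shows "1 < cf_complete \<alpha> (Suc n)"
proof -
  have "frac (cf_complete \<alpha> n) \<noteq> 0"
    using cf_complete_irrational[OF assms, of n] frac_in_Rats_iff[of "cf_complete \<alpha> n"] by (metis Rats_0)
  then have "0 < frac (cf_complete \<alpha> n)" "frac (cf_complete \<alpha> n) < 1"
    using frac_ge_0[of "cf_complete \<alpha> n"] frac_lt_1[of "cf_complete \<alpha> n"] by linarith+
  then show ?thesis by simp
qed

lemma cf_complete_rec:
  assumes "\<alpha> \<notin> \<rat>"
  shows "cf_complete \<alpha> n = of_int (cf_partial \<alpha> n) + 1 / cf_complete \<alpha> (Suc n)"
  by (simp add: cf_partial_def frac_def)

lemma cf_partial_ge_1: "\<alpha> \<notin> \<rat> \<Longrightarrow> 1 \<le> cf_partial \<alpha> (Suc n)"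
  using cf_complete_gt_1[of \<alpha> n] unfolding cf_partial_def by linarith

text \<open>\<open>Omega\<close> mentions the denominators only; the numerators are needed to say
  which fractions approximate \<alpha>.\<close>

fun cf_num :: "real \<Rightarrow> nat \<Rightarrow> int" where
  "cf_num \<alpha> 0 = cf_partial \<alpha> 0"
| "cf_num \<alpha> (Suc 0) = cf_partial \<alpha> 1 * cf_partial \<alpha> 0 + 1"
| "cf_num \<alpha> (Suc (Suc n)) = cf_partial \<alpha> (Suc (Suc n)) * cf_num \<alpha> (Suc n) + cf_num \<alpha> n"

lemma cf_denom_pos: "\<alpha> \<notin> \<rat> \<Longrightarrow> 0 < cf_denom \<alpha> n"
proof (induction \<alpha> n rule: cf_denom.induct)
  case (2 \<alpha>)
  then show ?case using cf_partial_ge_1[of \<alpha> 0] by simp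
next
  case (3 \<alpha> n)
  then show ?case using cf_partial_ge_1[of \<alpha> "Suc n"] by (simp add: add_pos_pos)
qed simp

lemma cf_denom_step: "\<alpha> \<notin> \<rat> \<Longrightarrow> cf_denom \<alpha> (Suc n) + cf_denom \<alpha> n \<le> cf_denom \<alpha> (Suc (Suc n))"
  using cf_partial_ge_1[of \<alpha> "Suc n"] cf_denom_pos[of \<alpha> "Suc n"] by simp

lemma cf_denom_ge: "\<alpha> \<notin> \<rat> \<Longrightarrow> int n \<le> cf_denom \<alpha> n"
proof (induction n)
  case 0
  then show ?case by simp
next
  case (Suc n)
  show ?case
  proof (cases n)
    case 0
    then show ?thesis using cf_partial_ge_1[OF Suc.prems, of 0] by simp
  next
    case (Suc k)
    then show ?thesis
      using cf_denom_step[OF Suc.prems, of k] cf_denom_pos[OF Suc.prems, of k] Suc.IH Suc.prems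
      by (simp del: cf_denom.simps)
  qed
qed

lemma cf_det: "\<bar>cf_num \<alpha> (Suc n) * cf_denom \<alpha> n - cf_num \<alpha> n * cf_denom \<alpha> (Suc n)\<bar> = 1"
proof (induction n)
  case (Suc n)
  have "cf_num \<alpha> (Suc (Suc n)) * cf_denom \<alpha> (Suc n) - cf_num \<alpha> (Suc n) * cf_denom \<alpha> (Suc (Suc n))
      = - (cf_num \<alpha> (Suc n) * cf_denom \<alpha> n - cf_num \<alpha> n * cf_denom \<alpha> (Suc n))"
    by (simp add: algebra_simps)
  then show ?case using Suc by (simp only: abs_minus_cancel)
qed (simp add: algebra_simps)

text \<open>This is \<alpha> = (x p' + p) / (x q' + q), cleared of its denominator, where p/q and
  p'/q' are consecutive convergents and x is the next complete quotient.\<close>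

lemma cf_complete_eq:
  assumes "\<alpha> \<notin> \<rat>"
  shows "\<alpha> * (cf_complete \<alpha> (Suc (Suc n)) * cf_denom \<alpha> (Suc n) + cf_denom \<alpha> n)
    = cf_complete \<alpha> (Suc (Suc n)) * cf_num \<alpha> (Suc n) + cf_num \<alpha> n"
proof (induction n)
  case 0
  define x1 x2 where "x1 = cf_complete \<alpha> 1" and "x2 = cf_complete \<alpha> 2"
  have "1 < x1" "1 < x2"
    using cf_complete_gt_1[OF assms, of 0] cf_complete_gt_1[OF assms, of 1]
    by (simp_all add: x1_def x2_def numeral_2_eq_2)
  moreover have "\<alpha> = of_int (cf_partial \<alpha> 0) + 1 / x1" "x1 = of_int (cf_partial \<alpha> 1) + 1 / x2"
    using cf_complete_rec[OF assms, of 0] cf_complete_rec[OF assms, of 1]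
    unfolding x1_def x2_def by (simp_all only: cf_complete.simps(1) One_nat_def numeral_2_eq_2)
  moreover from calculation have "(x1 - of_int (cf_partial \<alpha> 1)) * x2 = 1" by simp
  moreover from calculation have "\<alpha> - of_int (cf_partial \<alpha> 0) = 1 / x1" "x1 \<noteq> 0" by linarith+
  then have "(\<alpha> - of_int (cf_partial \<alpha> 0)) * x1 = 1" by simp
  ultimately have "\<alpha> * x1 = of_int (cf_partial \<alpha> 0) * x1 + 1" "x1 * x2 = of_int (cf_partial \<alpha> 1) * x2 + 1"
    by (simp_all only: left_diff_distrib diff_eq_eq add.commute)
  then have "\<alpha> * (x2 * of_int (cf_partial \<alpha> 1) + 1)
      = x2 * (of_int (cf_partial \<alpha> 1) * of_int (cf_partial \<alpha> 0) + 1) + of_int (cf_partial \<alpha> 0)"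
    by algebra
  then show ?case by (simp only: cf_denom.simps cf_num.simps x2_def numeral_2_eq_2 One_nat_def of_int_add of_int_mult of_int_1)
next
  case (Suc n)
  define x y where "x = cf_complete \<alpha> (Suc (Suc n))" and "y = cf_complete \<alpha> (Suc (Suc (Suc n)))"
  define a where "a = real_of_int (cf_partial \<alpha> (Suc (Suc n)))"
  have "1 < y" using cf_complete_gt_1[OF assms, of "Suc (Suc n)"] by (simp only: y_def)
  moreover have "x = a + 1 / y" using cf_complete_rec[OF assms, of "Suc (Suc n)"] by (simp only: x_def y_def a_def)
  ultimately have "x * y = a * y + 1" by (simp add: field_simps)
  moreover have "\<alpha> * (x * cf_denom \<alpha> (Suc n) + cf_denom \<alpha> n) = x * cf_num \<alpha> (Suc n) + cf_num \<alpha> n"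
    using Suc by (simp only: x_def)
  ultimately have "\<alpha> * (y * (a * cf_denom \<alpha> (Suc n) + cf_denom \<alpha> n) + cf_denom \<alpha> (Suc n))
     = y * (a * cf_num \<alpha> (Suc n) + cf_num \<alpha> n) + cf_num \<alpha> (Suc n)"
    by algebra
  then show ?case
    by (simp only: cf_denom.simps cf_num.simps x_def y_def a_def of_int_add of_int_mult)
qed

text \<open>All that the deviation estimate needs to know about q. It separates the analysis at one
  scale from the continued fraction, which matters only for how far apart the scales are.\<close>

definition good_denom :: "real \<Rightarrow> nat \<Rightarrow> bool" where
  "good_denom \<alpha> q \<longleftrightarrow> 0 < q \<and> (\<exists>p::int. coprime p (int q) \<and> \<bar>\<alpha> - p / q\<bar> \<le> 1 / (real q)\<^sup>2)"

text \<open>Multiplied by x q + q', the difference \<alpha> q - p becomes \<plusminus>1 by the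
  determinant identity, and that multiplier is at least q. The same identity gives
  coprimality.\<close>

lemma good_denom_cf:
  assumes "\<alpha> \<notin> \<rat>"
  shows "good_denom \<alpha> (nat (cf_denom \<alpha> (Suc n)))"
proof -
  define p q p' q' where "p = cf_num \<alpha> (Suc n)" and "q = cf_denom \<alpha> (Suc n)"
    and "p' = cf_num \<alpha> n" and "q' = cf_denom \<alpha> n"
  define x where "x = cf_complete \<alpha> (Suc (Suc n))"
  have q: "0 < q" "0 < q'" using cf_denom_pos[OF assms] by (auto simp: q_def q'_def)
  have x: "1 < x" using cf_complete_gt_1[OF assms, of "Suc n"] by (simp only: x_def)
  have det: "\<bar>p * q' - p' * q\<bar> = 1" using cf_det[of \<alpha> n] by (simp only: p_def q_def p'_def q'_def)
  have eq: "\<alpha> * (x * q + q') = x * p + p'" using cf_complete_eq[OF assms, of n]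
    by (simp only: p_def q_def p'_def q'_def x_def)
  have D: "0 < x * q + q'" "real_of_int q \<le> x * q + q'"
    using q x by (auto intro!: add_pos_pos mult_pos_pos add_increasing2) 
  have "(\<alpha> * q - p) * (x * q + q') = real_of_int p' * q - real_of_int p * q'"
    using eq by algebra
  then have "(\<alpha> * q - p) * (x * q + q') = - real_of_int (p * q' - p' * q)" by simp
  then have "\<bar>\<alpha> * q - p\<bar> * (x * q + q') = 1"
    using D det by (metis abs_minus_cancel abs_mult abs_of_pos of_int_1 of_int_abs)
  then have "\<bar>\<alpha> * q - p\<bar> * q \<le> 1"
    using D mult_left_mono[OF D(2), of "\<bar>\<alpha> * q - p\<bar>"] by simp
  moreover have "\<bar>\<alpha> - p / q\<bar> * q = \<bar>\<alpha> * q - p\<bar>"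
    using q by (simp add: field_simps abs_mult_pos')
  ultimately have "\<bar>\<alpha> - p / q\<bar> \<le> 1 / (real_of_int q)\<^sup>2"
    using q by (simp add: field_simps power2_eq_square)
  moreover have "coprime p q"
  proof (rule coprimeI)
    fix c assume "c dvd p" "c dvd q"
    then have "c dvd p * q' - p' * q" by (simp add: dvd_diff dvd_mult dvd_mult2)
    then show "is_unit c" using det by (metis dvd_abs_iff)
  qed
  ultimately show ?thesis unfolding good_denom_def using q by (auto simp: q_def)
qed

text \<open>The points \<open>y + j \<alpha>\<close> follow \<open>y + j p / q\<close> to within \<open>1/q\<close>, and the latter are \<open>1/q\<close>-spaced.\<close>

lemma orbit_dense:
  assumes "good_denom \<alpha> q"
  obtains j :: nat and k :: int where "j < q" "\<bar>y + real j * \<alpha> - of_int k\<bar> \<le> 2 / real q"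
proof -
  obtain p where q: "0 < q" and p: "coprime p (int q)" and ap: "\<bar>\<alpha> - p / q\<bar> \<le> 1 / (real q)\<^sup>2"
    using assms by (auto simp: good_denom_def)
  \<comment> \<open>\<open>t\<close> puts y + t/q into [0, 1/q]. Since b will invert p modulo q, the
    time j = t b mod q satisfies j p = t modulo q.\<close>
  define t where "t = - \<lfloor>y * q\<rfloor>"
  obtain b v where b: "b * p + v * int q = 1"
    using bezout_int[of p "int q"] p by auto
  define j where "j = nat ((t * b) mod int q)"
  have j: "int j = (t * b) mod int q" "j < q" using q by (auto simp: j_def nat_less_iff)
  have "p * int j - t = p * (t * b - int q * ((t * b) div int q)) - t * (b * p + v * int q)"
    unfolding j by (simp add: b minus_mult_div_eq_mod)
  also have "\<dots> = int q * (- p * ((t * b) div int q) - t * v)" by (simp add: algebra_simps)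
  finally have "int q dvd p * int j - t" by simp
  then obtain l where l: "p * int j = t + int q * l" by (metis dvdE add.commute diff_add_cancel)
  have 1: "real j * (p / q) = t / q + l"
    using q arg_cong[OF l, of real_of_int] by (simp add: field_simps)
  have "\<bar>real j * \<alpha> - real j * (p / q)\<bar> = real j * \<bar>\<alpha> - p / q\<bar>"
    by (simp only: abs_mult abs_of_nat flip: right_diff_distrib)
  also have "\<dots> \<le> real q * (1 / (real q)\<^sup>2)" using j ap by (intro mult_mono) auto
  also have "\<dots> = 1 / q" using q by (simp add: power2_eq_square)
  finally have 2: "\<bar>real j * \<alpha> - (t / q + l)\<bar> \<le> 1 / q" using 1 by simp
  have "0 \<le> y * q + t" "y * q + t \<le> 1" unfolding t_def by linarith+
  then have "0 \<le> (y * q + t) / q" "(y * q + t) / q \<le> 1 / q"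
    using q by (auto intro: divide_right_mono)
  moreover have "(y * q + t) / q = y + t / q" using q by (simp add: add_divide_distrib)
  ultimately have "\<bar>y + t / q\<bar> \<le> 1 / q" by simp
  then have "\<bar>y + real j * \<alpha> - of_int l\<bar> \<le> 2 / real q"
    using 2 by (simp add: abs_le_iff)
  then show ?thesis using that j by blast
qed

definition cf_denoms :: "real \<Rightarrow> nat set" where
  "cf_denoms \<alpha> = {nat (cf_denom \<alpha> (Suc n)) |n. True}"

lemma cf_denoms_unbounded:
  assumes "\<alpha> \<notin> \<rat>"
  obtains q where "q \<in> cf_denoms \<alpha>" "X \<le> real q"
proof
  show "nat (cf_denom \<alpha> (Suc (nat \<lceil>X\<rceil>))) \<in> cf_denoms \<alpha>" by (auto simp: cf_denoms_def)
  show "X \<le> real (nat (cf_denom \<alpha> (Suc (nat \<lceil>X\<rceil>))))"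
    using cf_denom_ge[OF assms, of "Suc (nat \<lceil>X\<rceil>)"] by linarith
qed

text \<open>Take the first denominator beyond \<open>q powr (1 + \<delta>)\<close>. Its predecessor
  still lies below this power, so the condition of \<open>Omega\<close> at the predecessor bounds
  the logarithm of the chosen one. The two bounds make ln q grow geometrically along a chain of
  scales without any scale outrunning exp (q^\<sigma>).\<close>

lemma Omega_gap:
  assumes "\<alpha> \<in> Omega \<eta>" "0 < \<eta>"
  obtains C where "0 < C" "\<And>q \<delta>. q \<in> cf_denoms \<alpha> \<Longrightarrow> 2 \<le> q \<Longrightarrow> 0 < \<delta> \<Longrightarrow>
    \<exists>q'\<in>cf_denoms \<alpha>. real q powr (1 + \<delta>) \<le> real q' \<and> ln (real q') \<le> C * real q powr ((1 + \<delta>) * \<eta>)"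
proof -
  from assms obtain C where irr: "\<alpha> \<notin> \<rat>" and C: "0 < C"
      "\<And>n. ln (of_int (cf_denom \<alpha> (Suc n))) \<le> C * of_int (cf_denom \<alpha> n) powr \<eta>"
    by (auto simp: Omega_def)
  show ?thesis
  proof (rule that[OF C(1)])
    fix q \<delta> assume q: "q \<in> cf_denoms \<alpha>" "2 \<le> q" and d: "0 < (\<delta>::real)"
    then obtain n where n: "q = nat (cf_denom \<alpha> (Suc n))" by (auto simp: cf_denoms_def)
    define P where "P m \<longleftrightarrow> real q powr (1 + \<delta>) \<le> of_int (cf_denom \<alpha> (Suc m))" for m
    have "P (nat \<lceil>real q powr (1 + \<delta>)\<rceil>)"
      unfolding P_def using cf_denom_ge[OF irr, of "Suc (nat \<lceil>real q powr (1 + \<delta>)\<rceil>)"] by linarith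
    then have PL: "P (Least P)" by (rule LeastI)
    have "\<exists>q'. q' = cf_denom \<alpha> (Least P) \<and> 0 < q' \<and> of_int q' \<le> real q powr (1 + \<delta>)"
    \<comment> \<open>If the search stops at once, the predecessor is q_0 = 1, which is below any
      power of q.\<close>
    proof (cases "Least P")
      case 0
      then show ?thesis using q d by (auto intro!: ge_one_powr_ge_zero)
    next
      case (Suc m)
      then have "\<not> P m" using not_less_Least[of m P] by simp
      then show ?thesis using Suc cf_denom_pos[OF irr] by (auto simp: P_def)
    qed
    then obtain r where r: "r = cf_denom \<alpha> (Least P)" "0 < r" "of_int r \<le> real q powr (1 + \<delta>)" by blast
    have "ln (of_int (cf_denom \<alpha> (Suc (Least P)))) \<le> C * of_int r powr \<eta>" using C(2) r by simp
    also have "\<dots> \<le> C * (real q powr (1 + \<delta>)) powr \<eta>"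
      using r C assms(2) by (intro mult_left_mono powr_mono2) auto
    finally have "ln (of_int (cf_denom \<alpha> (Suc (Least P)))) \<le> C * real q powr ((1 + \<delta>) * \<eta>)"
      by (simp add: powr_powr)
    moreover have "real (nat (cf_denom \<alpha> (Suc (Least P)))) = of_int (cf_denom \<alpha> (Suc (Least P)))"
      using cf_denom_pos[OF irr, of "Suc (Least P)"] by simp
    ultimately show "\<exists>q'\<in>cf_denoms \<alpha>. real q powr (1 + \<delta>) \<le> real q' \<and> ln (real q') \<le> C * real q powr ((1 + \<delta>) * \<eta>)"
      using PL by (intro bexI[of _ "nat (cf_denom \<alpha> (Suc (Least P)))"]) (auto simp: P_def cf_denoms_def)
  qed
qed

section \<open>Lower bounds for analytic functions\<close>

lemma holomorphic_factor_zero: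
  assumes "f holomorphic_on S" "open S" "a \<in> S" "f a = 0"
  obtains k where "k holomorphic_on S" "\<And>z. z \<in> S \<Longrightarrow> f z = (z - a) * k z"
proof
  show "(\<lambda>z. if z = a then deriv f a else (f z - f a) / (z - a)) holomorphic_on S"
    using assms by (intro pole_lemma) (auto simp: interior_open)
  show "f z = (z - a) * (if z = a then deriv f a else (f z - f a) / (z - a))" if "z \<in> S" for z
    using assms(4) by simp
qed

text \<open>With F = f(2z) - f(0) and c the gap between the bound and Re f(0), the map F / (2c - F)
  takes the unit disc into itself and fixes 0. The Schwarz lemma at radius 1/2 gives |F| \<le> (2c +
  |F|) / 2, hence |F| \<le> 2c.\<close>

lemma borel_caratheodory_half:
  fixes f :: "complex \<Rightarrow> complex"
  assumes hol: "f holomorphic_on ball 0 2" and less: "\<And>z. norm z < 2 \<Longrightarrow> Re (f z) < m"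
    and f0: "0 \<le> Re (f 0)" and z: "norm z \<le> 1"
  shows "- 2 * m \<le> Re (f z)"
proof -
  define c where "c = m - Re (f 0)"
  have c: "0 < c" "c \<le> m" using less[of 0] f0 by (auto simp: c_def)
  define F where "F z = f (2 * z) - f 0" for z
  define h where "h z = F z / (2 * of_real c - F z)" for z
  have ReF: "Re (F z) < c" if "norm z < 1" for z
    using less[of "2 * z"] that by (simp add: F_def c_def norm_mult)
  have ne: "2 * of_real c - F z \<noteq> 0" if "norm z < 1" for z
  proof
    assume "2 * of_real c - F z = 0"
    then have "Re (2 * of_real c - F z) = 0" by simp
    then show False using ReF[OF that] c by simp
  qed
  have "(\<lambda>z. f (2 * z)) holomorphic_on ball 0 1"
    by (rule holomorphic_on_compose_gen[of "\<lambda>z. 2 * z" "ball 0 1" f "ball 0 2", unfolded o_def])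
       (auto simp: norm_mult intro!: holomorphic_intros hol)
  then have holF: "F holomorphic_on ball 0 1"
    unfolding F_def by (intro holomorphic_intros)
  have holh: "h holomorphic_on ball 0 1"
    unfolding h_def using ne by (intro holomorphic_intros holF) auto
  have lt: "norm (h z) < 1" if z: "norm z < 1" for z
  proof -
    have "(norm (2 * of_real c - F z))\<^sup>2 - (norm (F z))\<^sup>2 = 4 * c * (c - Re (F z))"
      unfolding cmod_power2 by (simp add: power2_eq_square algebra_simps)
    moreover have "0 < 4 * c * (c - Re (F z))" using ReF[OF z] c by simp
    ultimately have "(norm (F z))\<^sup>2 < (norm (2 * of_real c - F z))\<^sup>2" by linarith
    then have "norm (F z) < norm (2 * of_real c - F z)"
      by (rule power2_less_imp_less) (rule norm_ge_zero)
    then show ?thesis using ne[OF z] by (simp add: h_def norm_divide divide_less_eq)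
  qed
  define w where "w = z / 2"
  have w: "norm w \<le> 1/2" "norm w < 1" using z by (auto simp: w_def norm_divide)
  have "norm (h w) \<le> norm w"
    using Schwarz_Lemma(1)[OF holh _ lt w(2)] by (simp add: h_def F_def)
  then have "norm (F w) \<le> norm w * norm (2 * of_real c - F w)"
    using ne[OF w(2)] by (simp add: h_def norm_divide divide_le_eq)
  also have "\<dots> \<le> 1/2 * norm (2 * of_real c - F w)" using w by (intro mult_right_mono) auto
  also have "\<dots> \<le> 1/2 * (norm (2 * of_real c :: complex) + norm (F w))"
    by (intro mult_left_mono norm_triangle_ineq4) auto
  finally have "norm (F w) \<le> 2 * c" using c by (simp add: norm_mult)
  then have "- 2 * c \<le> Re (F w)" using abs_Re_le_cmod[of "F w"] by linarith
  then show ?thesis using c f0 by (simp add: F_def w_def c_def)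
qed

text \<open>The factors \<open>4 (z - a) / (16 - cnj a * z)\<close> have modulus 1 on the circle of radius 4.\<close>

lemma blaschke_circle:
  assumes "norm (z::complex) = 4"
  shows "norm (16 - cnj a * z) = 4 * norm (z - a)"
proof -
  have "(norm (16 - cnj a * z))\<^sup>2 = (4 * norm (z - a))\<^sup>2"
  proof -
    have n: "Re z * Re z + Im z * Im z = 16"
      using assms cmod_power2[of z] by (simp add: power2_eq_square)
    have "(norm (16 - cnj a * z))\<^sup>2 - (4 * norm (z - a))\<^sup>2
      = (Re z * Re z + Im z * Im z - 16) * (Re a * Re a + Im a * Im a - 16)"
      unfolding power_mult_distrib cmod_power2 by (simp add: power2_eq_square algebra_simps)
    then show ?thesis using n by simp
  qed
  then show ?thesis by (rule power2_eq_imp_eq) auto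
qed

lemma blaschke_nonzero:
  assumes "norm (a::complex) \<le> 2" "norm z \<le> 4"
  shows "16 - cnj a * z \<noteq> 0" "norm (16 - cnj a * z) \<le> 24"
proof -
  have "norm (cnj a * z) \<le> 2 * 4" unfolding norm_mult using assms by (intro mult_mono) auto
  then show "norm (16 - cnj a * z) \<le> 24"
    using norm_triangle_ineq4[of 16 "cnj a * z"] by simp
  show "16 - cnj a * z \<noteq> 0" using \<open>norm (cnj a * z) \<le> 2 * 4\<close> by auto
qed

lemma norm_prod_list: "norm (prod_list (map f xs) :: complex) = prod_list (map (\<lambda>x. norm (f x)) xs)"
  by (induction xs) (simp_all add: norm_mult)

lemma prod_list_ge_power:
  assumes "\<And>x. x \<in> set xs \<Longrightarrow> c \<le> f x" "0 \<le> (c::real)"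
  shows "c ^ length xs \<le> prod_list (map f xs)"
  using assms
proof (induction xs)
  case (Cons x xs)
  then show ?case using mult_mono[of c "f x" "c ^ length xs" "prod_list (map f xs)"]
    by (auto intro: order.trans[OF Cons.prems(2)])
qed simp

lemma holomorphic_on_prod_list:
  "(\<And>a. (\<lambda>z. f a z) holomorphic_on S) \<Longrightarrow> (\<lambda>z. prod_list (map (\<lambda>a. f a z) xs)) holomorphic_on S"
  by (induction xs) (auto intro: holomorphic_intros)

text \<open>\<open>K\<close> is f with the Blaschke factors of the listed zeros divided out. On the
  circle of radius 4 this does not change the modulus, so the maximum principle keeps the upper
  bound. At 0 each factor has modulus |a|/4 \<le> 1/2, so each zero at least doubles |K 0|. Together
  the two bounds limit the number of zeros.\<close>

lemma jensen_bound:
  fixes f :: "complex \<Rightarrow> complex"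
  assumes S: "open S" "cball 0 4 \<subseteq> S" and k: "k holomorphic_on S"
    and f: "\<And>z. z \<in> S \<Longrightarrow> f z = prod_list (map (\<lambda>a. z - a) as) * k z"
    and as: "\<And>a. a \<in> set as \<Longrightarrow> norm a \<le> 2"
    and f0: "norm (f 0) = 1" and le: "\<And>z. norm z \<le> 4 \<Longrightarrow> norm (f z) \<le> exp m"
  defines "K \<equiv> \<lambda>z. k z * prod_list (map (\<lambda>a. (16 - cnj a * z) / 4) as)"
  shows "\<And>z. norm z \<le> 4 \<Longrightarrow> norm (K z) \<le> exp m" "2 ^ length as \<le> norm (K 0)"
proof -
  have holK: "K holomorphic_on S"
    unfolding K_def by (intro holomorphic_on_mult k holomorphic_on_prod_list) (auto intro!: holomorphic_intros)
  fix z :: complex assume z: "norm z \<le> 4"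
  show "norm (K z) \<le> exp m"
  proof (rule maximum_modulus_frontier[where S="cball 0 4" and f=K and \<xi>=z])
    show "K holomorphic_on interior (cball 0 4)"
      using holK S by (rule_tac holomorphic_on_subset) auto
    show "continuous_on (closure (cball 0 4)) K"
      using holK S holomorphic_on_imp_continuous_on continuous_on_subset by (metis closed_cball closure_closed)
    fix z :: complex assume "z \<in> frontier (cball 0 4)"
    then have z: "norm z = 4" by (simp add: frontier_cball)
    have zS: "z \<in> S" using S z by auto
    have e: "norm ((16 - cnj a * z) / 4) = norm (z - a)" for a
      using blaschke_circle[OF z, of a] by (simp add: norm_divide)
    have "norm (K z) = norm (f z)"
      unfolding f[OF zS] K_def norm_mult norm_prod_list e by (simp add: mult.commute)
    then show "norm (K z) \<le> exp m" using le[of z] z by simp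
  qed (use z in auto)
next
  have 0: "0 \<in> S" using S by auto
  have "norm (k 0) * prod_list (map norm as) = 1"
    using f[OF 0] f0 by (simp add: norm_mult norm_prod_list mult.commute)
  moreover have "prod_list (map norm as) \<le> 2 ^ length as" 
    using as by (induction as) (auto intro!: mult_mono prod_list_nonneg)
  ultimately have "1 \<le> norm (k 0) * 2 ^ length as"
    by (metis mult_left_mono norm_ge_zero)
  then have "2 ^ length as \<le> norm (k 0) * (2 ^ length as * 2 ^ length as)"
    by (simp add: mult.assoc[symmetric])
  also have "(2 ^ length as * 2 ^ length as :: real) = prod_list (map (\<lambda>a. 4) as)"
    by (induction as) auto
  finally show "2 ^ length as \<le> norm (K 0)"
    by (simp add: K_def norm_mult norm_prod_list)
qed

text \<open>Divide out as many zeros as possible by Blaschke factors. What is left has no zeros in the disc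
  of radius 2, so its logarithm is controlled by the Borel--Caratheodory inequality.\<close>

lemma cartan_estimate:
  fixes f :: "complex \<Rightarrow> complex"
  assumes hol: "f holomorphic_on S" and S: "open S" "cball 0 4 \<subseteq> S"
    and f0: "norm (f 0) = 1" and le: "\<And>z. norm z \<le> 4 \<Longrightarrow> norm (f z) \<le> exp m"
  obtains F :: "real set" where "finite F" "real (card F) \<le> 2 * m"
    "\<And>x \<epsilon>. \<bar>x\<bar> \<le> 1 \<Longrightarrow> 0 < \<epsilon> \<Longrightarrow> \<epsilon> \<le> 1 \<Longrightarrow> (\<And>a. a \<in> F \<Longrightarrow> \<epsilon> \<le> \<bar>x - a\<bar>) \<Longrightarrow>
       exp (- 2 * (m + 1) - 2 * m * ln (6 / \<epsilon>)) \<le> norm (f (of_real x))"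
proof -
  \<comment> \<open>Zeros in the disc of radius 2 are counted with multiplicity as linear factors
    that can be split off. Jensen's bound limits their number, so a maximal factorization exists,
    and its cofactor cannot vanish in that disc.\<close>
  define P where "P n \<longleftrightarrow> (\<exists>as k. length as = n \<and> k holomorphic_on S \<and> (\<forall>a\<in>set as. norm a \<le> 2) \<and>
      (\<forall>z\<in>S. f z = prod_list (map (\<lambda>a. z - a) as) * k z))" for n
  have bound: "2 ^ n \<le> exp m" if Pn: "P n" for n
  proof -
    obtain as k where ask: "length as = n" "k holomorphic_on S" "\<And>a. a \<in> set as \<Longrightarrow> norm a \<le> 2"
      "\<And>z. z \<in> S \<Longrightarrow> f z = prod_list (map (\<lambda>a. z - a) as) * k z"
      using Pn unfolding P_def by blast
    show ?thesis
      using jensen_bound(2)[OF S ask(2,4,3) f0 le] jensen_bound(1)[OF S ask(2,4,3) f0 le, of 0] ask(1)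
      by simp
  qed
  have P0: "P 0" unfolding P_def by (rule exI[of _ "[]"]) (use hol in auto)
  have Pb: "n \<le> nat \<lceil>exp m\<rceil>" if "P n" for n
  proof -
    have "real n < 2 ^ n" using of_nat_less_two_power[of n, where 'a=real] by simp
    then show ?thesis using bound[OF that] by linarith
  qed
  define n where "n = Greatest P"
  have Pn: "P n" unfolding n_def by (rule GreatestI_nat[of P 0, OF P0 Pb])
  have nP: "\<not> P (Suc n)" using Greatest_le_nat[of P "Suc n" "nat \<lceil>exp m\<rceil>"] Pb by (fastforce simp: n_def)
  obtain as k where ask: "length as = n" "k holomorphic_on S" "\<And>a. a \<in> set as \<Longrightarrow> norm a \<le> 2"
      "\<And>z. z \<in> S \<Longrightarrow> f z = prod_list (map (\<lambda>a. z - a) as) * k z"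
    using Pn unfolding P_def by blast
  define K where "K z = k z * prod_list (map (\<lambda>a. (16 - cnj a * z) / 4) as)" for z
  have Kle: "norm (K z) \<le> exp m" if "norm z \<le> 4" for z
    unfolding K_def using jensen_bound(1)[OF S ask(2,4,3) f0 le] that by blast
  have "2 ^ length as \<le> norm (K 0)"
    unfolding K_def using jensen_bound(2)[OF S ask(2,4,3) f0 le] by blast
  then have K0: "1 \<le> norm (K 0)" using one_le_power[of "2::real" "length as"] by linarith
  have n2: "real n \<le> 2 * m"
  proof -
    have "real n * ln 2 \<le> m"
      using bound[OF Pn] by (metis ln_exp ln_le_cancel_iff ln_realpow zero_less_numeral zero_less_power exp_gt_zero)
    moreover have "real n * (1/2) \<le> real n * ln 2"
      using ln2_ge_two_thirds by (intro mult_left_mono) auto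
    ultimately show ?thesis by simp
  qed
  have kne: "k z \<noteq> 0" if z: "norm z \<le> 2" for z
  proof
    assume "k z = 0"
    moreover have "z \<in> S" using S z by auto
    ultimately obtain k' where k': "k' holomorphic_on S" "\<And>w. w \<in> S \<Longrightarrow> k w = (w - z) * k' w"
      using holomorphic_factor_zero[OF ask(2) S(1), of z] by blast
    have "P (Suc n)" unfolding P_def
      using ask k' z by (intro exI[of _ "z # as"] exI[of _ k']) (auto simp: algebra_simps)
    then show False using nP by simp
  qed
  have Kne: "K z \<noteq> 0" if "norm z \<le> 2" for z
    using kne[OF that] blaschke_nonzero(1)[OF ask(3), of _ z] that
    by (auto simp: K_def prod_list_zero_iff)
  have holK: "K holomorphic_on ball 0 2"
    unfolding K_def using S
    by (intro holomorphic_on_mult holomorphic_on_subset[OF ask(2)] holomorphic_on_prod_list)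
       (auto intro!: holomorphic_intros)
  have "simply_connected (ball (0::complex) 2)" by (simp add: convex_imp_simply_connected)
  then obtain \<phi> where \<phi>: "\<phi> holomorphic_on ball 0 2" "\<And>z. z \<in> ball 0 2 \<Longrightarrow> K z = exp (\<phi> z)"
    using holK Kne simply_connected_eq_holomorphic_log[OF open_ball, of 0 2] by (metis less_imp_le mem_ball_0)
  have Re\<phi>: "Re (\<phi> z) = ln (norm (K z))" if "norm z < 2" for z using \<phi>(2)[of z] that by simp
  have low: "exp (- 2 * (m + 1)) \<le> norm (K z)" if z: "norm z \<le> 1" for z
  proof -
    have "- 2 * (m + 1) \<le> Re (\<phi> z)"
    proof (rule borel_caratheodory_half[OF \<phi>(1) _ _ z])
      \<comment> \<open>The bound m + 1 in place of m supplies the strict inequality that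
        \<open>borel_caratheodory_half\<close> asks for.\<close>
      show "Re (\<phi> z) < m + 1" if "norm z < 2" for z
        using Kle[of z] \<phi>(2)[of z] that by simp
      show "0 \<le> Re (\<phi> 0)" using Re\<phi>[of 0] K0 by simp
    qed
    then show ?thesis using \<phi>(2)[of z] z by simp
  qed
  show ?thesis
  proof
    \<comment> \<open>The witness consists of the real parts of the zeros: a real point is at least
      as far from a zero as from its real part.\<close>
    show "finite (Re ` set as)" by simp
    have "card (Re ` set as) \<le> n" using card_image_le[of "set as" Re] card_length[of as] ask(1) by simp
    then show "real (card (Re ` set as)) \<le> 2 * m" using n2 by simp
    fix x \<epsilon> :: real assume x: "\<bar>x\<bar> \<le> 1" and e: "0 < \<epsilon>" "\<epsilon> \<le> 1" and far: "\<And>a. a \<in> Re ` set as \<Longrightarrow> \<epsilon> \<le> \<bar>x - a\<bar>"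
    define B where "B a = (of_real x - a) / ((16 - cnj a * of_real x) / 4)" for a
    \<comment> \<open>The 6 is 24 / 4: the denominator of a Blaschke factor has modulus at most 24 /
      4 on the disc of radius 4.\<close>
    have Bge: "\<epsilon> / 6 \<le> norm (B a)" if "a \<in> set as" for a
    proof -
      have "\<epsilon> \<le> norm (of_real x - a)"
        using far[of "Re a"] abs_Re_le_cmod[of "of_real x - a"] that by auto
      moreover have "0 < norm (16 - cnj a * of_real x)" "norm (16 - cnj a * of_real x) \<le> 24"
        using blaschke_nonzero[OF ask(3)[OF that], of "of_real x"] x by auto
      ultimately have "\<epsilon> / 6 \<le> norm (of_real x - a) / (norm (16 - cnj a * of_real x) / 4)"
        using e frac_le[of "norm (of_real x - a)" \<epsilon> "norm (16 - cnj a * of_real x) / 4" 6] by simp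
      then show ?thesis by (simp only: B_def norm_divide norm_numeral)
    qed
    have xS: "of_real x \<in> S" using S x by auto
    have "prod_list (map (\<lambda>a. of_real x - a) bs)
        = prod_list (map (\<lambda>a. (16 - cnj a * of_real x) / 4) bs) * prod_list (map B bs)"
      if "set bs \<subseteq> set as" for bs
      using that
    proof (induction bs)
      case (Cons b bs)
      have "16 - cnj b * of_real x \<noteq> 0"
        using blaschke_nonzero(1)[OF ask(3), of b "of_real x"] Cons.prems x by auto
      then have "of_real x - b = (16 - cnj b * of_real x) / 4 * B b"
        unfolding B_def by (subst nonzero_mult_div_cancel_left[symmetric, of "(16 - cnj b * of_real x) / 4"]) auto
      then show ?case using Cons by simp
    qed simp
    then have "f (of_real x) = K (of_real x) * prod_list (map B as)"
      using ask(4)[OF xS] by (simp add: K_def)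
    then have "norm (f (of_real x)) = norm (K (of_real x)) * prod_list (map (\<lambda>a. norm (B a)) as)"
      by (simp add: norm_mult norm_prod_list)
    moreover have "\<dots> \<ge> exp (- 2 * (m + 1)) * (\<epsilon> / 6) ^ n"
      using low[of "of_real x"] x e prod_list_ge_power[of as "\<epsilon> / 6" "\<lambda>a. norm (B a)"] Bge ask(1)
      by (intro mult_mono) auto
    moreover have "exp (- (2 * m * ln (6 / \<epsilon>))) \<le> (\<epsilon> / 6) ^ n"
    proof -
      have "(\<epsilon> / 6) ^ n = exp (real n * ln (\<epsilon> / 6))"
        using e by (simp add: exp_of_nat_mult)
      also have "ln (\<epsilon> / 6) = - ln (6 / \<epsilon>)" using e by (simp add: ln_div)
      finally have "(\<epsilon> / 6) ^ n = exp (- (real n * ln (6 / \<epsilon>)))" by simp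
      moreover have "real n * ln (6 / \<epsilon>) \<le> 2 * m * ln (6 / \<epsilon>)"
        using n2 e by (intro mult_right_mono ln_ge_zero) auto
      ultimately show ?thesis by simp
    qed
    moreover have "exp (- 2 * (m + 1) - 2 * m * ln (6 / \<epsilon>))
        = exp (- 2 * (m + 1)) * exp (- (2 * m * ln (6 / \<epsilon>)))"
      by (simp flip: exp_add)
    ultimately show "exp (- 2 * (m + 1) - 2 * m * ln (6 / \<epsilon>)) \<le> norm (f (of_real x))"
      using mult_left_mono[of "exp (- (2 * m * ln (6 / \<epsilon>)))" "(\<epsilon> / 6) ^ n" "exp (- 2 * (m + 1))"]
      by (metis exp_ge_zero order.trans)
  qed
qed

text \<open>The factor exp (\<i> \<tau> z) has modulus exp (-\<tau> Im z), which lowers the bound on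
  the upper line from M' to M and leaves the real line alone. The modulus of the product has period
  1, so its maximum over the strip is attained on a compact rectangle and no growth condition is
  needed. An interior maximum makes the product constant, and its value at 0 is already
  bounded.\<close>

lemma three_lines_periodic:
  fixes g :: "complex \<Rightarrow> complex"
  assumes hol: "g holomorphic_on UNIV" and per: "\<And>z. g (z + 1) = g z"
    and h: "0 < h" and M: "0 < M" "0 < M'"
    and lower: "\<And>x. norm (g (of_real x)) \<le> M" and upper: "\<And>z. Im z = h \<Longrightarrow> norm (g z) \<le> M'"
    and z: "0 \<le> Im z" "Im z \<le> h"
  shows "norm (g z) \<le> M * exp (Im z / h * ln (M' / M))"
proof -
  define \<tau> where "\<tau> = ln (M' / M) / h"
  define F where "F z = g z * exp (\<i> * of_real \<tau> * z)" for z
  have nF: "norm (F z) = norm (g z) * exp (- \<tau> * Im z)" for z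
    by (simp add: F_def norm_mult)
  have holF: "F holomorphic_on UNIV" unfolding F_def by (intro holomorphic_intros hol)
  have contF: "continuous_on A (\<lambda>z. norm (F z))" for A
    using holomorphic_on_imp_continuous_on[OF holF] continuous_on_subset by (intro continuous_intros) blast
  have bd: "norm (F z) \<le> M" if "Im z = 0 \<or> Im z = h" for z
  proof (cases "Im z = 0")
    case True
    then have "z = of_real (Re z)" by (simp add: complex_eq_iff)
    then show ?thesis using lower[of "Re z"] True by (simp add: nF)
  next
    case False
    then have i: "Im z = h" using that by simp
    have "exp (- \<tau> * h) = M / M'" using h M by (simp add: \<tau>_def exp_minus)
    then show ?thesis using upper[OF i] M i mult_right_mono[of "norm (g z)" M' "M / M'"] by (simp add: nF)
  qed
  have perF: "norm (F (z + of_int n)) = norm (F z)" for z n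
  proof -
    have 1: "g (z + of_nat k) = g z" for z k
    proof (induction k)
      case (Suc k)
      then show ?case using per[of "z + of_nat k"] by (simp add: algebra_simps)
    qed simp
    have "g (z + of_int n) = g z"
      using 1[of z "nat n"] 1[of "z + of_int n" "nat (- n)"] by (cases "0 \<le> n") simp_all
    then show ?thesis by (simp add: nF)
  qed
  define R where "R = cbox 0 (Complex 1 h)"
  have "compact R" "R \<noteq> {}" using h by (auto simp: R_def box_ne_empty Basis_complex_def)
  then obtain w where w: "w \<in> R" "\<And>z. z \<in> R \<Longrightarrow> norm (F z) \<le> norm (F w)"
    using continuous_attains_sup[of R "\<lambda>z. norm (F z)"] contF by blast
  have inR: "z \<in> R \<longleftrightarrow> 0 \<le> Re z \<and> Re z \<le> 1 \<and> 0 \<le> Im z \<and> Im z \<le> h" for z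
    by (auto simp: R_def in_cbox_complex_iff)
  have strip: "norm (F z) \<le> norm (F w)" if "0 \<le> Im z" "Im z \<le> h" for z
  proof -
    have "z - of_int \<lfloor>Re z\<rfloor> \<in> R" using that by (auto simp: inR) linarith+
    then have "norm (F (z - of_int \<lfloor>Re z\<rfloor>)) \<le> norm (F w)" by (rule w(2))
    then show ?thesis using perF[of "z - of_int \<lfloor>Re z\<rfloor>" "\<lfloor>Re z\<rfloor>"] by simp
  qed
  have Fw: "norm (F w) \<le> M"
  proof (cases "Im w = 0 \<or> Im w = h")
    case False
    have U: "{z. 0 < Im z} \<inter> {z. Im z < h} = {z. 0 < Im z \<and> Im z < h}" by auto
    have "F constant_on UNIV"
    proof (rule maximum_modulus_principle[where U="{z. 0 < Im z \<and> Im z < h}"])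
      show "open {z. 0 < Im z \<and> Im z < h}"
        unfolding U[symmetric] by (intro open_Int open_halfspace_Im_gt open_halfspace_Im_lt)
      show "w \<in> {z. 0 < Im z \<and> Im z < h}" using w(1) False by (auto simp: inR)
    qed (use holF strip in auto)
    then have "F w = F 0" by (auto simp: constant_on_def)
    then show ?thesis using bd[of 0] by simp
  qed (use bd in auto)
  have "norm (F z) \<le> M" using strip[OF z] Fw by simp
  then have "norm (g z) * exp (- \<tau> * Im z) * exp (\<tau> * Im z) \<le> M * exp (\<tau> * Im z)"
    unfolding nF by (intro mult_right_mono) auto
  then have "norm (g z) \<le> M * exp (\<tau> * Im z)"
    by (simp add: mult.assoc flip: exp_add)
  then show ?thesis by (simp add: \<tau>_def mult.commute)
qed

section \<open>Analytic approximation of Gevrey functions\<close>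

lemma gevrey_infsum:
  assumes "B \<in> gevrey s \<rho>"
  shows "((\<lambda>k. norm (mfourier B k) * gevrey_weight s \<rho> k) has_sum gevrey_norm s \<rho> B) UNIV"
  using assms by (auto simp: gevrey_def gevrey_norm_def)

lemma norm_entry_le_norm: "norm (c $ i $ j) \<le> norm (c :: complex^2^2)"
  using Finite_Cartesian_Product.norm_nth_le[of "c $ i" j] Finite_Cartesian_Product.norm_nth_le[of c i] by linarith

lemma gevrey_norm_nonneg: "0 \<le> gevrey_norm s \<rho> f"
  unfolding gevrey_norm_def by (intro infsum_nonneg) (simp add: gevrey_weight_def)

lemma gevrey_entry_le:
  assumes B: "B \<in> gevrey s \<rho>" and r: "0 \<le> \<rho>"
  shows "\<bar>B x $ i $ j\<bar> \<le> gevrey_norm s \<rho> B"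
proof -
  have "norm (complex_of_real (B x $ i $ j)) \<le> gevrey_norm s \<rho> B"
  proof (rule norm_infsum_le[OF _ gevrey_infsum[OF B]])
    show "((\<lambda>k. mfourier B k $ i $ j * exp (2 * of_real pi * \<i> * of_int k * of_real x))
        has_sum of_real (B x $ i $ j)) UNIV"
      using B by (auto simp: gevrey_def)
    show "norm (mfourier B k $ i $ j * exp (2 * of_real pi * \<i> * of_int k * of_real x))
      \<le> norm (mfourier B k) * gevrey_weight s \<rho> k" for k
      unfolding norm_mult norm_exp_fourier using norm_entry_le_norm[of "mfourier B k" i j]
        mult_mono[OF norm_entry_le_norm[of "mfourier B k" i j] gevrey_weight_ge_1[OF r, of s k]] by simp
  qed
  then show ?thesis by simp
qed

definition trunc :: "(real \<Rightarrow> real^2^2) \<Rightarrow> nat \<Rightarrow> complex \<Rightarrow> complex^2^2" where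
  "trunc B K z = (\<chi> i j. \<Sum>k\<in>{- int K..int K}. mfourier B k $ i $ j * exp (2 * of_real pi * \<i> * of_int k * z))"

lemma trunc_holomorphic: "(\<lambda>z. trunc B K z $ i $ j) holomorphic_on S"
  unfolding trunc_def by (auto intro!: holomorphic_intros)

lemma trunc_periodic: "trunc B K (z + 1) = trunc B K z"
proof -
  have "exp (2 * of_real pi * \<i> * of_int k * (z + 1)) = exp (2 * of_real pi * \<i> * of_int k * z)" for k :: int
    using exp_plus_2pin[of "2 * of_real pi * \<i> * of_int k * z" k] by (simp add: algebra_simps)
  then show ?thesis by (simp add: trunc_def)
qed

text \<open>For |k| \<le> K the power \<open>u powr (1 / s - 1)\<close> of u = 2 pi |k| is smallest
  at |k| = K, because its exponent is negative. The width allowed for k = K thus lets the Gevrey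
  weight absorb the growth of every smaller frequency.\<close>

lemma trunc_strip_le:
  assumes B: "B \<in> gevrey s \<rho>" and r: "0 \<le> \<rho>" and s: "1 < s" and K: "1 \<le> K"
    and z: "\<bar>Im z\<bar> \<le> \<rho> * (2 * pi * real K) powr (1 / s - 1)"
  shows "norm (trunc B K z $ i $ j) \<le> gevrey_norm s \<rho> B"
proof -
  have e: "norm (exp (2 * of_real pi * \<i> * of_int k * z)) \<le> gevrey_weight s \<rho> k" if k: "\<bar>k\<bar> \<le> int K" for k
  proof -
    define u where "u = 2 * pi * \<bar>real_of_int k\<bar>"
    have "norm (exp (2 * of_real pi * \<i> * of_int k * z)) = exp (- (2 * pi * of_int k * Im z))" by simp
    also have "- (2 * pi * of_int k * Im z) \<le> u * \<bar>Im z\<bar>"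
      using abs_ge_minus_self[of "2 * pi * of_int k * Im z"] by (simp add: u_def abs_mult)
    also have "\<dots> \<le> \<rho> * u powr (1 / s)"
    proof (cases "k = 0")
      case False
      then have u: "0 < u" by (simp add: u_def)
      have "u \<le> 2 * pi * real K" using k by (simp add: u_def)
      then have "(2 * pi * real K) powr (1 / s - 1) \<le> u powr (1 / s - 1)"
        using u s by (intro powr_mono2') (auto simp: divide_le_eq)
      then have "u * \<bar>Im z\<bar> \<le> u * (\<rho> * u powr (1 / s - 1))"
        using z u r by (intro mult_left_mono) (auto intro: order.trans[OF _ mult_left_mono])
      also have "u * u powr (1 / s - 1) = u powr (1 / s)" using u by (simp add: powr_mult_base)
      then have "u * (\<rho> * u powr (1 / s - 1)) = \<rho> * u powr (1 / s)" by (metis mult.left_commute)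
      finally show ?thesis .
    qed (simp add: u_def)
    finally show ?thesis by (simp add: gevrey_weight_def u_def abs_mult)
  qed
  have "norm (trunc B K z $ i $ j)
     \<le> (\<Sum>k\<in>{- int K..int K}. norm (mfourier B k $ i $ j * exp (2 * of_real pi * \<i> * of_int k * z)))"
    unfolding trunc_def by (simp only: vec_lambda_beta norm_sum)
  also have "\<dots> \<le> (\<Sum>k\<in>{- int K..int K}. norm (mfourier B k) * gevrey_weight s \<rho> k)"
    unfolding norm_mult
    by (intro sum_mono mult_mono norm_entry_le_norm e) auto
  also have "\<dots> \<le> gevrey_norm s \<rho> B"
    by (rule finite_sum_le_has_sum[OF gevrey_infsum[OF B]]) (auto simp: gevrey_weight_def)
  finally show ?thesis .
qed

text \<open>Every omitted frequency carries a weight of at least exp X, so the tail is at most exp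
  (-X) times the full weighted sum.\<close>

lemma trunc_approx:
  assumes B: "B \<in> gevrey s \<rho>" and r: "0 \<le> \<rho>" and s: "1 < s"
  shows "norm (of_real (B x $ i $ j) - trunc B K (of_real x) $ i $ j)
    \<le> exp (- (\<rho> * (2 * pi * real K) powr (1 / s))) * gevrey_norm s \<rho> B"
proof -
  define S where "S = {- int K..int K}"
  define X where "X = \<rho> * (2 * pi * real K) powr (1 / s)"
  define f where "f k = mfourier B k $ i $ j * exp (2 * of_real pi * \<i> * of_int k * of_real x)" for k
  have "(f has_sum of_real (B x $ i $ j)) UNIV"
    using B unfolding gevrey_def f_def by blast
  moreover have "(f has_sum trunc B K (of_real x) $ i $ j) S"
    unfolding trunc_def by (auto simp: f_def S_def intro!: has_sum_finiteI)
  ultimately have hs: "(f has_sum (of_real (B x $ i $ j) - trunc B K (of_real x) $ i $ j)) (UNIV - S)"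
    by (intro has_sum_Diff) auto
  let ?g = "\<lambda>k. exp (- X) * (norm (mfourier B k) * gevrey_weight s \<rho> k)"
  have g: "(?g has_sum (exp (- X) * gevrey_norm s \<rho> B)) UNIV"
    by (intro has_sum_cmult_right gevrey_infsum B)
  have "norm (of_real (B x $ i $ j) - trunc B K (of_real x) $ i $ j) \<le> exp (- X) * gevrey_norm s \<rho> B"
  proof (rule norm_infsum_le[OF _ g])
    show "((\<lambda>k. if k \<in> S then 0 else f k) has_sum (of_real (B x $ i $ j) - trunc B K (of_real x) $ i $ j)) UNIV"
      using hs by (rule has_sum_cong_neutral[THEN iffD1, rotated -1]) auto
    fix k
    show "norm (if k \<in> S then 0 else f k) \<le> ?g k"
    proof (cases "k \<in> S")
      case False
      then have "real K \<le> \<bar>real_of_int k\<bar>" by (auto simp: S_def)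
      then have "X \<le> \<rho> * \<bar>2 * pi * of_int k\<bar> powr (1 / s)"
        unfolding X_def using r s by (intro mult_left_mono powr_mono2) (auto simp: abs_mult)
      then have "exp X \<le> gevrey_weight s \<rho> k" by (simp add: gevrey_weight_def)
      then have "1 \<le> exp (- X) * gevrey_weight s \<rho> k" by (simp add: exp_minus field_simps)
      then have "norm (f k) * 1 \<le> norm (mfourier B k) * (exp (- X) * gevrey_weight s \<rho> k)"
        unfolding f_def norm_mult norm_exp_fourier using norm_entry_le_norm[of "mfourier B k" i j]
        by (intro mult_mono) auto
      then show ?thesis using False by (simp add: mult_ac)
    qed (simp add: gevrey_weight_def)
  qed
  then show ?thesis by (simp add: X_def)
qed

text \<open>Truncating at \<open>\<bar>k\<bar> \<approx> N\<^sup>s\<close> gives an error \<open>exp (- c N)\<close> and a strip of width \<open>N\<^sup>1\<^sup>-\<^sup>s\<close>.\<close>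

lemma gevrey_approx:
  assumes r: "0 < \<rho>" and s: "1 < s" and c: "0 < c"
  obtains w where "0 < w" "w \<le> 1"
    "\<And>N B. 1 \<le> N \<Longrightarrow> B \<in> gevrey s \<rho> \<Longrightarrow> \<exists>T. (\<forall>i j. (\<lambda>z. T z $ i $ j) holomorphic_on UNIV) \<and>
       (\<forall>z. T (z + 1) = T z) \<and>
       (\<forall>z i j. \<bar>Im z\<bar> \<le> w * real N powr (1 - s) \<longrightarrow> norm (T z $ i $ j) \<le> gevrey_norm s \<rho> B) \<and>
       (\<forall>x i j. norm (of_real (B x $ i $ j) - T (of_real x) $ i $ j) \<le> exp (- c * real N) * gevrey_norm s \<rho> B)"
proof -
  \<comment> \<open>\<open>b\<close> is chosen so that 2 pi K \<le> b N^s below; its summand 2 pi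
    comes from rounding K up.\<close>
  define b where "b = (c / \<rho>) powr s + 2 * pi"
  define w where "w = min 1 (\<rho> * b powr (1 / s - 1))"
  have b: "0 < b" unfolding b_def using pi_gt_zero by (intro add_nonneg_pos) auto
  show ?thesis
  proof (rule that[of w])
    show "0 < w" "w \<le> 1" using b r by (auto simp: w_def)
    fix N :: nat and B assume N: "1 \<le> N" and B: "B \<in> gevrey s \<rho>"
    \<comment> \<open>The cut-off at which the exponent of the truncation error reaches c N.\<close>
    define K where "K = nat \<lceil>(c * real N / \<rho>) powr s / (2 * pi)\<rceil>"
    have cN: "0 < c * real N / \<rho>" using c r N by simp
    then have pos: "0 < (c * real N / \<rho>) powr s / (2 * pi)"
      by (intro divide_pos_pos powr_gt_zero[THEN iffD2]) (use c r N in auto)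
    then have K1: "1 \<le> K" unfolding K_def by linarith
    have "(c * real N / \<rho>) powr s / (2 * pi) \<le> real K" unfolding K_def by linarith
    then have lo: "(c * real N / \<rho>) powr s \<le> 2 * pi * real K" by (simp add: field_simps)
    have "real K \<le> (c * real N / \<rho>) powr s / (2 * pi) + 1" unfolding K_def using pos by linarith
    then have "2 * pi * real K \<le> (c * real N / \<rho>) powr s + 2 * pi" by (simp add: field_simps)
    also have "\<dots> \<le> (c / \<rho>) powr s * real N powr s + 2 * pi * real N powr s"
      using c r N s by (auto simp: powr_mult[symmetric] ge_one_powr_ge_zero)
    finally have hi: "2 * pi * real K \<le> b * real N powr s" by (simp add: b_def algebra_simps)
    have X: "c * real N \<le> \<rho> * (2 * pi * real K) powr (1 / s)"
    proof -
      have "u = (u powr s) powr (1 / s)" if "0 < u" for u :: real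
        using that s by (simp add: powr_powr)
      then have "c * real N / \<rho> = ((c * real N / \<rho>) powr s) powr (1 / s)" using cN by blast
      also have "\<dots> \<le> (2 * pi * real K) powr (1 / s)" using lo s by (intro powr_mono2) auto
      finally show ?thesis using r by (simp add: field_simps)
    qed
    have H: "w * real N powr (1 - s) \<le> \<rho> * (2 * pi * real K) powr (1 / s - 1)"
    proof -
      have e: "real N powr (1 - s) = (real N powr s) powr (1 / s - 1)"
        using s by (simp add: powr_powr algebra_simps)
      have "w * real N powr (1 - s) \<le> \<rho> * b powr (1 / s - 1) * real N powr (1 - s)"
        by (intro mult_right_mono) (auto simp: w_def)
      also have "\<dots> = \<rho> * (b * real N powr s) powr (1 / s - 1)"
        unfolding e using b by (simp add: powr_mult)
      also have "\<dots> \<le> \<rho> * (2 * pi * real K) powr (1 / s - 1)"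
        using hi r s K1 by (intro mult_left_mono powr_mono2') auto
      finally show ?thesis .
    qed
    show "\<exists>T. (\<forall>i j. (\<lambda>z. T z $ i $ j) holomorphic_on UNIV) \<and>
       (\<forall>z. T (z + 1) = T z) \<and>
       (\<forall>z i j. \<bar>Im z\<bar> \<le> w * real N powr (1 - s) \<longrightarrow> norm (T z $ i $ j) \<le> gevrey_norm s \<rho> B) \<and>
       (\<forall>x i j. norm (of_real (B x $ i $ j) - T (of_real x) $ i $ j) \<le> exp (- c * real N) * gevrey_norm s \<rho> B)"
    proof (intro exI[of _ "trunc B K"] conjI allI impI)
      show "norm (trunc B K z $ i $ j) \<le> gevrey_norm s \<rho> B" if "\<bar>Im z\<bar> \<le> w * real N powr (1 - s)" for z i j
        using trunc_strip_le[OF B _ s K1, of z] that H r by simp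
      have "exp (- (\<rho> * (2 * pi * real K) powr (1 / s))) * gevrey_norm s \<rho> B \<le> exp (- c * real N) * gevrey_norm s \<rho> B"
        using X by (intro mult_right_mono gevrey_norm_nonneg) auto
      then show "norm (of_real (B x $ i $ j) - trunc B K (of_real x) $ i $ j) \<le> exp (- c * real N) * gevrey_norm s \<rho> B" for x i j
        using trunc_approx[OF B _ s, of x i j K] r by simp
    qed (auto simp: trunc_holomorphic trunc_periodic)
  qed
qed

section \<open>Large deviations\<close>

lemma cocycle_eq_matrix_prod: "cocycle \<alpha> A N \<theta> = matrix_prod (\<lambda>n. A (\<theta> + of_nat n * \<alpha>)) N"
  by (induction N) simp_all

lemma cocycle_add: "cocycle \<alpha> A (m + n) \<theta> = cocycle \<alpha> A m (\<theta> + of_nat n * \<alpha>) ** cocycle \<alpha> A n \<theta>"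
  unfolding cocycle_eq_matrix_prod matrix_prod_add by (simp add: algebra_simps)

lemma det_cocycle: "(\<And>\<theta>. det (A \<theta>) = 1) \<Longrightarrow> det (cocycle \<alpha> A N \<theta>) = 1"
  by (simp add: cocycle_eq_matrix_prod det_matrix_prod)

lemma entry_sum_cocycle_le:
  assumes "\<And>\<theta>. entry_sum (A \<theta>) \<le> g" "0 \<le> g"
  shows "entry_sum (cocycle \<alpha> A N \<theta>) \<le> 2 * g ^ N"
  unfolding cocycle_eq_matrix_prod using assms by (intro entry_sum_matrix_prod) auto

lemma entry_sum_cocycle_ge_1:
  "(\<And>\<theta>. det (A \<theta>) = 1) \<Longrightarrow> 1 \<le> entry_sum (cocycle \<alpha> A N \<theta>)"
  by (intro entry_sum_ge_1 det_cocycle)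

lemma periodic_int:
  fixes f :: "real \<Rightarrow> 'a"
  assumes "\<And>x. f (x + 1) = f x"
  shows "f (x + of_int k) = f x"
proof -
  have 1: "f (x + of_nat n) = f x" for x n
  proof (induction n)
    case (Suc n)
    then show ?case using assms[of "x + of_nat n"] by (simp add: algebra_simps)
  qed simp
  show ?thesis
    using 1[of x "nat k"] 1[of "x + of_int k" "nat (- k)"] by (cases "0 \<le> k") simp_all
qed

lemma cocycle_periodic:
  assumes "\<And>\<theta>. A (\<theta> + 1) = A \<theta>"
  shows "cocycle \<alpha> A N (\<theta> + of_int k) = cocycle \<alpha> A N \<theta>"
proof (induction N)
  case (Suc N)
  have "A (\<theta> + of_int k + of_nat N * \<alpha>) = A (\<theta> + of_nat N * \<alpha>)"
    using periodic_int[of A "\<theta> + of_nat N * \<alpha>" k] assms by (simp add: algebra_simps)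
  then show ?case using Suc by simp
qed simp

text \<open>\<open>A\<^sub>N(\<theta> + j\<alpha>) = A\<^sub>j(\<theta> + N\<alpha>) A\<^sub>N(\<theta>) A\<^sub>j(\<theta>)\<^sup>-\<^sup>1\<close>.\<close>

lemma cocycle_almost_invariant:
  assumes det: "\<And>\<theta>. det (A \<theta>) = 1" and g: "\<And>\<theta>. entry_sum (A \<theta>) \<le> g" "1 \<le> g"
  shows "ln (entry_sum (cocycle \<alpha> A N (\<theta> + of_nat j * \<alpha>)))
     \<le> ln (entry_sum (cocycle \<alpha> A N \<theta>)) + 2 * ln 2 + 2 * real j * ln g"
proof -
  define X where "X = cocycle \<alpha> A j \<theta>"
  obtain Y where Y: "Y ** X = mat 1" "entry_sum Y = entry_sum X"
    using SL2_inverse[of X] det_cocycle[of A, OF det] unfolding X_def by metis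
  have "X ** Y = mat 1" using Y(1) by (simp add: matrix_left_right_inverse)
  moreover have "cocycle \<alpha> A N (\<theta> + of_nat j * \<alpha>) ** X = cocycle \<alpha> A j (\<theta> + of_nat N * \<alpha>) ** cocycle \<alpha> A N \<theta>"
    unfolding X_def cocycle_add[symmetric] by (simp add: add.commute)
  ultimately have "cocycle \<alpha> A N (\<theta> + of_nat j * \<alpha>)
     = (cocycle \<alpha> A j (\<theta> + of_nat N * \<alpha>) ** cocycle \<alpha> A N \<theta>) ** Y"
    by (metis matrix_mul_assoc matrix_mul_rid)
  then have "entry_sum (cocycle \<alpha> A N (\<theta> + of_nat j * \<alpha>))
     \<le> entry_sum (cocycle \<alpha> A j (\<theta> + of_nat N * \<alpha>)) * entry_sum (cocycle \<alpha> A N \<theta>) * entry_sum Y"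
    using entry_sum_mult[of "cocycle \<alpha> A j (\<theta> + of_nat N * \<alpha>) ** cocycle \<alpha> A N \<theta>" Y]
      mult_right_mono[OF entry_sum_mult entry_sum_nonneg[of Y], of "cocycle \<alpha> A j (\<theta> + of_nat N * \<alpha>)" "cocycle \<alpha> A N \<theta>"]
    by simp
  also have "\<dots> \<le> (2 * g ^ j) * entry_sum (cocycle \<alpha> A N \<theta>) * (2 * g ^ j)"
    using g Y(2) entry_sum_cocycle_le[OF g(1)] unfolding X_def
    by (intro mult_mono mult_nonneg_nonneg) (auto simp: entry_sum_nonneg)
  finally have le: "entry_sum (cocycle \<alpha> A N (\<theta> + of_nat j * \<alpha>)) \<le> entry_sum (cocycle \<alpha> A N \<theta>) * (2 * g ^ j)\<^sup>2"
    by (simp add: power2_eq_square mult_ac)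
  have 1: "1 \<le> entry_sum (cocycle \<alpha> A N (\<theta> + of_nat j * \<alpha>))" "1 \<le> entry_sum (cocycle \<alpha> A N \<theta>)"
    by (intro entry_sum_cocycle_ge_1 det)+
  have "ln (entry_sum (cocycle \<alpha> A N (\<theta> + of_nat j * \<alpha>))) \<le> ln (entry_sum (cocycle \<alpha> A N \<theta>) * (2 * g ^ j)\<^sup>2)"
    using 1 le by (intro ln_mono) auto
  also have "\<dots> = ln (entry_sum (cocycle \<alpha> A N \<theta>)) + 2 * (ln 2 + real j * ln g)"
  proof -
    have "ln ((2 * g ^ j)\<^sup>2) = 2 * (ln 2 + real j * ln g)"
      using g by (subst ln_realpow) (auto simp: ln_mult ln_realpow)
    moreover have "ln (entry_sum (cocycle \<alpha> A N \<theta>) * (2 * g ^ j)\<^sup>2)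
        = ln (entry_sum (cocycle \<alpha> A N \<theta>)) + ln ((2 * g ^ j)\<^sup>2)"
      using 1 g by (intro ln_mult_pos) auto
    ultimately show ?thesis by simp
  qed
  finally show ?thesis by simp
qed

definition complex_matrix :: "real^2^2 \<Rightarrow> complex^2^2" where
  "complex_matrix M = (\<chi> i j. of_real (M $ i $ j))"

lemma complex_matrix_prod: "matrix_prod (\<lambda>n. complex_matrix (f n)) N = complex_matrix (matrix_prod f N)"
  by (induction N) (simp_all add: complex_matrix_def vec_eq_iff matrix_mul_2 mat_def)

lemma entry_sum_complex_matrix: "entry_sum (complex_matrix M) = entry_sum M"
  by (simp add: entry_sum_2 complex_matrix_def)

lemma holomorphic_comp_entire:
  "f holomorphic_on UNIV \<Longrightarrow> g holomorphic_on UNIV \<Longrightarrow> (\<lambda>z. f (g z)) holomorphic_on UNIV"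
  using holomorphic_on_compose_gen[of g UNIV f UNIV] by (simp add: o_def)

lemma three_lines_periodic_abs:
  fixes g :: "complex \<Rightarrow> complex"
  assumes hol: "g holomorphic_on UNIV" and per: "\<And>z. g (z + 1) = g z"
    and h: "0 < h" and M: "0 < M" "0 < M'"
    and lower: "\<And>x. norm (g (of_real x)) \<le> M" and upper: "\<And>z. \<bar>Im z\<bar> = h \<Longrightarrow> norm (g z) \<le> M'"
    and z: "\<bar>Im z\<bar> \<le> h"
  shows "norm (g z) \<le> M * exp (\<bar>Im z\<bar> / h * ln (M' / M))"
proof (cases "0 \<le> Im z")
  case True
  then show ?thesis
    using three_lines_periodic[OF hol per h M lower, of z] upper z h by auto
next
  case False
  have "norm (g (- (- z))) \<le> M * exp (Im (- z) / h * ln (M' / M))"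
  proof (rule three_lines_periodic[OF _ _ h M])
    show "(\<lambda>z. g (- z)) holomorphic_on UNIV"
      by (intro holomorphic_comp_entire[OF hol] holomorphic_intros)
    show "g (- (z + 1)) = g (- z)" for z using per[of "- z - 1"] by simp
    show "norm (g (- of_real x)) \<le> M" for x using lower[of "- x"] by simp
    show "norm (g (- z)) \<le> M'" if "Im z = h" for z using upper[of "- z"] that h by simp
  qed (use False z in auto)
  then show ?thesis using False by simp
qed

text \<open>The entire function \<open>T\<close> approximates \<open>B\<close> on the real line. The exceptional set \<open>F\<close> consists of
  the real parts of the zeros near the point of largest modulus, moved back along the orbit.\<close>

lemma large_deviation:
  fixes T :: "complex \<Rightarrow> complex^2^2" and N q :: nat
  assumes det: "\<And>\<theta>. det (B \<theta>) = 1" and per: "\<And>\<theta>. B (\<theta> + 1) = B \<theta>"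
    and g: "\<And>\<theta>. entry_sum (B \<theta>) \<le> g" "1 \<le> g"
    and holT: "\<And>i j. (\<lambda>z. T z $ i $ j) holomorphic_on UNIV" and perT: "\<And>z. T (z + 1) = T z"
    and Tle: "\<And>z. \<bar>Im z\<bar> \<le> h \<Longrightarrow> entry_sum (T z) \<le> g"
    and TB: "\<And>x. entry_sum (complex_matrix (B x) - T (of_real x)) \<le> \<delta>"
    and \<delta>: "2 * real N * g ^ N * \<delta> \<le> 1 / 8"
    and q: "good_denom \<alpha> q" "2 \<le> q" "8 / real q \<le> h" and H: "0 \<le> H"
  defines "m \<equiv> 8 / (real q * h) * (ln 16 + real N * ln g)"
  obtains F :: "real set" where "finite F" "real (card F) \<le> 2 * m * real q"
    "\<And>\<theta> \<theta>'. (\<And>a k. a \<in> F \<Longrightarrow> exp (- H) \<le> \<bar>\<theta> - a - of_int k\<bar>) \<Longrightarrow>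
      ln (entry_sum (cocycle \<alpha> B N \<theta>')) - (7 + 6 * m + 2 * m * H + 2 * real q * ln g)
       \<le> ln (entry_sum (cocycle \<alpha> B N \<theta>))"
proof -
  define W where "W z = matrix_prod (\<lambda>n. T (z + of_real (of_nat n * \<alpha>))) N" for z
  have h: "0 < h" using q(2,3) by (intro less_le_trans[OF _ q(3)]) auto
  have holp: "(\<lambda>z. matrix_prod (\<lambda>n. T (z + of_real (of_nat n * \<alpha>))) K $ i $ j) holomorphic_on UNIV" for i j K
  proof (induction K arbitrary: i j)
    case 0
    then show ?case by (simp add: mat_def)
  next
    case (Suc K)
    have "(\<lambda>z. T (z + of_real (of_nat K * \<alpha>)) $ i $ j) holomorphic_on UNIV" for i j
      by (rule holomorphic_comp_entire[OF holT]) (intro holomorphic_intros)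
    then show ?case using Suc by (auto simp: matrix_mul_2 intro!: holomorphic_intros)
  qed
  then have holW: "(\<lambda>z. W z $ i $ j) holomorphic_on UNIV" for i j by (simp add: W_def)
  have perW: "W (z + 1) = W z" for z
  proof -
    have "T (z + 1 + c) = T (z + c)" for c using perT[of "z + c"] by (simp add: algebra_simps)
    then show ?thesis by (simp add: W_def)
  qed
  have Wle: "entry_sum (W z) \<le> 2 * g ^ N" if "\<bar>Im z\<bar> \<le> h" for z
    unfolding W_def using g that by (intro entry_sum_matrix_prod Tle) auto
  define BN where "BN = cocycle \<alpha> B N"
  have BN1: "1 \<le> entry_sum (BN x)" for x unfolding BN_def by (intro entry_sum_cocycle_ge_1 det)
  have BW: "entry_sum (complex_matrix (BN x) - W (of_real x)) \<le> 1 / 8" for x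
  proof -
    have "entry_sum (matrix_prod (\<lambda>n. complex_matrix (B (x + of_nat n * \<alpha>))) N
        - matrix_prod (\<lambda>n. T (of_real (x + of_nat n * \<alpha>))) N) \<le> 2 * real N * g ^ N * \<delta>"
      using g h by (intro entry_sum_matrix_prod_diff TB Tle) (auto simp: entry_sum_complex_matrix)
    then show ?thesis using \<delta>
      unfolding complex_matrix_prod BN_def cocycle_eq_matrix_prod W_def by simp
  qed
  have BNW: "entry_sum (BN x) \<le> entry_sum (W (of_real x)) + 1 / 8"
    and WBN: "entry_sum (W (of_real x)) \<le> entry_sum (BN x) + 1 / 8" for x
    using entry_sum_triangle[of "complex_matrix (BN x) - W (of_real x)" "W (of_real x)"]
      entry_sum_triangle[of "- (complex_matrix (BN x) - W (of_real x))" "complex_matrix (BN x)"] BW[of x]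
    unfolding entry_sum_minus by (simp_all add: entry_sum_complex_matrix)
  \<comment> \<open>Each entry attains its maximum separately, and the largest of the four maxima
    selects the entry to be followed. At the point found, this holomorphic function is comparable
    with the largest norm of the whole product.\<close>
  have "\<exists>x\<in>{0..1}. \<forall>y\<in>{0..1}. norm (W (of_real y) $ i $ j) \<le> norm (W (of_real x) $ i $ j)" for i j
  proof (rule continuous_attains_sup)
    have "continuous_on UNIV (\<lambda>z. W z $ i $ j)" by (rule holomorphic_on_imp_continuous_on[OF holW])
    then show "continuous_on {0..1} (\<lambda>x. norm (W (of_real x) $ i $ j))"
      using continuous_on_compose2[of UNIV "\<lambda>z. W z $ i $ j" "{0..1}" of_real]
      by (intro continuous_on_norm) (auto intro: continuous_on_of_real continuous_on_id)
  qed auto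
  then obtain xs where xs: "\<And>i j y. y \<in> {0..1} \<Longrightarrow> norm (W (of_real y) $ i $ j) \<le> norm (W (of_real (xs i j)) $ i $ j)"
    by metis
  define v where "v = (\<lambda>(i, j). norm (W (of_real (xs i j)) $ i $ j))"
  have "finite (range v)" "range v \<noteq> {}" by auto
  then have "Max (range v) \<in> range v" by (rule Max_in)
  then obtain i0 j0 where ij: "Max (range v) = v (i0, j0)" by (metis rangeE surj_pair)
  define x1 where "x1 = xs i0 j0"
  define M where "M = norm (W (of_real x1) $ i0 $ j0)"
  have Mv: "v p \<le> M" for p
    using Max_ge[OF \<open>finite (range v)\<close>, of "v p"] by (simp add: ij) (simp add: v_def M_def x1_def)
  have WM: "norm (W (of_real x) $ i $ j) \<le> M" for x i j
  proof -
    have "W (of_real (frac x + of_int \<lfloor>x\<rfloor>)) = W (of_real (frac x))"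
      by (rule periodic_int[of "\<lambda>x. W (of_real x)"]) (use perW in auto)
    then have "W (of_real x) = W (of_real (frac x))" by (simp add: frac_def)
    then show ?thesis
      using xs[of "frac x" i j] Mv[of "(i, j)"] frac_ge_0[of x] frac_lt_1[of x] by (simp add: v_def)
  qed
  have E4: "entry_sum (W (of_real x)) \<le> 4 * M" for x by (rule entry_sum_le[OF WM])
  \<comment> \<open>Since a product of determinant 1 has entry sum at least 1 and W is within 1/8 of
    it, M cannot be small. Hence the ratio of the strip bound to M is at most 16 g^N, whatever B
    is.\<close>
  have M8: "1 / 8 \<le> M" using BNW[of 0] E4[of 0] BN1[of 0] by simp
  have BNM: "entry_sum (BN x) \<le> 8 * M" for x using BNW[of x] E4[of x] M8 by simp
  define \<Lambda> where "\<Lambda> = ln 16 + real N * ln g"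
  have \<Lambda>: "0 \<le> \<Lambda>" using g by (simp add: \<Lambda>_def)
  define f0 where "f0 z = W z $ i0 $ j0" for z
  have strip: "norm (f0 z) \<le> M * exp (\<bar>Im z\<bar> / h * \<Lambda>)" if z: "\<bar>Im z\<bar> \<le> h" for z
  proof -
    have "norm (f0 z) \<le> M * exp (\<bar>Im z\<bar> / h * ln (2 * g ^ N / M))"
    proof (rule three_lines_periodic_abs[OF _ _ h _ _ _ _ z])
      show "norm (f0 z) \<le> 2 * g ^ N" if "\<bar>Im z\<bar> = h" for z
        using norm_entry_le_entry_sum[of "W z" i0 j0] Wle[of z] that by (simp add: f0_def)
    qed (use M8 WM g perW holW in \<open>auto simp: f0_def\<close>)
    also have "ln (2 * g ^ N / M) \<le> ln (2 * g ^ N / (1/8))"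
      using M8 g by (intro ln_mono divide_left_mono) auto
    also have "\<dots> = \<Lambda>"
    proof -
      have "2 * g ^ N / (1/8) = 16 * g ^ N" by simp
      then show ?thesis using g by (simp only: \<Lambda>_def ln_mult ln_realpow) (simp add: ln_mult ln_realpow)
    qed
    finally show ?thesis using M8 h by (auto simp: mult_left_mono divide_right_mono)
  qed
  \<comment> \<open>The radius 2/q is the one that every orbit reaches in fewer than q steps. The
    Cartan estimate looks at a disc four times as large, which is why 8/q \<le> h is
    assumed.\<close>
  define r where "r = 2 / real q"
  have r: "0 < r" "r \<le> 1" "4 * r \<le> h" using q by (auto simp: r_def)
  have m: "m = 4 * r / h * \<Lambda>" by (simp add: m_def r_def \<Lambda>_def field_simps)
  have m0: "0 \<le> m" using r h \<Lambda> by (simp add: m)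
  define f where "f w = f0 (of_real x1 + of_real r * w) / f0 (of_real x1)" for w
  have f0x1: "norm (f0 (of_real x1)) = M" by (simp add: f0_def M_def)
  obtain F0 where F0: "finite F0" "real (card F0) \<le> 2 * m"
    "\<And>x \<epsilon>. \<bar>x\<bar> \<le> 1 \<Longrightarrow> 0 < \<epsilon> \<Longrightarrow> \<epsilon> \<le> 1 \<Longrightarrow> (\<And>a. a \<in> F0 \<Longrightarrow> \<epsilon> \<le> \<bar>x - a\<bar>) \<Longrightarrow>
       exp (- 2 * (m + 1) - 2 * m * ln (6 / \<epsilon>)) \<le> norm (f (of_real x))"
  proof (rule cartan_estimate[of f UNIV m])
    have "(\<lambda>w. f0 (of_real x1 + of_real r * w)) holomorphic_on UNIV"
      unfolding f0_def by (rule holomorphic_comp_entire[OF holW]) (intro holomorphic_intros)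
    then show "f holomorphic_on UNIV"
      unfolding f_def using f0x1 M8 by (intro holomorphic_intros) auto
    show "norm (f 0) = 1" using f0x1 M8 by (auto simp: f_def)
    show "norm (f z) \<le> exp m" if z: "norm z \<le> 4" for z
    proof -
      have "\<bar>Im (of_real x1 + of_real r * z)\<bar> = r * \<bar>Im z\<bar>" using r by (simp add: abs_mult)
      also have le: "\<dots> \<le> 4 * r" using abs_Im_le_cmod[of z] z r by simp
      finally have im: "\<bar>Im (of_real x1 + of_real r * z)\<bar> \<le> 4 * r" .
      have "norm (f0 (of_real x1 + of_real r * z)) \<le> M * exp (\<bar>Im (of_real x1 + of_real r * z)\<bar> / h * \<Lambda>)"
        using im r by (intro strip) simp
      also have "\<dots> \<le> M * exp m"
        using im M8 h \<Lambda> unfolding m by (intro mult_left_mono) (auto intro!: mult_right_mono divide_right_mono)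
      finally show ?thesis using M8 f0x1 by (simp add: f_def norm_divide field_simps)
    qed
  qed auto
  \<comment> \<open>The time j at which the orbit of \<theta> enters the good interval depends on
    \<theta>, so each zero is pulled back by all j < q. This multiplies the number of points by
    q.\<close>
  define F where "F = (\<lambda>(a, j). x1 + r * a - real j * \<alpha>) ` (F0 \<times> {..<q})"
  show ?thesis
  proof
    show "finite F" using F0 by (simp add: F_def)
    have "card F \<le> card (F0 \<times> {..<q})" unfolding F_def using F0 by (intro card_image_le) auto
    then have "real (card F) \<le> real (card F0) * real q" by (simp add: card_cartesian_product flip: of_nat_mult)
    also have "\<dots> \<le> 2 * m * real q" using F0 by (intro mult_right_mono) auto
    finally show "real (card F) \<le> 2 * m * real q" .
    fix \<theta> \<theta>' assume far: "\<And>a k. a \<in> F \<Longrightarrow> exp (- H) \<le> \<bar>\<theta> - a - of_int k\<bar>"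
    obtain j k where jk: "j < q" "\<bar>\<theta> - x1 + real j * \<alpha> - of_int k\<bar> \<le> 2 / real q"
      using orbit_dense[OF q(1)] by blast
    define y where "y = \<theta> + real j * \<alpha> - of_int k"
    define x where "x = (y - x1) / r"
    have x: "\<bar>x\<bar> \<le> 1" using jk r by (simp add: x_def y_def r_def abs_divide field_simps abs_le_iff)
    have "exp (- 2 * (m + 1) - 2 * m * ln (6 / exp (- H))) \<le> norm (f (of_real x))"
    proof (rule F0(3)[OF x])
      fix a assume a: "a \<in> F0"
      then have "x1 + r * a - real j * \<alpha> \<in> F" using jk(1) by (force simp: F_def)
      then have "exp (- H) \<le> \<bar>\<theta> - (x1 + r * a - real j * \<alpha>) - of_int k\<bar>" by (rule far)
      also have "\<theta> - (x1 + r * a - real j * \<alpha>) - of_int k = r * (x - a)"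
        using r by (simp add: x_def y_def field_simps)
      also have "\<bar>r * (x - a)\<bar> \<le> 1 * \<bar>x - a\<bar>" unfolding abs_mult using r by (intro mult_right_mono) auto
      finally show "exp (- H) \<le> \<bar>x - a\<bar>" by simp
    qed (use H in auto)
    also have "ln (6 / exp (- H)) = ln 6 + H" by (simp add: ln_div)
    finally have "M * exp (- 2 * (m + 1) - 2 * m * (ln 6 + H)) \<le> M * norm (f (of_real x))"
      using M8 by (intro mult_left_mono) auto
    also have "M * norm (f (of_real x)) = norm (f0 (of_real y))"
    proof -
      have "of_real x1 + of_real r * of_real x = (of_real y :: complex)"
        using r unfolding x_def by (simp flip: of_real_mult of_real_add)
      then show ?thesis using f0x1 M8 by (simp add: f_def norm_divide)
    qed
    also have "\<dots> \<le> 2 * entry_sum (BN y)"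
      using norm_entry_le_entry_sum[of "W (of_real y)" i0 j0] WBN[of y] BN1[of y] by (simp add: f0_def)
    also have "BN y = BN (\<theta> + real j * \<alpha>)"
      using cocycle_periodic[of B \<alpha> N "\<theta> + real j * \<alpha>" "- k", OF per] by (simp add: BN_def y_def)
    finally have "ln (M * exp (- 2 * (m + 1) - 2 * m * (ln 6 + H))) \<le> ln (2 * entry_sum (BN (\<theta> + real j * \<alpha>)))"
      using M8 by (intro ln_mono) auto
    then have "ln M - 2 * (m + 1) - 2 * m * (ln 6 + H) \<le> ln 2 + ln (entry_sum (BN (\<theta> + real j * \<alpha>)))"
      using M8 BN1[of "\<theta> + real j * \<alpha>"] by (simp add: ln_mult)
    moreover have "ln (entry_sum (BN (\<theta> + real j * \<alpha>))) \<le> ln (entry_sum (BN \<theta>)) + 2 * ln 2 + 2 * real j * ln g"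
      unfolding BN_def using cocycle_almost_invariant[OF det g] by simp
    moreover have "2 * real j * ln g \<le> 2 * real q * ln g" using jk(1) g by (intro mult_right_mono) auto
    moreover have "ln (entry_sum (BN \<theta>')) \<le> ln 8 + ln M"
      using BNM[of \<theta>'] BN1[of \<theta>'] M8 ln_mono[of "entry_sum (BN \<theta>')" "8 * M"] by (simp add: ln_mult)
    moreover have "2 * m * (ln 6 + H) \<le> 4 * m + 2 * m * H"
    proof -
      have "ln (6::real) \<le> 2"
        using ln_le_cancel_iff[of 6 "exp 2"] exp_ge_one_plus_x_over_n_power_n[of 10 2] by (simp add: power_numeral_reduce)
      then show ?thesis using m0 mult_left_mono[of "ln 6" 2 "2 * m"] by (simp add: algebra_simps)
    qed
    \<comment> \<open>The additive 7 is this 5 plus the 2 in 2 (m + 1); the coefficient 6 of m is 2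
      from the same term plus 4 from ln 6.\<close>
    moreover have "ln 8 + 3 * ln 2 \<le> (5::real)"
      using ln_realpow[of 2 3] ln2_le_25_over_36 by simp
    ultimately show "ln (entry_sum (cocycle \<alpha> B N \<theta>')) - (7 + 6 * m + 2 * m * H + 2 * real q * ln g)
       \<le> ln (entry_sum (cocycle \<alpha> B N \<theta>))"
      unfolding BN_def by (simp add: algebra_simps)
  qed
qed

lemma gevrey_entry_sum_le:
  assumes "B \<in> gevrey s \<rho>" "0 \<le> \<rho>" "gevrey_norm s \<rho> B \<le> \<Gamma>"
  shows "entry_sum (B \<theta>) \<le> 4 * \<Gamma>"
  using gevrey_entry_le[OF assms(1,2)] assms(3) by (intro entry_sum_le) (auto intro: order.trans)

text \<open>With a strip of width about \<open>N powr (1 - s)\<close>, the exponent m of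
  \<open>large_deviation\<close> is of order N^s / q, which gives both the count of order m q and
  the error. The condition \<open>C * real N powr (s - 1) \<le> real q\<close> places the disc
  inside the strip. C depends on \<rho>, s and \<Gamma> only.\<close>

lemma gevrey_large_deviation:
  assumes r: "0 < \<rho>" and s: "1 < s" and \<Gamma>: "1 \<le> \<Gamma>"
  obtains C where "1 \<le> C"
    "\<And>\<alpha> B N q H. B \<in> gevrey_SL2 s \<rho> \<Longrightarrow> gevrey_norm s \<rho> B \<le> \<Gamma> \<Longrightarrow> 1 \<le> N \<Longrightarrow> good_denom \<alpha> q \<Longrightarrow> 2 \<le> q \<Longrightarrow>
      C * real N powr (s - 1) \<le> real q \<Longrightarrow> 1 \<le> H \<Longrightarrow>
      \<exists>F. finite F \<and> real (card F) \<le> C * real N powr s \<and>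
        (\<forall>\<theta> \<theta>'. (\<forall>a\<in>F. \<forall>k. exp (- H) \<le> \<bar>\<theta> - a - of_int k\<bar>) \<longrightarrow>
          ln (entry_sum (cocycle \<alpha> B N \<theta>')) - C * (real N powr s * H / real q + real q)
            \<le> ln (entry_sum (cocycle \<alpha> B N \<theta>)))"
proof -
  define g where "g = 4 * \<Gamma>"
  have g: "4 \<le> g" using \<Gamma> by (simp add: g_def)
  \<comment> \<open>One ln g compensates the growth g^N of the product, the second the factor g in
    the truncation error, and 6 beats the remaining 2 N with a margin of 1/8.\<close>
  define c where "c = 2 * ln g + 6"
  have lng: "0 \<le> ln g" using g by simp
  then have c: "0 < c" by (simp add: c_def)
  obtain w where w: "0 < w" "w \<le> 1" and approx:
    "\<And>N B. 1 \<le> N \<Longrightarrow> B \<in> gevrey s \<rho> \<Longrightarrow> \<exists>T. (\<forall>i j. (\<lambda>z. T z $ i $ j) holomorphic_on UNIV) \<and>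
       (\<forall>z. T (z + 1) = T z) \<and>
       (\<forall>z i j. \<bar>Im z\<bar> \<le> w * real N powr (1 - s) \<longrightarrow> norm (T z $ i $ j) \<le> gevrey_norm s \<rho> B) \<and>
       (\<forall>x i j. norm (of_real (B x $ i $ j) - T (of_real x) $ i $ j) \<le> exp (- c * real N) * gevrey_norm s \<rho> B)"
    using gevrey_approx[OF r s c] by blast
  define L where "L = 8 * (ln 16 + ln g) / w"
  define C where "C = 8 * L + (7 + 2 * ln g) + 8 / w"
  have L: "0 < L" using w lng by (simp add: L_def add_pos_nonneg)
  have C: "1 \<le> C" "2 * L \<le> C" "8 / w \<le> C" "8 * L \<le> C" "7 + 2 * ln g \<le> C"
    using L w lng by (simp_all add: C_def add_nonneg_nonneg)
  show ?thesis
  proof (rule that[OF C(1)])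
    fix \<alpha> B N q and H :: real
    assume B: "B \<in> gevrey_SL2 s \<rho>" "gevrey_norm s \<rho> B \<le> \<Gamma>" and N: "1 \<le> N" and q: "good_denom \<alpha> q" "2 \<le> q"
      and CN: "C * real N powr (s - 1) \<le> real q" and H: "1 \<le> H"
    have Bg: "B \<in> gevrey s \<rho>" and det: "\<And>\<theta>. det (B \<theta>) = 1" and per: "\<And>\<theta>. B (\<theta> + 1) = B \<theta>"
      using B by (auto simp: gevrey_SL2_def gevrey_def)
    obtain T where T: "\<And>i j. (\<lambda>z. T z $ i $ j) holomorphic_on UNIV" "\<And>z. T (z + 1) = T z"
       "\<And>z i j. \<bar>Im z\<bar> \<le> w * real N powr (1 - s) \<Longrightarrow> norm (T z $ i $ j) \<le> gevrey_norm s \<rho> B"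
       "\<And>x i j. norm (of_real (B x $ i $ j) - T (of_real x) $ i $ j) \<le> exp (- c * real N) * gevrey_norm s \<rho> B"
      using approx[OF N Bg] by blast
    define h where "h = w * real N powr (1 - s)"
    define \<delta> where "\<delta> = g * exp (- c * real N)"
    have h: "0 < h" using w N by (simp add: h_def)
    have hinv: "1 / h = real N powr (s - 1) / w"
      using powr_minus[of "real N" "s - 1"] by (simp add: h_def field_simps)
    define m where "m = 8 / (real q * h) * (ln 16 + real N * ln g)"
    have q0: "0 < real q" using q(2) by simp
    have qh: "8 / real q \<le> h"
    proof -
      have "8 / w * real N powr (s - 1) \<le> real q"
        using CN mult_right_mono[OF C(3), of "real N powr (s - 1)"] by simp
      then have "8 * (1 / h) \<le> real q" unfolding hinv by simp
      then show ?thesis using h q0 by (simp add: field_simps)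
    qed
    have \<delta>: "2 * real N * g ^ N * \<delta> \<le> 1 / 8"
    proof -
      have "g ^ N * \<delta> = exp (real N * ln g + ln g - c * real N)"
        using g by (simp add: \<delta>_def exp_diff exp_add exp_of_nat_mult exp_minus field_simps)
      also have "\<dots> \<le> exp (- 6 * real N)"
        using N lng mult_right_mono[of 1 "real N" "ln g"] by (simp add: c_def algebra_simps)
      finally have "2 * real N * (g ^ N * \<delta>) \<le> 2 * real N * exp (- 6 * real N)"
        by (intro mult_left_mono) auto
      also have "\<dots> \<le> 1 / 8"
      proof -
        have "real N * 1 \<le> real N * real N" using N by (intro mult_left_mono) auto
        then have "16 * real N \<le> exp (6 * real N)"
          using exp_lower_Taylor_quadratic[of "6 * real N"] by (simp add: power2_eq_square)
        then show ?thesis by (simp add: exp_minus field_simps)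
      qed
      finally show ?thesis by (simp add: mult.assoc)
    qed
    have "\<exists>F. finite F \<and> real (card F) \<le> 2 * m * real q \<and>
        (\<forall>\<theta> \<theta>'. (\<forall>a\<in>F. \<forall>k. exp (- H) \<le> \<bar>\<theta> - a - of_int k\<bar>) \<longrightarrow>
           ln (entry_sum (cocycle \<alpha> B N \<theta>')) - (7 + 6 * m + 2 * m * H + 2 * real q * ln g)
             \<le> ln (entry_sum (cocycle \<alpha> B N \<theta>)))"
    proof (rule large_deviation[where B=B and T=T and N=N and g=g and h=h and \<delta>=\<delta> and q=q and \<alpha>=\<alpha> and H=H])
      show "entry_sum (B \<theta>) \<le> g" for \<theta> unfolding g_def using gevrey_entry_sum_le[OF Bg _ B(2)] r by simp
      show "entry_sum (T z) \<le> g" if "\<bar>Im z\<bar> \<le> h" for z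
        unfolding g_def using T(3)[of z] that B(2) by (intro entry_sum_le) (auto simp: h_def intro: order.trans)
      show "entry_sum (complex_matrix (B x) - T (of_real x)) \<le> \<delta>" for x
      proof -
        have "entry_sum (complex_matrix (B x) - T (of_real x)) \<le> 4 * (exp (- c * real N) * gevrey_norm s \<rho> B)"
          using T(4)[of x] by (intro entry_sum_le) (simp add: complex_matrix_def)
        also have "\<dots> \<le> \<delta>" unfolding \<delta>_def g_def using B(2) by simp
        finally show ?thesis .
      qed
    qed (use det per g T q qh \<delta> H in \<open>auto simp: m_def\<close>)
    then obtain F where F: "finite F" "real (card F) \<le> 2 * m * real q"
      "\<And>\<theta> \<theta>'. (\<forall>a\<in>F. \<forall>k. exp (- H) \<le> \<bar>\<theta> - a - of_int k\<bar>) \<Longrightarrow>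
           ln (entry_sum (cocycle \<alpha> B N \<theta>')) - (7 + 6 * m + 2 * m * H + 2 * real q * ln g)
             \<le> ln (entry_sum (cocycle \<alpha> B N \<theta>))"
      by blast
    have m: "m \<le> L * real N powr s / real q"
    proof -
      have "m = 8 / real q * (real N powr (s - 1) / w) * (ln 16 + real N * ln g)"
        unfolding m_def by (simp flip: hinv)
      also have "\<dots> \<le> 8 / real q * (real N powr (s - 1) / w) * (real N * (ln 16 + ln g))"
        using N w lng mult_right_mono[of 1 "real N" "ln 16"] by (intro mult_left_mono) (auto simp: algebra_simps)
      also have "\<dots> = L * (real N powr (s - 1) * real N) / real q"
        using w q0 by (simp add: L_def field_simps)
      also have "real N powr (s - 1) * real N = real N powr s"
        using N powr_add[of "real N" "s - 1" 1] by simp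
      finally show ?thesis by simp
    qed
    have m0: "0 \<le> m" unfolding m_def using h lng by simp
    have 1: "real (card F) \<le> C * real N powr s"
    proof -
      have "2 * m * real q \<le> 2 * (L * real N powr s)"
        using m q0 by (simp add: pos_le_divide_eq)
      also have "\<dots> \<le> C * real N powr s" using mult_right_mono[OF C(2), of "real N powr s"] by simp
      finally show ?thesis using F(2) by simp
    qed
    have 2: "7 + 6 * m + 2 * m * H + 2 * real q * ln g \<le> C * (real N powr s * H / real q + real q)"
    proof -
      have "7 + 2 * real q * ln g \<le> (7 + 2 * ln g) * real q" using q lng by (simp add: algebra_simps)
      also have "\<dots> \<le> C * real q" using C(5) by (intro mult_right_mono) auto
      finally have a: "7 + 2 * real q * ln g \<le> C * real q" .
      have "6 * m + 2 * m * H \<le> 8 * (m * H)" using mult_left_mono[OF H m0] by linarith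
      also have "\<dots> \<le> 8 * (L * real N powr s / real q * H)" using m H by (intro mult_left_mono mult_right_mono) auto
      also have "\<dots> = 8 * L * (real N powr s * H / real q)" by simp
      also have "\<dots> \<le> C * (real N powr s * H / real q)" using C(4) H by (intro mult_right_mono) auto
      finally show ?thesis using a by (simp add: algebra_simps)
    qed
    show "\<exists>F. finite F \<and> real (card F) \<le> C * real N powr s \<and>
        (\<forall>\<theta> \<theta>'. (\<forall>a\<in>F. \<forall>k. exp (- H) \<le> \<bar>\<theta> - a - of_int k\<bar>) \<longrightarrow>
          ln (entry_sum (cocycle \<alpha> B N \<theta>')) - C * (real N powr s * H / real q + real q)
            \<le> ln (entry_sum (cocycle \<alpha> B N \<theta>)))"
      using F(1,3) 1 2 by (intro exI[of _ F]) (meson diff_left_mono order.trans)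
  qed
qed

text \<open>After reducing a to its fractional part, only the translates by -1, 0 and 1 can come
  within \<epsilon> of the unit interval. Three intervals of length 2 \<epsilon> per point give the
  factor 6.\<close>

lemma near_integer_translates_small:
  assumes F: "finite F" and e: "0 < \<epsilon>" "\<epsilon> \<le> (1::real)"
  obtains U where "U \<in> sets borel" "emeasure lborel U \<le> ennreal (6 * \<epsilon> * real (card F))"
    "\<And>\<theta> a k. \<theta> \<in> {0..1} \<Longrightarrow> \<theta> \<notin> U \<Longrightarrow> a \<in> F \<Longrightarrow> \<epsilon> \<le> \<bar>\<theta> - a - of_int k\<bar>"
proof
  define I where "I = (\<lambda>(a, k). {frac a + of_int k - \<epsilon> <..< frac a + of_int k + \<epsilon>})"
  define U where "U = (\<Union>p\<in>F \<times> {-1..1::int}. I p)"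
  have meas: "I p \<in> sets borel" for p by (cases p) (simp add: I_def)
  show "U \<in> sets borel" unfolding U_def using F meas by (intro sets.finite_UN) auto
  have "emeasure lborel U \<le> (\<Sum>p\<in>F \<times> {-1..1::int}. emeasure lborel (I p))"
    unfolding U_def using F meas by (intro emeasure_subadditive_finite) auto
  also have "\<dots> = (\<Sum>p\<in>F \<times> {-1..1::int}. ennreal (2 * \<epsilon>))"
    using e by (intro sum.cong) (auto simp: I_def)
  also have "\<dots> = ennreal (6 * \<epsilon> * real (card F))"
    using e F by (simp add: card_cartesian_product ennreal_mult' ennreal_of_nat_eq_real_of_nat algebra_simps flip: ennreal_mult)
  finally show "emeasure lborel U \<le> ennreal (6 * \<epsilon> * real (card F))" .
  fix \<theta> a k assume t: "\<theta> \<in> {0..1}" "\<theta> \<notin> U" and a: "a \<in> F"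
  show "\<epsilon> \<le> \<bar>\<theta> - a - of_int k\<bar>"
  proof (rule ccontr)
    assume "\<not> ?thesis"
    then have lt: "\<bar>\<theta> - frac a - of_int (k + \<lfloor>a\<rfloor>)\<bar> < \<epsilon>" by (simp add: frac_def algebra_simps)
    have "0 \<le> frac a" "frac a < 1" by (simp_all add: frac_lt_1)
    then have "\<bar>real_of_int (k + \<lfloor>a\<rfloor>)\<bar> < 2"
      using lt t(1) e by (simp only: atLeastAtMost_iff abs_less_iff) linarith
    then have "k + \<lfloor>a\<rfloor> \<in> {-1..1}" by auto
    moreover have "\<theta> \<in> I (a, k + \<lfloor>a\<rfloor>)" using lt by (auto simp: I_def abs_less_iff)
    ultimately show False using t(2) a unfolding U_def by blast
  qed
qed

section \<open>Maxima over the circle and one avalanche step\<close>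

definition sup_ln :: "real \<Rightarrow> (real \<Rightarrow> real^2^2) \<Rightarrow> nat \<Rightarrow> real" where
  "sup_ln \<alpha> B N = (SUP \<theta>. ln (entry_sum (cocycle \<alpha> B N \<theta>)))"

lemma ln_entry_sum_cocycle_le:
  assumes "\<And>\<theta>. det (B \<theta>) = 1" "\<And>\<theta>. entry_sum (B \<theta>) \<le> g" "1 \<le> g"
  shows "ln (entry_sum (cocycle \<alpha> B N \<theta>)) \<le> ln 2 + real N * ln g"
proof -
  have "ln (entry_sum (cocycle \<alpha> B N \<theta>)) \<le> ln (2 * g ^ N)"
    using entry_sum_cocycle_le[of B g \<alpha> N \<theta>] entry_sum_cocycle_ge_1[of B \<alpha> N \<theta>] assms
    by (intro ln_mono) auto
  then show ?thesis using assms(3) by (simp add: ln_mult ln_realpow)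
qed

context
  fixes B :: "real \<Rightarrow> real^2^2" and \<alpha> g :: real
  assumes det: "\<And>\<theta>. det (B \<theta>) = 1" and g: "\<And>\<theta>. entry_sum (B \<theta>) \<le> g" "1 \<le> g"
begin

lemma sup_ln_upper: "ln (entry_sum (cocycle \<alpha> B N \<theta>)) \<le> sup_ln \<alpha> B N"
  unfolding sup_ln_def using ln_entry_sum_cocycle_le[of B g, OF det g]
  by (intro cSUP_upper bdd_aboveI2) auto

lemma sup_ln_least: "(\<And>\<theta>. ln (entry_sum (cocycle \<alpha> B N \<theta>)) \<le> c) \<Longrightarrow> sup_ln \<alpha> B N \<le> c"
  unfolding sup_ln_def by (intro cSUP_least) auto

lemma ln_entry_sum_nonneg: "0 \<le> ln (entry_sum (cocycle \<alpha> B N \<theta>))"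
  using entry_sum_cocycle_ge_1[of B, OF det] by simp

lemma sup_ln_nonneg: "0 \<le> sup_ln \<alpha> B N"
  using sup_ln_upper[of N 0] ln_entry_sum_nonneg[of N 0] by linarith

lemma sup_ln_add: "sup_ln \<alpha> B (m + n) \<le> sup_ln \<alpha> B m + sup_ln \<alpha> B n"
proof (rule sup_ln_least)
  fix \<theta>
  have 1: "1 \<le> entry_sum (cocycle \<alpha> B k \<theta>)" for k \<theta> by (intro entry_sum_cocycle_ge_1 det)
  have "ln (entry_sum (cocycle \<alpha> B (m + n) \<theta>))
     \<le> ln (entry_sum (cocycle \<alpha> B m (\<theta> + real n * \<alpha>)) * entry_sum (cocycle \<alpha> B n \<theta>))"
    using 1[of "m + n" \<theta>] entry_sum_mult[of "cocycle \<alpha> B m (\<theta> + real n * \<alpha>)" "cocycle \<alpha> B n \<theta>"]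
    by (intro ln_mono) (auto simp: cocycle_add)
  also have "\<dots> = ln (entry_sum (cocycle \<alpha> B m (\<theta> + real n * \<alpha>))) + ln (entry_sum (cocycle \<alpha> B n \<theta>))"
    using 1[of m "\<theta> + real n * \<alpha>"] 1[of n \<theta>] by (intro ln_mult_pos) auto
  also have "\<dots> \<le> sup_ln \<alpha> B m + sup_ln \<alpha> B n" by (intro add_mono sup_ln_upper)
  finally show "ln (entry_sum (cocycle \<alpha> B (m + n) \<theta>)) \<le> sup_ln \<alpha> B m + sup_ln \<alpha> B n" .
qed

lemma cocycle_mult_eq_matrix_prod:
  "cocycle \<alpha> B (n * N) \<theta> = matrix_prod (\<lambda>j. cocycle \<alpha> B N (\<theta> + real j * real N * \<alpha>)) n"
proof (induction n)
  case (Suc n)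
  have "cocycle \<alpha> B (N + n * N) \<theta> = cocycle \<alpha> B N (\<theta> + real (n * N) * \<alpha>) ** cocycle \<alpha> B (n * N) \<theta>"
    by (rule cocycle_add)
  then show ?case using Suc by simp
qed simp

text \<open>A single good \<theta> suffices because the conclusion concerns a supremum. By
  \<open>small\<close>, the exceptional intervals pulled back by all n block positions do not cover
  the unit interval, so such a \<theta> exists.\<close>

lemma sup_ln_avalanche:
  assumes n: "2 \<le> n" and F: "finite F" and H: "0 \<le> H"
    and small: "6 * exp (- H) * (real n * real (card F)) < 1"
    and ld: "\<And>\<theta> \<theta>'. (\<forall>a\<in>F. \<forall>k. exp (- H) \<le> \<bar>\<theta> - a - of_int k\<bar>) \<Longrightarrow>
       ln (entry_sum (cocycle \<alpha> B (2 * N) \<theta>')) - err \<le> ln (entry_sum (cocycle \<alpha> B (2 * N) \<theta>))"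
  defines "x \<equiv> sup_ln \<alpha> B (2 * N) - err - sup_ln \<alpha> B N"
  assumes x: "3 \<le> x" "sup_ln \<alpha> B N + 7 \<le> 3 * x"
  shows "real n * (x - 3) \<le> sup_ln \<alpha> B (n * N)"
proof -
  define F' where "F' = (\<lambda>(a, j). a - real j * real N * \<alpha>) ` (F \<times> {..<n})"
  have "card F' \<le> card (F \<times> {..<n})" unfolding F'_def using F by (intro card_image_le) auto
  then have "real (card F') \<le> real n * real (card F)"
    by (simp add: card_cartesian_product mult.commute flip: of_nat_mult)
  then have lt: "6 * exp (- H) * real (card F') < 1"
    using small by (intro le_less_trans[OF _ small] mult_left_mono) auto
  obtain U where U: "U \<in> sets borel" "emeasure lborel U \<le> ennreal (6 * exp (- H) * real (card F'))"
    "\<And>\<theta> a k. \<theta> \<in> {0..1} \<Longrightarrow> \<theta> \<notin> U \<Longrightarrow> a \<in> F' \<Longrightarrow> exp (- H) \<le> \<bar>\<theta> - a - of_int k\<bar>"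
    using near_integer_translates_small[of F' "exp (- H)"] F H by (auto simp: F'_def)
  have "\<not> {0..1} \<subseteq> U"
  proof
    assume "{0..1} \<subseteq> U"
    then have "emeasure lborel {0..1::real} \<le> emeasure lborel U" using U(1) by (intro emeasure_mono) auto
    then have "1 \<le> emeasure lborel U" by simp
    then have "1 \<le> ennreal (6 * exp (- H) * real (card F'))" using U(2) by (rule order.trans)
    then show False using lt by simp
  qed
  then obtain \<theta> where \<theta>: "\<theta> \<in> {0..1}" "\<theta> \<notin> U" by blast
  define A where "A j = cocycle \<alpha> B N (\<theta> + real j * real N * \<alpha>)" for j
  have big: "sup_ln \<alpha> B (2 * N) - err \<le> ln (entry_sum (A (Suc j) ** A j))" if j: "Suc j < n" for j
  proof -
    define \<theta>j where "\<theta>j = \<theta> + real j * real N * \<alpha>"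
    have "A (Suc j) ** A j = cocycle \<alpha> B (N + N) \<theta>j"
      using cocycle_add[of \<alpha> B N N \<theta>j] by (simp add: A_def \<theta>j_def algebra_simps)
    then have AA: "A (Suc j) ** A j = cocycle \<alpha> B (2 * N) \<theta>j" by (simp only: mult_2)
    have "\<forall>a\<in>F. \<forall>k. exp (- H) \<le> \<bar>\<theta>j - a - of_int k\<bar>"
    proof (intro ballI allI)
      fix a k assume "a \<in> F"
      then have "a - real j * real N * \<alpha> \<in> F'" using j by (force simp: F'_def)
      from U(3)[OF \<theta> this, of k] show "exp (- H) \<le> \<bar>\<theta>j - a - of_int k\<bar>"
        by (simp add: \<theta>j_def algebra_simps)
    qed
    from ld[OF this] have "sup_ln \<alpha> B (2 * N) \<le> ln (entry_sum (cocycle \<alpha> B (2 * N) \<theta>j)) + err"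
      by (intro sup_ln_least) (simp add: algebra_simps)
    then show ?thesis unfolding AA by simp
  qed
  define a where "a = exp (sup_ln \<alpha> B N)"
  \<comment> \<open>The ratio between a double block and a single one is at least exp x, and the 4
    matches the factor 4 in \<open>avalanche_lower\<close>. Its requirement 8 a \<le> gr^3 becomes
    512 a \<le> exp (3 x), which follows from 512 \<le> exp 7; finally exp 3 \<ge> 8 lets x - 3
    replace the logarithm of gr / 2.\<close>
  define gr where "gr = exp x / 4"
  have ep: "0 < entry_sum (cocycle \<alpha> B k \<theta>)" for k \<theta>
    using entry_sum_cocycle_ge_1[of B \<alpha> k \<theta>, OF det] by linarith
  have e3: "16 \<le> exp (3::real)"
    using exp_ge_one_plus_x_over_n_power_n[of 30 3] by (simp add: power_numeral_reduce)
  have "(gr / 2) ^ n \<le> entry_sum (matrix_prod A n)"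
  proof (rule avalanche_lower[where a=a])
    show "det (A j) = 1" for j unfolding A_def by (intro det_cocycle det)
    show "entry_sum (A j) \<le> a" for j
      using sup_ln_upper[of N "\<theta> + real j * real N * \<alpha>"] ep[of N "\<theta> + real j * real N * \<alpha>"]
      unfolding A_def a_def by (metis exp_le_cancel_iff exp_ln)
    show "4 * (gr * a) \<le> entry_sum (A (Suc j) ** A j)" if "Suc j < n" for j
    proof -
      have AA: "A (Suc j) ** A j = cocycle \<alpha> B (N + N) (\<theta> + real j * real N * \<alpha>)"
        using cocycle_add[of \<alpha> B N N "\<theta> + real j * real N * \<alpha>"] by (simp add: A_def algebra_simps)
      have "4 * (gr * a) = exp (sup_ln \<alpha> B (2 * N) - err)"
        by (simp add: gr_def a_def x_def flip: exp_add)
      also have "\<dots> \<le> exp (ln (entry_sum (A (Suc j) ** A j)))" using big[OF that] by simp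
      also have "\<dots> = entry_sum (A (Suc j) ** A j)" unfolding AA by (simp add: ep)
      finally show ?thesis .
    qed
    have ex: "exp 3 \<le> exp x" using x by simp
    then show "3 \<le> gr" unfolding gr_def using e3 by linarith
    have "512 \<le> exp (7::real)"
    proof -
      have "exp (7::real) = exp 3 * exp 3 * exp 1" by (simp flip: exp_add)
      moreover have "16 * 16 * 2 \<le> exp 3 * exp 3 * exp (1::real)"
        using e3 exp_ge_add_one_self[of 1] by (intro mult_mono) auto
      ultimately show ?thesis by simp
    qed
    then have "512 * a \<le> exp 7 * a" by (intro mult_right_mono) (auto simp: a_def)
    moreover have "exp 7 * a \<le> exp (3 * x)"
      using x(2) unfolding a_def by (simp add: mult_exp_exp add.commute)
    ultimately have "512 * a \<le> exp (3 * x)" by linarith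
    then show "8 * a \<le> gr ^ 3" by (simp add: gr_def power_divide exp_of_nat_mult[symmetric])
  qed (rule n)
  then have "(gr / 2) ^ n \<le> entry_sum (cocycle \<alpha> B (n * N) \<theta>)"
    unfolding cocycle_mult_eq_matrix_prod A_def[symmetric] by simp
  moreover have "exp (real n * (x - 3)) \<le> (gr / 2) ^ n"
  proof -
    have "exp (x - 3) \<le> gr / 2"
    proof -
      have "exp x * 8 \<le> exp x * exp 3" using e3 by (intro mult_left_mono) auto
      then show ?thesis by (simp add: gr_def exp_diff field_simps)
    qed
    then have "exp (x - 3) ^ n \<le> (gr / 2) ^ n" by (intro power_mono) auto
    then show ?thesis by (simp add: exp_of_nat_mult)
  qed
  ultimately have "exp (real n * (x - 3)) \<le> entry_sum (cocycle \<alpha> B (n * N) \<theta>)" by simp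
  then have "real n * (x - 3) \<le> ln (entry_sum (cocycle \<alpha> B (n * N) \<theta>))"
    using ep by (simp add: ln_ge_iff)
  also have "\<dots> \<le> sup_ln \<alpha> B (n * N)" by (rule sup_ln_upper)
  finally show ?thesis .
qed

end

section \<open>Multiscale induction\<close>

lemma pigeonhole_small_drop:
  fixes f :: "nat \<Rightarrow> real"
  assumes "\<And>i. 0 \<le> f i" "\<And>i. f i \<le> M" "0 < m"
  shows "\<exists>i. i0 \<le> i \<and> i < i0 + m \<and> f i - f (Suc i) \<le> M / real m"
proof (rule ccontr)
  assume "\<not> ?thesis"
  then have gt: "M / real m < f (i0 + j) - f (Suc (i0 + j))" if "j < m" for j
    using that by (meson le_add1 nat_add_left_cancel_less not_le)
  have "M = (\<Sum>j<m. M / real m)" using assms(3) by simp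
  also have "\<dots> < (\<Sum>j<m. f (i0 + j) - f (Suc (i0 + j)))"
    using assms(3) gt by (intro sum_strict_mono) auto
  also have "\<dots> = f i0 - f (i0 + m)"
    using sum_lessThan_telescope'[of "\<lambda>j. f (i0 + j)" m] by simp
  finally show False using assms(1)[of "i0 + m"] assms(2)[of i0] by simp
qed

text \<open>On the scale log 2 the window has length \<tau> log_2 x \<ge> \<tau> ln x. Rounding both
  ends costs at most 2, which is half of this by \<open>big\<close>.\<close>

lemma dyadic_window:
  fixes x \<tau> :: real
  assumes x: "1 \<le> x" and t: "0 < \<tau>" and big: "4 \<le> \<tau> * ln x"
  obtains i0 m :: nat where "0 < m" "x powr (1 + \<tau>) \<le> 2 ^ i0" "2 ^ (i0 + m) \<le> x powr (1 + 2 * \<tau>)"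
    "\<tau> * ln x / 2 \<le> real m"
proof -
  define l where "l = log 2 x"
  have l: "x = 2 powr l" using x by (simp add: l_def)
  have lnx: "0 \<le> ln x" using x by simp
  have "ln 2 * ln x \<le> 1 * ln x" using lnx ln2_le_25_over_36 by (intro mult_right_mono) auto
  then have lge: "ln x \<le> l" by (simp add: l_def log_def field_simps)
  then have tl: "\<tau> * ln x \<le> \<tau> * l" using t by simp
  define i0 where "i0 = nat \<lceil>(1 + \<tau>) * l\<rceil>"
  define i1 where "i1 = nat \<lfloor>(1 + 2 * \<tau>) * l\<rfloor>"
  have l0: "0 \<le> l" using lge lnx by simp
  have nn: "0 \<le> (1 + \<tau>) * l" "0 \<le> (1 + 2 * \<tau>) * l" using l0 t by simp_all
  have i0: "(1 + \<tau>) * l \<le> real i0" "real i0 < (1 + \<tau>) * l + 1"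
    using nn unfolding i0_def by linarith+
  have i1: "real i1 \<le> (1 + 2 * \<tau>) * l" "(1 + 2 * \<tau>) * l - 1 < real i1"
    using nn unfolding i1_def by linarith+
  have d: "\<tau> * ln x - 2 \<le> real i1 - real i0"
    using i0 i1 tl by (simp add: algebra_simps)
  then have lt: "i0 < i1" using big by linarith
  show ?thesis
  proof (rule that[of "i1 - i0" i0])
    have xp: "x powr a = 2 powr (a * l)" for a
      by (subst l) (simp only: powr_powr mult.commute)
    have p2: "(2::real) ^ i = 2 powr real i" for i by (simp add: powr_realpow)
    show "x powr (1 + \<tau>) \<le> 2 ^ i0" unfolding xp p2 using i0(1) by simp
    show "2 ^ (i0 + (i1 - i0)) \<le> x powr (1 + 2 * \<tau>)" unfolding xp p2 using i1(1) lt by simp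
    show "\<tau> * ln x / 2 \<le> real (i1 - i0)" using d lt big by simp
  qed (use lt in auto)
qed

lemma geometric_partial_sum:
  fixes \<delta> :: real
  assumes "0 < \<delta>"
  shows "(\<Sum>j<k. 1 / (1 + \<delta>) ^ j) \<le> (1 + \<delta>) / \<delta>"
proof -
  have "(\<Sum>j<k. 1 / (1 + \<delta>) ^ j) = (1 + \<delta>) / \<delta> - (1 + \<delta>) / (\<delta> * (1 + \<delta>) ^ k)"
  proof (induction k)
    case (Suc k)
    define R where "R = (1 + \<delta>) ^ k"
    have "0 < R" using assms by (simp add: R_def)
    then have "1 / R - (1 + \<delta>) / (\<delta> * R) = - ((1 + \<delta>) / (\<delta> * ((1 + \<delta>) * R)))"
      using assms by (simp add: divide_simps)
    then show ?case unfolding sum.lessThan_Suc Suc.IH power_Suc R_def[symmetric] by linarith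
  qed simp
  moreover have "0 \<le> (1 + \<delta>) / (\<delta> * (1 + \<delta>) ^ k)" using assms by simp
  ultimately show ?thesis by simp
qed

text \<open>In each window a scale with a small drop is found by pigeonhole, and this scale controls all later ones
  up to the end of the next window. The losses \<open>K / ln q\<close> form a geometric series because
  \<open>ln q\<close> grows at least geometrically along the chain.\<close>

lemma multiscale_chain:
  fixes f :: "nat \<Rightarrow> real" and Q :: "nat set"
  assumes f: "\<And>i. 0 \<le> f i" "\<And>i. f i \<le> M" "\<And>i. f (Suc i) \<le> f i"
    and t: "0 < \<tau>" and \<delta>: "0 < \<delta>" and q0: "q0 \<in> Q" "2 \<le> q0"
    and step: "\<And>q i i'. q \<in> Q \<Longrightarrow> q0 \<le> q \<Longrightarrow> real q powr (1 + \<tau>) \<le> 2 ^ i \<Longrightarrow> 2 ^ Suc i \<le> real q powr (1 + 2 * \<tau>) \<Longrightarrow>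
       i < i' \<Longrightarrow> 2 ^ i' \<le> exp (real q powr \<sigma> / 2) \<Longrightarrow> \<mu> \<le> f i \<Longrightarrow> f i - f (Suc i) \<le> \<mu> / 8 \<Longrightarrow>
       f i - 2 * (f i - f (Suc i)) - 1 / ln (real q) \<le> f i'"
    and gap: "\<And>q. q \<in> Q \<Longrightarrow> q0 \<le> q \<Longrightarrow> \<exists>q'\<in>Q. real q powr (1 + \<delta>) \<le> real q' \<and>
       real q' powr (1 + 2 * \<tau>) \<le> exp (real q powr \<sigma> / 2)"
    and big: "4 \<le> \<tau> * ln (real q0)" "2 * M / (\<tau> * ln (real q0)) \<le> \<mu> / 8"
      "(4 * M / \<tau> + 1) / ln (real q0) * ((1 + \<delta>) / \<delta>) \<le> L - \<mu>"
    and base: "\<And>i. 2 ^ i \<le> real q0 powr (1 + 2 * \<tau>) \<Longrightarrow> L \<le> f i"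
  shows "\<mu> \<le> f i"
proof -
  \<comment> \<open>The pigeonhole gives a drop of at most 2 M / (\<tau> ln q). The avalanche step
    doubles it and adds 1 / ln q, so one link of the chain costs K / ln q.\<close>
  define K where "K = 4 * M / \<tau> + 1"
  define l0 where "l0 = ln (real q0)"
  have l0: "0 < l0" using q0 by (simp add: l0_def)
  have M0: "0 \<le> M" using f(1,2)[of 0] by linarith
  have K0: "0 < K" using M0 t by (simp add: K_def add_nonneg_pos)
  define loss where "loss k = K / l0 * (\<Sum>j<k. 1 / (1 + \<delta>) ^ j)" for k
  have loss: "L - loss k \<ge> \<mu>" for k
  proof -
    have "loss k \<le> K / l0 * ((1 + \<delta>) / \<delta>)"
      unfolding loss_def using K0 l0 geometric_partial_sum[OF \<delta>] by (intro mult_left_mono) auto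
    then show ?thesis using big(3) by (simp add: K_def l0_def)
  qed
  have chain: "\<exists>q\<in>Q. q0 \<le> q \<and> (1 + \<delta>) ^ k * l0 \<le> ln (real q) \<and>
      (\<forall>i. 2 ^ i \<le> real q powr (1 + 2 * \<tau>) \<longrightarrow> L - loss k \<le> f i)" for k
  proof (induction k)
    case 0
    show ?case using q0 base by (intro bexI[of _ q0]) (auto simp: l0_def loss_def)
  next
    case (Suc k)
    then obtain q where q: "q \<in> Q" "q0 \<le> q" "(1 + \<delta>) ^ k * l0 \<le> ln (real q)"
      and IH: "\<And>i. 2 ^ i \<le> real q powr (1 + 2 * \<tau>) \<Longrightarrow> L - loss k \<le> f i" by blast
    have q2: "2 \<le> real q" using q(2) q0 by simp
    have lq: "l0 \<le> ln (real q)" unfolding l0_def using q(2) q0 by (intro ln_mono) auto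
    have t4: "4 \<le> \<tau> * ln (real q)"
      using big(1) t by (intro order.trans[OF big(1)] mult_left_mono lq[unfolded l0_def]) auto
    have q1: "1 \<le> real q" using q2 by simp
    obtain i0 m where im: "0 < m" "real q powr (1 + \<tau>) \<le> 2 ^ i0" "2 ^ (i0 + m) \<le> real q powr (1 + 2 * \<tau>)"
      "\<tau> * ln (real q) / 2 \<le> real m"
      by (rule dyadic_window[OF q1 t t4])
    obtain i where i: "i0 \<le> i" "i < i0 + m" "f i - f (Suc i) \<le> M / real m"
      using pigeonhole_small_drop[of f M m i0] f im(1) by blast
    have pw: "(2::real) ^ i0 \<le> 2 ^ i" "(2::real) ^ Suc i \<le> 2 ^ (i0 + m)"
      using i by (auto intro!: power_increasing simp del: power_Suc)
    have wi: "real q powr (1 + \<tau>) \<le> 2 ^ i" "2 ^ Suc i \<le> real q powr (1 + 2 * \<tau>)"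
      using pw im by linarith+
    have "M / real m \<le> M / (\<tau> * ln (real q) / 2)"
      using im M0 t lq l0 by (intro divide_left_mono) auto
    then have drop: "f i - f (Suc i) \<le> 2 * M / (\<tau> * ln (real q))" using i(3) by (simp add: mult.commute)
    also have "\<dots> \<le> 2 * M / (\<tau> * l0)"
      using M0 t lq l0 by (intro divide_left_mono mult_left_mono) auto
    finally have d8: "f i - f (Suc i) \<le> \<mu> / 8" using big(2) by (simp add: l0_def)
    have "(2::real) ^ i \<le> 2 ^ Suc i" by simp
    then have fi: "L - loss k \<le> f i" using wi(2) by (intro IH) linarith
    then have li: "\<mu> \<le> f i" using loss[of k] by simp
    obtain q' where q': "q' \<in> Q" "real q powr (1 + \<delta>) \<le> real q'" "real q' powr (1 + 2 * \<tau>) \<le> exp (real q powr \<sigma> / 2)"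
      using gap[OF q(1,2)] by blast
    have "ln (real q powr (1 + \<delta>)) \<le> ln (real q')" using q' q2 by (intro ln_mono) auto
    then have lq': "(1 + \<delta>) * ln (real q) \<le> ln (real q')" using q2 by (simp add: ln_powr)
    have "real q powr 1 \<le> real q powr (1 + \<delta>)" using q2 \<delta> by (intro powr_mono) auto
    then have qq': "q0 \<le> q'" using q'(2) q(2) q2 by simp
    have l1: "(1 + \<delta>) ^ Suc k * l0 \<le> ln (real q')"
    proof -
      have "(1 + \<delta>) ^ Suc k * l0 = (1 + \<delta>) * ((1 + \<delta>) ^ k * l0)" by simp
      also have "\<dots> \<le> (1 + \<delta>) * ln (real q)" using q(3) \<delta> by (intro mult_left_mono) auto
      finally show ?thesis using lq' by simp
    qed
    have "L - loss (Suc k) \<le> f i'" if i': "2 ^ i' \<le> real q' powr (1 + 2 * \<tau>)" for i'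
    proof -
      have lossS: "loss (Suc k) = loss k + K / ((1 + \<delta>) ^ k * l0)" by (simp add: loss_def algebra_simps)
      have pos: "0 < (1 + \<delta>) ^ k * l0" using \<delta> l0 by simp
      have Kl: "K / ln (real q) \<le> K / ((1 + \<delta>) ^ k * l0)"
        using q(3) K0 pos by (intro divide_left_mono) auto
      show ?thesis
      \<comment> \<open>Scales beyond i are reached by one avalanche step; those up to i follow from
        monotonicity of f.\<close>
      proof (cases "i < i'")
        case True
        have st: "f i - 2 * (f i - f (Suc i)) - 1 / ln (real q) \<le> f i'"
          using step[OF q(1,2) wi True _ li d8] i' q'(3) by simp
        have eq: "2 * (2 * M / (\<tau> * ln (real q))) + 1 / ln (real q) = K / ln (real q)"
          using t lq l0 by (simp add: K_def field_simps)
        have lin: "L - (a + b) \<le> w"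
          if "y - 2 * h - c \<le> w" "2 * p + c = e" "h \<le> p" "L - a \<le> y" "e \<le> b" for a b c e h p w y :: real
          using that by linarith
        show ?thesis unfolding lossS by (rule lin[OF st eq drop fi Kl])
      next
        case False
        then have "f i \<le> f i'" using lift_Suc_antimono_le[of f i' i] f(3) by simp
        moreover have "0 \<le> K / ((1 + \<delta>) ^ k * l0)" using K0 pos by simp
        ultimately show ?thesis using fi unfolding lossS by linarith
      qed
    qed
    then show ?case using q'(1) qq' l1 by blast
  qed
  \<comment> \<open>The logarithms of the denominators in the chain are unbounded, so a prescribed
    scale i is covered by some link.\<close>
  obtain k where k: "real i / l0 < (1 + \<delta>) ^ k"
    using real_arch_pow[of "1 + \<delta>" "real i / l0"] \<delta> by auto
  obtain q where q: "q \<in> Q" "q0 \<le> q" "(1 + \<delta>) ^ k * l0 \<le> ln (real q)"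
      "\<And>i. 2 ^ i \<le> real q powr (1 + 2 * \<tau>) \<Longrightarrow> L - loss k \<le> f i"
    using chain[of k] by blast
  have q2: "2 \<le> real q" using q(2) q0 by simp
  have "real i < ln (real q)" using k l0 q(3) by (simp add: pos_divide_less_eq)
  then have "real i * ln 2 \<le> ln (real q) * 1" using ln2_le_25_over_36 by (intro mult_mono) auto
  then have "exp (real i * ln 2) \<le> real q" using q2 by (simp add: ln_ge_iff)
  then have "2 ^ i \<le> real q powr 1" using q2 by (simp add: exp_of_nat_mult)
  also have "\<dots> \<le> real q powr (1 + 2 * \<tau>)" using q2 t by (intro powr_mono) auto
  finally show ?thesis using q(4)[of i] loss[of k] by linarith
qed

text \<open>Subadditivity makes this sequence decreasing in i. For general lengths N the quotient
  S_N / N need not be monotone, and the pigeonhole argument relies on nonnegative drops under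
  doubling.\<close>

definition dyadic_sup :: "real \<Rightarrow> (real \<Rightarrow> real^2^2) \<Rightarrow> nat \<Rightarrow> real" where
  "dyadic_sup \<alpha> B i = sup_ln \<alpha> B (2 ^ i) / 2 ^ i"

text \<open>The choice of \<open>\<tau>\<close> makes both error terms of the large deviation estimate \<open>O(q powr (- \<tau>))\<close> at
  all scales \<open>N\<close> of the window.\<close>

lemma window_error:
  fixes q N s \<tau> \<sigma> :: real
  assumes q: "1 \<le> q" and s: "1 < s" "s < 2" and N: "q powr (1 + \<tau>) \<le> N" "2 * N \<le> q powr (1 + 2 * \<tau>)"
    and N1: "1 \<le> N" and k: "k = 1 \<or> k = 2"
    and e: "(1 + 2 * \<tau>) * (s - 1) + \<sigma> - 1 \<le> - \<tau>"
  shows "((k * N) powr s * q powr \<sigma> / q + q) / (k * N) \<le> 3 * q powr (- \<tau>)"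
    "(k * N) powr (s - 1) \<le> q powr ((1 + 2 * \<tau>) * (s - 1))"
    "(k * N) powr s \<le> q powr ((1 + 2 * \<tau>) * s)"
proof -
  have kN: "1 \<le> k * N" "k * N \<le> q powr (1 + 2 * \<tau>)" using N N1 k by auto
  show 1: "(k * N) powr (s - 1) \<le> q powr ((1 + 2 * \<tau>) * (s - 1))"
    unfolding powr_powr[symmetric] using kN s by (intro powr_mono2) auto
  show "(k * N) powr s \<le> q powr ((1 + 2 * \<tau>) * s)"
    unfolding powr_powr[symmetric] using kN s by (intro powr_mono2) auto
  have "(k * N) powr s = (k * N) powr (s - 1) * (k * N)"
    using kN powr_add[of "k * N" "s - 1" 1] by simp
  then have "(k * N) powr s * q powr \<sigma> / q / (k * N) = (k * N) powr (s - 1) * (q powr \<sigma> / q)"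
    using kN by simp
  also have "q powr \<sigma> / q = q powr (\<sigma> - 1)" using q by (simp add: powr_diff)
  also have "(k * N) powr (s - 1) * q powr (\<sigma> - 1) \<le> q powr ((1 + 2 * \<tau>) * (s - 1)) * q powr (\<sigma> - 1)"
    using 1 by (intro mult_right_mono) auto
  also have "\<dots> = q powr ((1 + 2 * \<tau>) * (s - 1) + \<sigma> - 1)" by (simp add: powr_add[symmetric] add_diff_eq)
  also have "\<dots> \<le> q powr (- \<tau>)" using q e by (intro powr_mono) auto
  finally have a: "(k * N) powr s * q powr \<sigma> / q / (k * N) \<le> q powr (- \<tau>)" .
  have "q powr (1 + \<tau>) \<le> k * N" using N N1 k by auto
  moreover have "0 < k * N * q powr (1 + \<tau>)"
    by (rule mult_pos_pos) (use q kN in auto)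
  ultimately have "q / (k * N) \<le> q / q powr (1 + \<tau>)"
    using q by (intro divide_left_mono) auto
  also have "\<dots> = q powr (- \<tau>)" using q powr_diff[of q 1 "1 + \<tau>"] by simp
  finally have b: "q / (k * N) \<le> q powr (- \<tau>)" .
  have "((k * N) powr s * q powr \<sigma> / q + q) / (k * N)
      = (k * N) powr s * q powr \<sigma> / q / (k * N) + q / (k * N)"
    by (rule add_divide_distrib)
  then show "((k * N) powr s * q powr \<sigma> / q + q) / (k * N) \<le> 3 * q powr (- \<tau>)"
    using a b powr_ge_zero[of q "- \<tau>"] by linarith
qed

lemma gevrey_SL2_bounds:
  assumes B: "B \<in> gevrey_SL2 s \<rho>" "gevrey_norm s \<rho> B \<le> \<Gamma>" and r: "0 < \<rho>" and \<Gamma>: "1 \<le> \<Gamma>"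
  shows "\<And>\<theta>. det (B \<theta>) = 1" "\<And>\<theta>. entry_sum (B \<theta>) \<le> 4 * \<Gamma>" "1 \<le> 4 * \<Gamma>" "\<And>\<theta>. B (\<theta> + 1) = B \<theta>"
  using B r \<Gamma> gevrey_entry_sum_le[of B s \<rho> \<Gamma>] by (auto simp: gevrey_SL2_def gevrey_def)

text \<open>Take H = q^\<sigma>. The exceptional set has measure exp (-q^\<sigma>) up to a power of
  q, so exp (q^\<sigma> / 2) blocks still leave a good point, while the error per step is
  O(q^(-\<tau>)) and hence below 1 / ln q. The quantifiers over \<alpha> and B stand inside the
  eventuality, so one threshold for q serves all of them.\<close>

lemma multiscale_step:
  assumes r: "0 < \<rho>" and s: "1 < s" "s < 2" and \<Gamma>: "1 \<le> \<Gamma>" and t: "0 < \<tau>" "0 < \<sigma>"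
    and e: "(1 + 2 * \<tau>) * (s - 1) + \<sigma> - 1 \<le> - \<tau>" and \<mu>: "0 < \<mu>"
  shows "\<forall>\<^sub>F q::nat in sequentially. \<forall>\<alpha> B i i'. good_denom \<alpha> q \<longrightarrow> B \<in> gevrey_SL2 s \<rho> \<longrightarrow> gevrey_norm s \<rho> B \<le> \<Gamma> \<longrightarrow>
     real q powr (1 + \<tau>) \<le> 2 ^ i \<longrightarrow> 2 ^ Suc i \<le> real q powr (1 + 2 * \<tau>) \<longrightarrow> i < i' \<longrightarrow> 2 ^ i' \<le> exp (real q powr \<sigma> / 2) \<longrightarrow>
     \<mu> \<le> dyadic_sup \<alpha> B i \<longrightarrow> dyadic_sup \<alpha> B i - dyadic_sup \<alpha> B (Suc i) \<le> \<mu> / 8 \<longrightarrow>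
     dyadic_sup \<alpha> B i - 2 * (dyadic_sup \<alpha> B i - dyadic_sup \<alpha> B (Suc i)) - 1 / ln (real q) \<le> dyadic_sup \<alpha> B i'"
proof -
  obtain C where C: "1 \<le> C" and ldt:
    "\<And>\<alpha> B N q H. B \<in> gevrey_SL2 s \<rho> \<Longrightarrow> gevrey_norm s \<rho> B \<le> \<Gamma> \<Longrightarrow> 1 \<le> N \<Longrightarrow> good_denom \<alpha> q \<Longrightarrow> 2 \<le> q \<Longrightarrow>
      C * real N powr (s - 1) \<le> real q \<Longrightarrow> 1 \<le> H \<Longrightarrow>
      \<exists>F. finite F \<and> real (card F) \<le> C * real N powr s \<and>
        (\<forall>\<theta> \<theta>'. (\<forall>a\<in>F. \<forall>k. exp (- H) \<le> \<bar>\<theta> - a - of_int k\<bar>) \<longrightarrow>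
          ln (entry_sum (cocycle \<alpha> B N \<theta>')) - C * (real N powr s * H / real q + real q)
            \<le> ln (entry_sum (cocycle \<alpha> B N \<theta>)))"
    using gevrey_large_deviation[OF r s(1) \<Gamma>] by blast
  have C0: "0 < C" using C by simp
  define u where "u = (1 + 2 * \<tau>) * (s - 1)"
  have u: "0 < u" "u < 1" using e t s unfolding u_def by (simp_all add: mult_pos_pos)
  define v where "v = (1 + 2 * \<tau>) * s"
  have v: "0 < v" using t s by (simp add: v_def)
  have ev: "\<forall>\<^sub>F q::nat in sequentially. P (real q)" if "\<forall>\<^sub>F x in at_top. P x" for P
    using that filterlim_real_sequentially by (simp add: filterlim_iff)
  have "\<forall>\<^sub>F x in at_top. C * x powr u \<le> x" using C0 u by real_asymp
  note e1 = ev[OF this]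
  have "\<forall>\<^sub>F x in at_top. 6 * exp (- (x powr \<sigma>)) * (exp (x powr \<sigma> / 2) * (C * x powr v)) < 1"
    using C0 v t by real_asymp
  note e2 = ev[OF this]
  have "\<forall>\<^sub>F x in at_top. 6 * C * x powr (- \<tau>) \<le> \<mu> / 8" using C0 t \<mu> by real_asymp
  note e3 = ev[OF this]
  have "\<forall>\<^sub>F x in at_top. (6 * C + 3) * x powr (- \<tau>) \<le> 1 / ln x" using C0 t by real_asymp
  note e4 = ev[OF this]
  have "\<forall>\<^sub>F x in at_top. max 2 (8 / \<mu>) \<le> x" by (rule eventually_ge_at_top)
  note e5 = ev[OF this]
  have "\<forall>\<^sub>F x in at_top. 1 \<le> x powr \<sigma>" using t by real_asymp
  note e6 = ev[OF this]
  show ?thesis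
    using e1 e2 e3 e4 e5 e6
  proof eventually_elim
    case (elim q)
    show ?case
    proof (intro allI impI)
      fix \<alpha> B i i'
      assume q: "good_denom \<alpha> q" and B: "B \<in> gevrey_SL2 s \<rho>" "gevrey_norm s \<rho> B \<le> \<Gamma>"
        and w1: "real q powr (1 + \<tau>) \<le> 2 ^ i" and w2: "2 ^ Suc i \<le> real q powr (1 + 2 * \<tau>)"
        and ii: "i < i'" and i': "2 ^ i' \<le> exp (real q powr \<sigma> / 2)"
        and f1: "\<mu> \<le> dyadic_sup \<alpha> B i" and f2: "dyadic_sup \<alpha> B i - dyadic_sup \<alpha> B (Suc i) \<le> \<mu> / 8"
      note Bb = gevrey_SL2_bounds[OF B r \<Gamma>]
      define N where "N = (2::nat) ^ i"
      define n where "n = (2::nat) ^ (i' - i)"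
      define H where "H = real q powr \<sigma>"
      have q2: "2 \<le> q" using elim(5) by simp
      have N: "real N = 2 ^ i" "1 \<le> N" by (simp_all add: N_def)
      have nN: "n * N = 2 ^ i'" using ii by (simp add: n_def N_def flip: power_add)
      have n2: "2 \<le> n" using ii power_increasing[of 1 "i' - i" "2::nat"] by (simp add: n_def)
      have rN: "0 < real N" using N(2) by simp
      define err where "err = C * (real (2 * N) powr s * H / real q + real q)"
      \<comment> \<open>The factor 2: the deviation estimate is applied to double blocks, since the
        avalanche principle needs a lower bound only for products of two neighbours.\<close>
      note we = window_error[of "real q" s \<tau> "real N" 2 \<sigma>, OF _ s _ _ _ _ e, unfolded N(1)]
      have q1: "1 \<le> real q" using q2 by simp
      have we1: "(real (2 * N) powr s * H / real q + real q) / real (2 * N) \<le> 3 * real q powr (- \<tau>)"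
        and we2: "real (2 * N) powr (s - 1) \<le> real q powr u"
        and we3: "real (2 * N) powr s \<le> real q powr v"
        using we[OF q1 w1] w2 by (simp_all add: H_def N u_def v_def)
      have Cq: "C * real (2 * N) powr (s - 1) \<le> real q"
        using mult_left_mono[OF we2, of C] C0 elim(1) by linarith
      have H1: "1 \<le> H" using elim(6) by (simp add: H_def)
      obtain F where F: "finite F" "real (card F) \<le> C * real (2 * N) powr s"
        "\<And>\<theta> \<theta>'. (\<forall>a\<in>F. \<forall>k. exp (- H) \<le> \<bar>\<theta> - a - of_int k\<bar>) \<Longrightarrow>
          ln (entry_sum (cocycle \<alpha> B (2 * N) \<theta>')) - err \<le> ln (entry_sum (cocycle \<alpha> B (2 * N) \<theta>))"
        using ldt[OF B _ q q2 Cq H1] N(2) unfolding err_def by (metis mult_le_mono one_le_numeral mult_1)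
      have errN: "err / real N \<le> 6 * C * real q powr (- \<tau>)"
      proof -
        have "err / real N = 2 * C * ((real (2 * N) powr s * H / real q + real q) / real (2 * N))"
          by (simp add: err_def)
        also have "\<dots> \<le> 2 * C * (3 * real q powr (- \<tau>))" using we1 C0 by (intro mult_left_mono) auto
        finally show ?thesis by simp
      qed
      define S S2 where "S = sup_ln \<alpha> B N" and "S2 = sup_ln \<alpha> B (2 * N)"
      have dS: "dyadic_sup \<alpha> B i = S / real N" "dyadic_sup \<alpha> B (Suc i) = S2 / (2 * real N)"
        by (simp_all add: dyadic_sup_def S_def S2_def N_def)
      define x where "x = S2 - err - S"
      define d where "d = dyadic_sup \<alpha> B i - dyadic_sup \<alpha> B (Suc i)"
      have xN: "x / real N = dyadic_sup \<alpha> B i - 2 * d - err / real N"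
        using rN unfolding d_def dS x_def by (simp add: field_simps)
      have e8: "err / real N \<le> \<mu> / 8" using errN elim(3) by linarith
      \<comment> \<open>Twice the drop and the error take at most \<mu>/4 + \<mu>/8 from a quantity
        that is at least \<mu>, leaving 5/8. With S \<ge> 8 this yields 3 x \<ge> 15/8 S \<ge> S +
        7, as \<open>sup_ln_avalanche\<close> requires.\<close>
      have x58: "5/8 * (S / real N) \<le> x / real N"
      proof -
        have "5/8 * f \<le> y" if "y = f - 2 * h - c" "\<mu> \<le> f" "h \<le> \<mu> / 8" "c \<le> \<mu> / 8" for f h y c
          using that by linarith
        from this[OF xN f1 _ e8] f2 show ?thesis unfolding d_def dS(1) by blast
      qed
      then have x58': "5/8 * S \<le> x" using rN by (simp add: field_simps)
      have "real q \<le> real q powr (1 + \<tau>)" using q1 t powr_mono[of 1 "1 + \<tau>" "real q"] by simp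
      then have qN: "real q \<le> real N" using w1 unfolding N(1) by linarith
      have "8 / \<mu> \<le> real N" using elim(5) qN by simp
      then have "8 \<le> \<mu> * real N" using \<mu> by (simp add: field_simps)
      also have "\<dots> \<le> S" using f1 rN unfolding dS by (simp add: field_simps)
      finally have S8: "8 \<le> S" .
      have small: "6 * exp (- H) * (real n * real (card F)) < 1"
      proof -
        have "n * 1 \<le> n * N" using N(2) by (rule mult_le_mono2)
        then have "real n \<le> real (n * N)" by (simp only: of_nat_le_iff mult_1_right)
        also have "\<dots> \<le> exp (real q powr \<sigma> / 2)" unfolding nN using i' by simp
        finally have n: "real n \<le> exp (real q powr \<sigma> / 2)" .
        have "real (card F) \<le> C * real q powr v"
          using F(2) mult_left_mono[OF we3, of C] C0 by linarith
        then have "6 * exp (- H) * (real n * real (card F))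
            \<le> 6 * exp (- H) * (exp (real q powr \<sigma> / 2) * (C * real q powr v))"
          using n by (intro mult_left_mono mult_mono) auto
        then show ?thesis using elim(2) unfolding H_def by linarith
      qed
      have "real n * (x - 3) \<le> sup_ln \<alpha> B (n * N)"
        unfolding x_def S_def S2_def
        by (rule sup_ln_avalanche[OF Bb(1,2,3) n2 F(1) _ small F(3)])
           (use H1 x58' S8 in \<open>auto simp: x_def S_def S2_def\<close>)
      then have "real n * (x - 3) / real (n * N) \<le> dyadic_sup \<alpha> B i'"
        unfolding dyadic_sup_def nN by (simp add: divide_right_mono)
      moreover have "real n * (x - 3) / real (n * N) = x / real N - 3 / real N"
        using n2 by (simp add: diff_divide_distrib)
      moreover have "3 / real N \<le> 3 * real q powr (- \<tau>)"
      proof -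
        have "real q powr \<tau> \<le> real q powr (1 + \<tau>)" using q1 by (intro powr_mono) auto
        then have "real q powr \<tau> \<le> real N" using w1 unfolding N(1) by linarith
        then have "1 / real N \<le> 1 / real q powr \<tau>" using q1 by (intro divide_left_mono mult_pos_pos rN) auto
        then show ?thesis using q1 by (simp add: powr_minus field_simps)
      qed
      ultimately show "dyadic_sup \<alpha> B i - 2 * (dyadic_sup \<alpha> B i - dyadic_sup \<alpha> B (Suc i)) - 1 / ln (real q)
          \<le> dyadic_sup \<alpha> B i'"
        using xN errN elim(4) unfolding d_def by (simp add: algebra_simps)
    qed
  qed
qed

section \<open>The Lyapunov exponent\<close>

definition op_norm :: "real^2^2 \<Rightarrow> real" where
  "op_norm M = onorm (\<lambda>v. M *v v)"

lemma op_norm_le_entry_sum: "op_norm M \<le> entry_sum M"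
  using onorm_le_matrix_component_sum[of M] by (simp add: op_norm_def entry_sum_def)

lemma entry_sum_le_op_norm: "entry_sum M \<le> 4 * op_norm M"
  using matrix_component_le_onorm[of M] by (intro entry_sum_le) (simp add: op_norm_def)

lemma op_norm_mult: "op_norm (X ** Y) \<le> op_norm X * op_norm Y"
  using onorm_compose[OF matrix_vector_mul_bounded_linear[of X] matrix_vector_mul_bounded_linear[of Y]]
  by (simp add: op_norm_def o_def matrix_vector_mul_assoc)

lemma op_norm_triangle: "op_norm (X + Y) \<le> op_norm X + op_norm Y"
  using onorm_triangle[OF matrix_vector_mul_bounded_linear[of X] matrix_vector_mul_bounded_linear[of Y]]
  by (simp add: op_norm_def matrix_vector_mult_add_rdistrib)

lemma op_norm_diff: "\<bar>op_norm X - op_norm Y\<bar> \<le> entry_sum (X - Y)"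
  using op_norm_triangle[of "X - Y" Y] op_norm_triangle[of "Y - X" X]
    op_norm_le_entry_sum[of "X - Y"] op_norm_le_entry_sum[of "Y - X"] entry_sum_minus[of "X - Y"]
  by (simp add: abs_le_iff)

text \<open>The columns span a parallelogram of area 1, and neither is longer than the operator
  norm.\<close>

lemma op_norm_ge_1:
  assumes "det X = 1"
  shows "1 \<le> op_norm X"
proof -
  have p: "0 \<le> op_norm X" unfolding op_norm_def by (intro onorm_pos_le) auto
  have "1 = \<bar>wedge (column 1 X) (column 2 X)\<bar>"
    using assms by (simp add: wedge_def column_def det_2 mult.commute)
  also have "\<dots> \<le> norm (column 1 X) * norm (column 2 X)" by (rule wedge_le)
  also have "\<dots> \<le> op_norm X * op_norm X"
    using norm_column_le_onorm[of 1 X] norm_column_le_onorm[of 2 X] p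
    unfolding op_norm_def by (intro mult_mono) auto
  finally have "1\<^sup>2 \<le> (op_norm X)\<^sup>2" by (simp add: power2_eq_square)
  then show ?thesis using p by (rule power2_le_imp_le)
qed

lemma ln_lipschitz_ge_1:
  fixes x y :: real
  assumes "1 \<le> x" "1 \<le> y"
  shows "\<bar>ln x - ln y\<bar> \<le> \<bar>x - y\<bar>"
proof -
  have *: "ln x - ln y \<le> x - y" if "1 \<le> y" "y \<le> x" for x y :: real
  proof -
    have "ln x - ln y = ln (x / y)" using that by (simp add: ln_div)
    also have "\<dots> \<le> x / y - 1" using that by (intro ln_le_minus_one) auto
    also have "\<dots> = (x - y) / y" using that by (simp add: field_simps)
    also have "\<dots> \<le> (x - y) / 1" using that by (intro divide_left_mono) auto
    finally show ?thesis by simp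
  qed
  have **: "ln y \<le> ln x" if "1 \<le> y" "y \<le> x" for x y :: real using that by simp
  show ?thesis using *[of x y] *[of y x] **[of x y] **[of y x] assms by (cases "x \<le> y") auto
qed

lemma continuous_on_op_norm:
  fixes f :: "real \<Rightarrow> real^2^2"
  assumes f: "\<And>i j. continuous_on S (\<lambda>x. f x $ i $ j)"
  shows "continuous_on S (\<lambda>x. op_norm (f x))"
  unfolding continuous_on_def
proof
  fix x assume x: "x \<in> S"
  have "((\<lambda>y. f y $ i $ j) \<longlongrightarrow> f x $ i $ j) (at x within S)" for i j
    using f x by (auto simp: continuous_on_def)
  then have "((\<lambda>y. entry_sum (f y - f x)) \<longlongrightarrow> entry_sum (f x - f x)) (at x within S)"
    unfolding entry_sum_2 vector_minus_component
    by (intro tendsto_add tendsto_norm tendsto_diff tendsto_const)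
  then have "((\<lambda>y. entry_sum (f y - f x)) \<longlongrightarrow> 0) (at x within S)" by (simp add: entry_sum_2)
  then have "((\<lambda>y. op_norm (f y) - op_norm (f x)) \<longlongrightarrow> 0) (at x within S)"
    by (rule Lim_null_comparison[rotated]) (auto intro!: always_eventually op_norm_diff)
  then show "((\<lambda>y. op_norm (f y)) \<longlongrightarrow> op_norm (f x)) (at x within S)"
    by (rule LIM_zero_cancel)
qed

lemma continuous_on_cocycle:
  assumes B: "\<And>i j. continuous_on UNIV (\<lambda>\<theta>. B \<theta> $ i $ j)"
  shows "continuous_on UNIV (\<lambda>\<theta>. cocycle \<alpha> B N \<theta> $ i $ j)"
proof (induction N arbitrary: i j)
  case (Suc N)
  have "continuous_on UNIV (\<lambda>\<theta>. B (\<theta> + of_nat N * \<alpha>) $ i $ j)" for i j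
    by (rule continuous_on_compose2[OF B]) (auto intro!: continuous_intros)
  then show ?case
    unfolding cocycle.simps matrix_mul_2 by (intro continuous_on_add continuous_on_mult Suc)
qed (simp add: continuous_on_const)

lemma integral_periodic_shift:
  fixes f :: "real \<Rightarrow> real"
  assumes cont: "continuous_on UNIV f" and per: "\<And>x. f (x + 1) = f x"
  shows "integral {0..1} (\<lambda>x. f (x + c)) = integral {0..1} f"
proof -
  define d where "d = frac c"
  have d: "0 \<le> d" "d \<le> 1" using frac_lt_1[of c] by (auto simp: d_def intro: less_imp_le)
  have int: "f integrable_on {a..b}" for a b
    by (intro integrable_continuous_interval continuous_on_subset[OF cont]) auto
  have sh: "integral {a..b} (\<lambda>x. f (x + c)) = integral {a + c..b + c} f" for a b c
    using integral_shift_Icc_real[of a b f c] by (simp add: o_def add.commute)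
  have "f (x + c) = f (x + d)" for x
    using periodic_int[of f "x + d" "\<lfloor>c\<rfloor>"] per by (simp add: d_def frac_def)
  then have "integral {0..1} (\<lambda>x. f (x + c)) = integral {0..1} (\<lambda>x. f (x + d))" by simp
  also have "\<dots> = integral {d..1 + d} f"
    unfolding sh by simp
  also have "\<dots> = integral {d..1} f + integral {1..1 + d} f"
    using d int by (intro Henstock_Kurzweil_Integration.integral_combine[symmetric]) auto
  also have "integral {1..1 + d} f = integral {0..d} (\<lambda>x. f (x + 1))"
    unfolding sh by (simp add: add.commute)
  also have "\<dots> = integral {0..d} f" using per by simp
  also have "integral {d..1} f + integral {0..d} f = integral {0..1} f"
    using Henstock_Kurzweil_Integration.integral_combine[OF d int] by simp
  finally show ?thesis .
qed

lemma fekete: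
  fixes a :: "nat \<Rightarrow> real"
  assumes sub: "\<And>m n. a (m + n) \<le> a m + a n" and nn: "\<And>n. 0 \<le> a n"
  obtains l where "(\<lambda>n. a n / real n) \<longlonglongrightarrow> l" "\<And>n. 1 \<le> n \<Longrightarrow> l \<le> a n / real n" "0 \<le> l"
proof -
  define l where "l = (INF n\<in>{1..}. a n / real n)"
  have bdd: "bdd_below ((\<lambda>n. a n / real n) ` {1..})" using nn by (intro bdd_belowI2[of _ 0]) auto
  have le: "l \<le> a n / real n" if "1 \<le> n" for n
    unfolding l_def using that bdd by (intro cINF_lower) auto
  have l0: "0 \<le> l" unfolding l_def using nn by (intro cINF_greatest) auto
  have mult: "a (k * N) \<le> real k * a N" if "1 \<le> k" for k N
    using that
  proof (induction k rule: dec_induct)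
    case (step k)
    then show ?case using sub[of N "k * N"] by (simp add: algebra_simps)
  qed simp
  have "(\<lambda>n. a n / real n) \<longlonglongrightarrow> l"
  proof (rule LIMSEQ_I)
    fix e :: real assume e: "0 < e"
    have "\<exists>N\<in>{1..}. a N / real N < l + e / 2"
      using cINF_less_iff[OF _ bdd, of "l + e / 2"] e by (auto simp: l_def)
    then obtain N where N: "1 \<le> N" "a N / real N < l + e / 2" by auto
    define c where "c = (\<Sum>r\<le>N. a r)"
    have c: "a r \<le> c" if "r \<le> N" for r
      unfolding c_def using that nn by (intro member_le_sum) auto
    have c0: "0 \<le> c" using c[of N] nn[of N] by simp
    obtain M where M: "2 * c / e < real M" using reals_Archimedean2 by blast
    show "\<exists>no. \<forall>n\<ge>no. norm (a n / real n - l) < e"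
    proof (intro exI allI impI)
      fix n assume n: "max (N + 1) (M + 1) \<le> n"
      define k r where "k = n div N" and "r = n mod N"
      have kr: "n = r + k * N" by (simp add: k_def r_def)
      have k1: "1 \<le> k" unfolding k_def using n N by (simp add: Suc_le_eq div_greater_zero_iff)
      have r: "r \<le> N" unfolding r_def using N by (intro less_imp_le mod_less_divisor) auto
      have n0: "0 < real n" using n by simp
      have "a n \<le> a r + a (k * N)" unfolding kr by (rule sub)
      also have "\<dots> \<le> c + real k * a N" by (intro add_mono c r mult k1)
      also have "real k * a N = real (k * N) * (a N / real N)" using N by simp
      also have "\<dots> \<le> real n * (a N / real N)"
        using kr nn[of N] by (intro mult_right_mono) auto
      finally have "a n / real n \<le> (c + real n * (a N / real N)) / real n"
        using n0 by (intro divide_right_mono) auto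
      also have "\<dots> = c / real n + a N / real N" using n0 by (simp add: add_divide_distrib)
      finally have 1: "a n / real n \<le> c / real n + a N / real N" .
      have "2 * c / e < real n" using M n by simp
      then have "c / real n < e / 2" using e n0 by (simp add: field_simps)
      then have "a n / real n < l + e" using 1 N(2) by linarith
      moreover have "l \<le> a n / real n" using n by (intro le) auto
      ultimately show "norm (a n / real n - l) < e" by simp
    qed
  qed
  then show ?thesis using that le l0 by blast
qed

lemma gevrey_continuous:
  assumes "f \<in> gevrey s \<rho>" "0 \<le> \<rho>"
  shows "continuous_on UNIV (\<lambda>\<theta>. f \<theta> $ i $ j)"
  using continuous_on_Re[OF gevrey_continuous_entry[OF assms, of i j]] by simp

lemma gevrey_diff:
  assumes "f \<in> gevrey s \<rho>" "g \<in> gevrey s \<rho>" "0 \<le> \<rho>"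
  shows "(\<lambda>\<theta>. f \<theta> - g \<theta>) \<in> gevrey s \<rho>"
  unfolding gevrey_def
proof (intro CollectI conjI allI)
  show "f (\<theta> + 1) - g (\<theta> + 1) = f \<theta> - g \<theta>" for \<theta> using assms by (simp add: gevrey_def)
  show "(\<lambda>k. norm (mfourier (\<lambda>\<theta>. f \<theta> - g \<theta>) k) * gevrey_weight s \<rho> k) summable_on UNIV"
    using gevrey_dist_summable[OF assms(1,2)] by (simp add: mfourier_diff[OF assms])
  fix \<theta> i j
  let ?e = "\<lambda>k. exp (2 * of_real pi * \<i> * of_int k * of_real \<theta>)"
  have "((\<lambda>k. mfourier h k $ i $ j * ?e k) has_sum of_real (h \<theta> $ i $ j)) UNIV" if "h \<in> gevrey s \<rho>" for h
    using that unfolding gevrey_def by blast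
  then have "((\<lambda>k. mfourier f k $ i $ j * ?e k + - (mfourier g k $ i $ j * ?e k)) has_sum
      (of_real (f \<theta> $ i $ j) + - of_real (g \<theta> $ i $ j))) UNIV"
    using assms(1,2) by (intro has_sum_add) (auto simp: has_sum_uminus)
  then show "((\<lambda>k. mfourier (\<lambda>\<theta>. f \<theta> - g \<theta>) k $ i $ j * ?e k) has_sum of_real ((f \<theta> - g \<theta>) $ i $ j)) UNIV"
    by (simp add: mfourier_diff[OF assms] left_diff_distrib)
qed

lemma gevrey_norm_le:
  assumes f: "f \<in> gevrey s \<rho>" and g: "g \<in> gevrey s \<rho>" and r: "0 \<le> \<rho>"
  shows "gevrey_norm s \<rho> g \<le> gevrey_norm s \<rho> f + gevrey_norm s \<rho> (\<lambda>\<theta>. f \<theta> - g \<theta>)"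
proof (rule has_sum_mono[OF gevrey_infsum[OF g] has_sum_add[OF gevrey_infsum[OF f] gevrey_infsum[OF gevrey_diff[OF f g r]]]])
  fix k
  have "norm (mfourier g k) \<le> norm (mfourier f k) + norm (mfourier (\<lambda>\<theta>. f \<theta> - g \<theta>) k)"
    unfolding mfourier_diff[OF f g r] using norm_triangle_ineq4[of "mfourier f k" "mfourier f k - mfourier g k"] by simp
  then have "norm (mfourier g k) * gevrey_weight s \<rho> k
      \<le> (norm (mfourier f k) + norm (mfourier (\<lambda>\<theta>. f \<theta> - g \<theta>) k)) * gevrey_weight s \<rho> k"
    by (intro mult_right_mono) (auto simp: gevrey_weight_def)
  then show "norm (mfourier g k) * gevrey_weight s \<rho> k \<le> norm (mfourier f k) * gevrey_weight s \<rho> k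
      + norm (mfourier (\<lambda>\<theta>. f \<theta> - g \<theta>) k) * gevrey_weight s \<rho> k"
    by (simp add: distrib_right)
qed

definition log_norm :: "real \<Rightarrow> (real \<Rightarrow> real^2^2) \<Rightarrow> nat \<Rightarrow> real \<Rightarrow> real" where
  "log_norm \<alpha> B N \<theta> = ln (op_norm (cocycle \<alpha> B N \<theta>))"

context
  fixes s \<rho> \<Gamma> :: real
  assumes r: "0 < \<rho>" and \<Gamma>: "1 \<le> \<Gamma>"
begin

lemma log_norm_nonneg: "B \<in> gevrey_SL2 s \<rho> \<Longrightarrow> 0 \<le> log_norm \<alpha> B N \<theta>"
  using op_norm_ge_1[OF det_cocycle[of B]] by (auto simp: log_norm_def gevrey_SL2_def)

lemma continuous_log_norm:
  assumes "B \<in> gevrey_SL2 s \<rho>"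
  shows "continuous_on A (log_norm \<alpha> B N)"
proof -
  have B: "B \<in> gevrey s \<rho>" "\<And>\<theta>. det (B \<theta>) = 1" using assms by (auto simp: gevrey_SL2_def)
  have "continuous_on UNIV (\<lambda>\<theta>. op_norm (cocycle \<alpha> B N \<theta>))"
    using B(1) r by (intro continuous_on_op_norm continuous_on_cocycle gevrey_continuous[where s=s and \<rho>=\<rho>]) auto
  moreover have "op_norm (cocycle \<alpha> B N \<theta>) \<noteq> 0" for \<theta>
    using op_norm_ge_1[OF det_cocycle[of B \<alpha> N \<theta>]] B(2) by force
  ultimately have "continuous_on UNIV (log_norm \<alpha> B N)"
    unfolding log_norm_def by (intro continuous_on_ln) auto
  then show ?thesis by (rule continuous_on_subset) simp
qed

lemma lyap_N_eq:
  assumes "B \<in> gevrey_SL2 s \<rho>"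
  shows "lyap_N \<alpha> B N = integral {0..1} (log_norm \<alpha> B N) / real N"
    "integral {0..1} (log_norm \<alpha> B N) = integral\<^sup>L lborel (\<lambda>\<theta>. indicator {0..1} \<theta> * log_norm \<alpha> B N \<theta>)"
    "integrable lborel (\<lambda>\<theta>. indicator {0..1} \<theta> * log_norm \<alpha> B N \<theta>)"
proof -
  have si: "set_integrable lborel {0..1} (log_norm \<alpha> B N)"
    by (intro borel_integrable_atLeastAtMost' continuous_log_norm assms)
  then show "integrable lborel (\<lambda>\<theta>. indicator {0..1} \<theta> * log_norm \<alpha> B N \<theta>)"
    by (simp add: set_integrable_def)
  have "(LINT \<theta>:{0..1}|lborel. log_norm \<alpha> B N \<theta>) = integral {0..1} (log_norm \<alpha> B N)"
    by (rule set_borel_integral_eq_integral(2)[OF si])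
  then show "lyap_N \<alpha> B N = integral {0..1} (log_norm \<alpha> B N) / real N"
    "integral {0..1} (log_norm \<alpha> B N) = integral\<^sup>L lborel (\<lambda>\<theta>. indicator {0..1} \<theta> * log_norm \<alpha> B N \<theta>)"
    by (simp_all add: lyap_N_def log_norm_def op_norm_def set_lebesgue_integral_def)
qed

text \<open>\<open>lyapunov\<close> is defined by \<open>lim\<close>, which is informative only once
  convergence is known. It follows from Fekete's argument: invariance of the integral under the
  rotation makes the integrals of the logarithms subadditive.\<close>

lemma lyapunov_limit:
  assumes B: "B \<in> gevrey_SL2 s \<rho>"
  shows "lyap_N \<alpha> B \<longlonglongrightarrow> lyapunov \<alpha> B" "\<And>N. 1 \<le> N \<Longrightarrow> lyapunov \<alpha> B \<le> lyap_N \<alpha> B N" "0 \<le> lyapunov \<alpha> B"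
proof -
  define a where "a N = integral {0..1} (log_norm \<alpha> B N)" for N
  have det: "\<And>\<theta>. det (B \<theta>) = 1" and per: "\<And>\<theta>. B (\<theta> + 1) = B \<theta>"
    using B by (auto simp: gevrey_SL2_def gevrey_def)
  note cont = continuous_log_norm[OF B]
  have int: "log_norm \<alpha> B N integrable_on {0..1}" for N
    by (intro integrable_continuous_interval cont)
  have a0: "0 \<le> a N" for N unfolding a_def by (intro integral_nonneg int log_norm_nonneg B)
  have "a (m + n) \<le> a m + a n" for m n
  proof -
    have ci: "(\<lambda>\<theta>. log_norm \<alpha> B m (\<theta> + real n * \<alpha>)) integrable_on {0..1}"
      by (intro integrable_continuous_interval continuous_on_compose2[OF cont[of UNIV]]) (auto intro!: continuous_intros)
    have "log_norm \<alpha> B (m + n) \<theta> \<le> log_norm \<alpha> B m (\<theta> + real n * \<alpha>) + log_norm \<alpha> B n \<theta>" for \<theta>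
    proof -
      have 1: "1 \<le> op_norm (cocycle \<alpha> B k \<theta>)" for k \<theta> by (intro op_norm_ge_1 det_cocycle det)
      have "ln (op_norm (cocycle \<alpha> B (m + n) \<theta>))
         \<le> ln (op_norm (cocycle \<alpha> B m (\<theta> + real n * \<alpha>)) * op_norm (cocycle \<alpha> B n \<theta>))"
        using 1[of "m + n" \<theta>] op_norm_mult[of "cocycle \<alpha> B m (\<theta> + real n * \<alpha>)" "cocycle \<alpha> B n \<theta>"]
        by (intro ln_mono) (auto simp: cocycle_add)
      also have "\<dots> = ln (op_norm (cocycle \<alpha> B m (\<theta> + real n * \<alpha>))) + ln (op_norm (cocycle \<alpha> B n \<theta>))"
        using 1[of m "\<theta> + real n * \<alpha>"] 1[of n \<theta>] by (intro ln_mult_pos) auto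
      finally show ?thesis by (simp add: log_norm_def)
    qed
    then have "a (m + n) \<le> integral {0..1} (\<lambda>\<theta>. log_norm \<alpha> B m (\<theta> + real n * \<alpha>) + log_norm \<alpha> B n \<theta>)"
      unfolding a_def by (intro integral_le int integrable_add ci) auto
    also have "\<dots> = integral {0..1} (\<lambda>\<theta>. log_norm \<alpha> B m (\<theta> + real n * \<alpha>)) + a n"
      unfolding a_def by (intro Henstock_Kurzweil_Integration.integral_add ci int)
    also have "integral {0..1} (\<lambda>\<theta>. log_norm \<alpha> B m (\<theta> + real n * \<alpha>)) = a m"
      unfolding a_def
    proof (intro integral_periodic_shift cont)
      show "log_norm \<alpha> B m (x + 1) = log_norm \<alpha> B m x" for x
        using cocycle_periodic[of B \<alpha> m x 1, OF per] by (simp add: log_norm_def)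
    qed
    finally show ?thesis .
  qed
  then obtain l where l: "(\<lambda>n. a n / real n) \<longlonglongrightarrow> l" "\<And>n. 1 \<le> n \<Longrightarrow> l \<le> a n / real n" "0 \<le> l"
    using fekete[of a] a0 by blast
  have e: "lyap_N \<alpha> B = (\<lambda>n. a n / real n)" by (simp add: fun_eq_iff lyap_N_eq(1)[OF B] a_def)
  have "lyapunov \<alpha> B = l" unfolding lyapunov_def e by (rule limI[OF l(1)])
  then show "lyap_N \<alpha> B \<longlonglongrightarrow> lyapunov \<alpha> B" "\<And>N. 1 \<le> N \<Longrightarrow> lyapunov \<alpha> B \<le> lyap_N \<alpha> B N" "0 \<le> lyapunov \<alpha> B"
    using l by (auto simp: e)
qed

lemma lyap_N_le_sup_ln:
  assumes B: "B \<in> gevrey_SL2 s \<rho>" "gevrey_norm s \<rho> B \<le> \<Gamma>"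
  shows "lyap_N \<alpha> B N \<le> sup_ln \<alpha> B N / real N"
proof -
  note Bb = gevrey_SL2_bounds[OF B r \<Gamma>]
  have "log_norm \<alpha> B N \<theta> \<le> sup_ln \<alpha> B N" for \<theta>
  proof -
    have "log_norm \<alpha> B N \<theta> \<le> ln (entry_sum (cocycle \<alpha> B N \<theta>))"
      unfolding log_norm_def using op_norm_ge_1[OF det_cocycle[of B \<alpha> N \<theta>]] Bb(1)
      by (intro ln_mono op_norm_le_entry_sum) fastforce+
    then show ?thesis using sup_ln_upper[of B "4 * \<Gamma>" \<alpha> N \<theta>, OF Bb(1,2,3)] by simp
  qed
  then have "integral {0..1} (log_norm \<alpha> B N) \<le> integral {0..1::real} (\<lambda>_. sup_ln \<alpha> B N)"
    by (intro integral_le integrable_continuous_interval continuous_log_norm B continuous_intros) auto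
  then show ?thesis unfolding lyap_N_eq(1)[OF B(1)] by (simp add: divide_right_mono)
qed

lemma cocycle_close:
  assumes A: "A \<in> gevrey_SL2 s \<rho>" "gevrey_norm s \<rho> A \<le> \<Gamma>" and B: "B \<in> gevrey_SL2 s \<rho>" "gevrey_norm s \<rho> B \<le> \<Gamma>"
  shows "entry_sum (cocycle \<alpha> A N \<theta> - cocycle \<alpha> B N \<theta>)
     \<le> 2 * real N * (4 * \<Gamma>) ^ N * (4 * gevrey_norm s \<rho> (\<lambda>\<theta>. A \<theta> - B \<theta>))"
  unfolding cocycle_eq_matrix_prod
proof (rule entry_sum_matrix_prod_diff)
  have "(\<lambda>\<theta>. A \<theta> - B \<theta>) \<in> gevrey s \<rho>" using A B r by (intro gevrey_diff) (auto simp: gevrey_SL2_def)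
  then show "entry_sum (A (\<theta> + real n * \<alpha>) - B (\<theta> + real n * \<alpha>)) \<le> 4 * gevrey_norm s \<rho> (\<lambda>\<theta>. A \<theta> - B \<theta>)" for n
    using gevrey_entry_sum_le[OF _ _ order.refl, of "\<lambda>\<theta>. A \<theta> - B \<theta>" s \<rho> "\<theta> + real n * \<alpha>"] r by simp
qed (use gevrey_SL2_bounds[OF A r \<Gamma>] gevrey_SL2_bounds[OF B r \<Gamma>] in auto)

text \<open>The inequalities point in opposite directions for their two uses: the first bounds the
  exponent of B from above, the second starts the multiscale induction for B from the scales of
  A.\<close>

lemma lyap_N_close:
  assumes A: "A \<in> gevrey_SL2 s \<rho>" "gevrey_norm s \<rho> A \<le> \<Gamma>" and B: "B \<in> gevrey_SL2 s \<rho>" "gevrey_norm s \<rho> B \<le> \<Gamma>"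
    and N: "1 \<le> N" and d: "gevrey_norm s \<rho> (\<lambda>\<theta>. A \<theta> - B \<theta>) \<le> \<delta>"
  shows "lyap_N \<alpha> B N \<le> lyap_N \<alpha> A N + 8 * (4 * \<Gamma>) ^ N * \<delta>"
    "sup_ln \<alpha> A N / real N \<le> sup_ln \<alpha> B N / real N + 8 * (4 * \<Gamma>) ^ N * \<delta>"
proof -
  define c where "c = real N * (8 * (4 * \<Gamma>) ^ N * \<delta>)"
  have "2 * real N * (4 * \<Gamma>) ^ N * (4 * gevrey_norm s \<rho> (\<lambda>\<theta>. A \<theta> - B \<theta>)) \<le> 2 * real N * (4 * \<Gamma>) ^ N * (4 * \<delta>)"
    using d \<Gamma> by (intro mult_left_mono) auto
  also have "\<dots> = c" by (simp add: c_def)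
  finally have close: "entry_sum (cocycle \<alpha> A N \<theta> - cocycle \<alpha> B N \<theta>) \<le> c" for \<theta>
    using cocycle_close[OF A B, of \<alpha> N \<theta>] by simp
  have det: "\<And>\<theta>. det (A \<theta>) = 1" "\<And>\<theta>. det (B \<theta>) = 1" using A B by (auto simp: gevrey_SL2_def)
  have "log_norm \<alpha> B N \<theta> \<le> log_norm \<alpha> A N \<theta> + c" for \<theta>
  proof -
    have "\<bar>ln (op_norm (cocycle \<alpha> A N \<theta>)) - ln (op_norm (cocycle \<alpha> B N \<theta>))\<bar>
        \<le> \<bar>op_norm (cocycle \<alpha> A N \<theta>) - op_norm (cocycle \<alpha> B N \<theta>)\<bar>"
      by (intro ln_lipschitz_ge_1 op_norm_ge_1 det_cocycle det)
    then show ?thesis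
      using op_norm_diff[of "cocycle \<alpha> A N \<theta>" "cocycle \<alpha> B N \<theta>"] close[of \<theta>]
      unfolding log_norm_def by linarith
  qed
  then have "integral {0..1} (log_norm \<alpha> B N) \<le> integral {0..1} (\<lambda>\<theta>. log_norm \<alpha> A N \<theta> + c)"
    by (intro integral_le integrable_continuous_interval continuous_intros continuous_log_norm A B) auto
  also have "\<dots> = integral {0..1} (log_norm \<alpha> A N) + c"
    by (subst Henstock_Kurzweil_Integration.integral_add)
       (auto intro!: integrable_continuous_interval continuous_log_norm A)
  finally show "lyap_N \<alpha> B N \<le> lyap_N \<alpha> A N + 8 * (4 * \<Gamma>) ^ N * \<delta>"
    unfolding lyap_N_eq(1)[OF A(1)] lyap_N_eq(1)[OF B(1)] using N by (simp add: c_def field_simps)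
  have "sup_ln \<alpha> A N \<le> sup_ln \<alpha> B N + c"
  proof (rule sup_ln_least[of A "4 * \<Gamma>", OF gevrey_SL2_bounds(1,2,3)[OF A r \<Gamma>]])
    fix \<theta>
    have "\<bar>entry_sum X - entry_sum Y\<bar> \<le> entry_sum (X - Y)" for X Y :: "real^2^2"
      using entry_sum_triangle[of "X - Y" Y] entry_sum_triangle[of "Y - X" X] entry_sum_minus[of "X - Y"] by simp
    then have "\<bar>entry_sum (cocycle \<alpha> A N \<theta>) - entry_sum (cocycle \<alpha> B N \<theta>)\<bar> \<le> c"
      using close[of \<theta>] order.trans by blast
    moreover have "\<bar>ln (entry_sum (cocycle \<alpha> A N \<theta>)) - ln (entry_sum (cocycle \<alpha> B N \<theta>))\<bar>
        \<le> \<bar>entry_sum (cocycle \<alpha> A N \<theta>) - entry_sum (cocycle \<alpha> B N \<theta>)\<bar>"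
      by (intro ln_lipschitz_ge_1 entry_sum_cocycle_ge_1 det)
    ultimately have "ln (entry_sum (cocycle \<alpha> A N \<theta>)) \<le> ln (entry_sum (cocycle \<alpha> B N \<theta>)) + c"
      by linarith
    then show "ln (entry_sum (cocycle \<alpha> A N \<theta>)) \<le> sup_ln \<alpha> B N + c"
      using sup_ln_upper[of B "4 * \<Gamma>" \<alpha> N \<theta>, OF gevrey_SL2_bounds(1,2,3)[OF B r \<Gamma>]] by simp
  qed
  then have "sup_ln \<alpha> A N / real N \<le> (sup_ln \<alpha> B N + c) / real N" by (intro divide_right_mono) auto
  then show "sup_ln \<alpha> A N / real N \<le> sup_ln \<alpha> B N / real N + 8 * (4 * \<Gamma>) ^ N * \<delta>"
    using N by (simp add: c_def add_divide_distrib)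
qed

end

section \<open>Continuity\<close>

lemma eventually_real_sequentially:
  "\<forall>\<^sub>F x in at_top. P x \<Longrightarrow> \<forall>\<^sub>F q::nat in sequentially. P (real q)"
  using filterlim_real_sequentially by (simp add: filterlim_iff)

text \<open>The minorant is K times the difference of the two indicators. It is at most 0 on U,
  where the logarithm is only known to be nonnegative, and this covers the part of U outside the
  unit interval too.\<close>

lemma log_norm_integral_ge:
  assumes r: "0 < \<rho>" and B: "B \<in> gevrey_SL2 s \<rho>" and U: "U \<in> sets borel" "emeasure lborel U \<le> ennreal p" "0 \<le> p"
    and K: "0 \<le> K" "\<And>\<theta>. \<theta> \<in> {0..1} \<Longrightarrow> \<theta> \<notin> U \<Longrightarrow> K \<le> log_norm \<alpha> B N \<theta>"
  shows "K * (1 - p) \<le> integral {0..1} (log_norm \<alpha> B N)"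
proof -
  have fin: "emeasure lborel U < \<infinity>" using U(2) by (simp add: le_less_trans)
  have mU: "measure lborel U \<le> p" using U(2,3) by (simp add: measure_def enn2real_leI)
  have "K * (1 - p) \<le> K * (1 - measure lborel U)" using K mU by (intro mult_left_mono) auto
  also have "\<dots> = integral\<^sup>L lborel (\<lambda>\<theta>. K * (indicator {0..1} \<theta> - indicator U \<theta>))"
    using fin U(1) by (simp add: Bochner_Integration.integral_diff)
  also have "\<dots> \<le> integral\<^sup>L lborel (\<lambda>\<theta>. indicator {0..1} \<theta> * log_norm \<alpha> B N \<theta>)"
  proof (rule integral_mono)
    show "integrable lborel (\<lambda>\<theta>. K * (indicator {0..1} \<theta> - indicator U \<theta>))"
      using fin U(1) by (intro integrable_mult_right Bochner_Integration.integrable_diff) auto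
    show "integrable lborel (\<lambda>\<theta>. indicator {0..1} \<theta> * log_norm \<alpha> B N \<theta>)"
      by (rule lyap_N_eq(3)[OF r order.refl B])
    show "K * (indicator {0..1} \<theta> - indicator U \<theta>) \<le> indicator {0..1} \<theta> * log_norm \<alpha> B N \<theta>" for \<theta>
      using K log_norm_nonneg[OF r order.refl B, of \<alpha> N \<theta>] by (auto simp: indicator_def)
  qed
  also have "\<dots> = integral {0..1} (log_norm \<alpha> B N)" by (rule lyap_N_eq(2)[OF r order.refl B, symmetric])
  finally show ?thesis .
qed

text \<open>The way back from maxima to means. Within a window the logarithm of the norm is close to
  its maximum off a set of tiny measure, so averaging over the circle loses at most
  \<epsilon>.\<close>

lemma lyap_window:
  assumes r: "0 < \<rho>" and s: "1 < s" "s < 2" and \<Gamma>: "1 \<le> \<Gamma>" and t: "0 < \<tau>" "0 < \<sigma>"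
    and e: "(1 + 2 * \<tau>) * (s - 1) + \<sigma> - 1 \<le> - \<tau>" and \<epsilon>: "0 < \<epsilon>"
  shows "\<forall>\<^sub>F q::nat in sequentially. \<forall>\<alpha> B i. good_denom \<alpha> q \<longrightarrow> B \<in> gevrey_SL2 s \<rho> \<longrightarrow> gevrey_norm s \<rho> B \<le> \<Gamma> \<longrightarrow>
     real q powr (1 + \<tau>) \<le> 2 ^ i \<longrightarrow> 2 ^ Suc i \<le> real q powr (1 + 2 * \<tau>) \<longrightarrow>
     dyadic_sup \<alpha> B i - \<epsilon> \<le> lyap_N \<alpha> B (2 ^ i)"
proof -
  obtain C where C: "1 \<le> C" and ldt:
    "\<And>\<alpha> B N q H. B \<in> gevrey_SL2 s \<rho> \<Longrightarrow> gevrey_norm s \<rho> B \<le> \<Gamma> \<Longrightarrow> 1 \<le> N \<Longrightarrow> good_denom \<alpha> q \<Longrightarrow> 2 \<le> q \<Longrightarrow>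
      C * real N powr (s - 1) \<le> real q \<Longrightarrow> 1 \<le> H \<Longrightarrow>
      \<exists>F. finite F \<and> real (card F) \<le> C * real N powr s \<and>
        (\<forall>\<theta> \<theta>'. (\<forall>a\<in>F. \<forall>k. exp (- H) \<le> \<bar>\<theta> - a - of_int k\<bar>) \<longrightarrow>
          ln (entry_sum (cocycle \<alpha> B N \<theta>')) - C * (real N powr s * H / real q + real q)
            \<le> ln (entry_sum (cocycle \<alpha> B N \<theta>)))"
    using gevrey_large_deviation[OF r s(1) \<Gamma>] by blast
  have C0: "0 < C" using C by simp
  define u where "u = (1 + 2 * \<tau>) * (s - 1)"
  have u: "0 < u" "u < 1" using e t s unfolding u_def by (simp_all add: mult_pos_pos)
  define v where "v = (1 + 2 * \<tau>) * s"
  have v: "0 < v" using t s by (simp add: v_def)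
  define M where "M = ln 2 + ln (4 * \<Gamma>)"
  have M: "0 < M" using \<Gamma> by (simp add: M_def add_pos_nonneg)
  have "\<forall>\<^sub>F x in at_top. C * x powr u \<le> x" using C0 u by real_asymp
  note e1 = eventually_real_sequentially[OF this]
  have "\<forall>\<^sub>F x in at_top. 3 * C * x powr (- \<tau>) \<le> \<epsilon> / 3" using C0 t \<epsilon> by real_asymp
  moreover have "\<forall>\<^sub>F x in at_top. 4 / x \<le> \<epsilon> / 3" using \<epsilon> by real_asymp
  moreover have "\<forall>\<^sub>F x in at_top. M * (6 * exp (- (x powr \<sigma>)) * (C * x powr v)) \<le> \<epsilon> / 3"
    using C0 v t \<epsilon> M by real_asymp
  ultimately have "\<forall>\<^sub>F x in at_top. 3 * C * x powr (- \<tau>) + 4 / x + M * (6 * exp (- (x powr \<sigma>)) * (C * x powr v)) \<le> \<epsilon>"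
    by eventually_elim linarith
  note e2 = eventually_real_sequentially[OF this]
  have "\<forall>\<^sub>F x in at_top. 2 \<le> (x::real)" by (rule eventually_ge_at_top)
  note e3 = eventually_real_sequentially[OF this]
  have "\<forall>\<^sub>F x in at_top. 1 \<le> x powr \<sigma>" using t by real_asymp
  note e4 = eventually_real_sequentially[OF this]
  show ?thesis
    using e1 e2 e3 e4
  proof eventually_elim
    case (elim q)
    show ?case
    proof (intro allI impI)
      fix \<alpha> B i
      assume q: "good_denom \<alpha> q" and B: "B \<in> gevrey_SL2 s \<rho>" "gevrey_norm s \<rho> B \<le> \<Gamma>"
        and w1: "real q powr (1 + \<tau>) \<le> 2 ^ i" and w2: "2 ^ Suc i \<le> real q powr (1 + 2 * \<tau>)"
      note Bb = gevrey_SL2_bounds[OF B r \<Gamma>]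
      define N where "N = (2::nat) ^ i"
      define H where "H = real q powr \<sigma>"
      have q2: "2 \<le> q" using elim(3) by simp
      have q1: "1 \<le> real q" using q2 by simp
      have N: "real N = 2 ^ i" "1 \<le> N" by (simp_all add: N_def)
      have rN: "0 < real N" using N(2) by simp
      define err where "err = C * (real N powr s * H / real q + real q)"
      note we = window_error[of "real q" s \<tau> "real N" 1 \<sigma>, OF _ s _ _ _ _ e, unfolded N(1)]
      have we1: "(real N powr s * H / real q + real q) / real N \<le> 3 * real q powr (- \<tau>)"
        and we2: "real N powr (s - 1) \<le> real q powr u"
        and we3: "real N powr s \<le> real q powr v"
        using we[OF q1 w1] w2 by (simp_all add: H_def N u_def v_def)
      have Cq: "C * real N powr (s - 1) \<le> real q"
        using mult_left_mono[OF we2, of C] C0 elim(1) by linarith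
      have H1: "1 \<le> H" using elim(4) by (simp add: H_def)
      obtain F where F: "finite F" "real (card F) \<le> C * real N powr s"
        "\<And>\<theta> \<theta>'. (\<forall>a\<in>F. \<forall>k. exp (- H) \<le> \<bar>\<theta> - a - of_int k\<bar>) \<Longrightarrow>
          ln (entry_sum (cocycle \<alpha> B N \<theta>')) - err \<le> ln (entry_sum (cocycle \<alpha> B N \<theta>))"
        using ldt[OF B N(2) q q2 Cq H1] unfolding err_def by metis
      have errN: "err / real N \<le> 3 * C * real q powr (- \<tau>)"
        using mult_left_mono[OF we1, of C] C0 by (simp add: err_def)
      define p where "p = 6 * exp (- H) * real (card F)"
      have p0: "0 \<le> p" by (simp add: p_def)
      have p: "p \<le> 6 * exp (- (real q powr \<sigma>)) * (C * real q powr v)"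
        unfolding p_def H_def using order.trans[OF F(2) mult_left_mono[OF we3 less_imp_le[OF C0]]]
        by (intro mult_left_mono) auto
      obtain U where U: "U \<in> sets borel" "emeasure lborel U \<le> ennreal p"
        "\<And>\<theta> a k. \<theta> \<in> {0..1} \<Longrightarrow> \<theta> \<notin> U \<Longrightarrow> a \<in> F \<Longrightarrow> exp (- H) \<le> \<bar>\<theta> - a - of_int k\<bar>"
        using near_integer_translates_small[OF F(1), of "exp (- H)"] H1 unfolding p_def by auto
      define S where "S = sup_ln \<alpha> B N"
      \<comment> \<open>The ln 4 pays for passing from the entry sum to the operator norm.\<close>
      define K where "K = S - err - ln 4"
      have S0: "0 \<le> S" unfolding S_def by (rule sup_ln_nonneg[of B "4 * \<Gamma>", OF Bb(1,2,3)])
      have err0: "0 \<le> err" using C0 H1 by (simp add: err_def)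
      have SN: "S / real N \<le> M"
      proof -
        have "S \<le> ln 2 + real N * ln (4 * \<Gamma>)" unfolding S_def
          by (intro sup_ln_least[of B "4 * \<Gamma>", OF Bb(1,2,3)] ln_entry_sum_cocycle_le[of B "4 * \<Gamma>", OF Bb(1,2,3)])
        also have "\<dots> \<le> real N * M"
          using N(2) mult_right_mono[of 1 "real N" "ln 2"] by (simp add: M_def algebra_simps)
        finally show ?thesis using rN by (simp add: field_simps)
      qed
      have Klow: "K \<le> log_norm \<alpha> B N \<theta>" if "\<theta> \<in> {0..1}" "\<theta> \<notin> U" for \<theta>
      proof -
        have "ln (entry_sum (cocycle \<alpha> B N \<theta>')) \<le> ln (entry_sum (cocycle \<alpha> B N \<theta>)) + err" for \<theta>'
          using F(3)[of \<theta> \<theta>'] U(3)[OF that] by (simp add: algebra_simps)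
        then have "S \<le> ln (entry_sum (cocycle \<alpha> B N \<theta>)) + err"
          unfolding S_def by (intro sup_ln_least[of B "4 * \<Gamma>", OF Bb(1,2,3)])
        moreover have "ln (entry_sum (cocycle \<alpha> B N \<theta>)) \<le> ln (4 * op_norm (cocycle \<alpha> B N \<theta>))"
          using entry_sum_cocycle_ge_1[of B \<alpha> N \<theta>, OF Bb(1)]
          by (intro ln_mono entry_sum_le_op_norm) linarith
        moreover have "ln (4 * op_norm (cocycle \<alpha> B N \<theta>)) = ln 4 + log_norm \<alpha> B N \<theta>"
          unfolding log_norm_def using op_norm_ge_1[OF det_cocycle[of B \<alpha> N \<theta>, OF Bb(1)]]
          by (intro ln_mult_pos) linarith+
        ultimately show ?thesis by (simp add: K_def)
      qed
      \<comment> \<open>A negative K makes the bound trivial because the integral is nonnegative;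
        otherwise K \<le> S turns the loss K p on the exceptional set into S p.\<close>
      have int: "integral {0..1} (log_norm \<alpha> B N) \<ge> K - S * p"
      proof (cases "0 \<le> K")
        case True
        have "0 \<le> ln (4::real)" by simp
        then have "K \<le> S" using err0 unfolding K_def by linarith
        then have "K * p \<le> S * p" using p0 by (intro mult_right_mono) auto
        moreover have "K * (1 - p) \<le> integral {0..1} (log_norm \<alpha> B N)"
          by (rule log_norm_integral_ge[OF r B(1) U(1,2) p0 True Klow])
        ultimately show ?thesis by (simp add: algebra_simps)
      next
        case False
        have "0 \<le> integral {0..1} (log_norm \<alpha> B N)"
          using log_norm_integral_ge[OF r B(1), of "{}" 0 0 \<alpha> N] log_norm_nonneg[OF r \<Gamma> B(1)] by simp
        moreover have "0 \<le> S * p" using S0 p0 by simp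
        ultimately show ?thesis using False by linarith
      qed
      have "(K - S * p) / real N \<le> lyap_N \<alpha> B N"
        unfolding lyap_N_eq(1)[OF r \<Gamma> B(1)] using int by (intro divide_right_mono) auto
      moreover have "(K - S * p) / real N = S / real N - err / real N - ln 4 / real N - S / real N * p"
        by (simp add: K_def diff_divide_distrib)
      moreover have "S / real N * p \<le> M * (6 * exp (- (real q powr \<sigma>)) * (C * real q powr v))"
        using SN p p0 M by (intro mult_mono) auto
      moreover have "ln 4 / real N \<le> 4 / real q"
      proof -
        have "real q \<le> real q powr (1 + \<tau>)" using q1 t powr_mono[of 1 "1 + \<tau>" "real q"] by simp
        then have "real q \<le> real N" using w1 unfolding N(1) by linarith
        moreover have "ln 4 \<le> (4::real)" using ln_le_minus_one[of "4::real"] by simp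
        ultimately show ?thesis using q1 by (intro frac_le) auto
      qed
      moreover have "dyadic_sup \<alpha> B i = S / real N" by (simp add: dyadic_sup_def S_def N_def)
      ultimately show "dyadic_sup \<alpha> B i - \<epsilon> \<le> lyap_N \<alpha> B (2 ^ i)"
        using errN elim(2) unfolding N_def[symmetric] by linarith
    qed
  qed
qed

lemma lyapunov_lower_bound:
  assumes r: "0 < \<rho>" and s: "1 < s" "s < 2" and \<eta>: "0 < \<eta>" "\<eta> < 2 - s" and \<alpha>: "\<alpha> \<in> Omega \<eta>"
    and A: "A \<in> gevrey_SL2 s \<rho>" and \<epsilon>: "0 < \<epsilon>" "\<epsilon> \<le> lyapunov \<alpha> A"
  shows "\<exists>\<delta>>0. \<forall>B\<in>gevrey_SL2 s \<rho>. gevrey_norm s \<rho> (\<lambda>\<theta>. A \<theta> - B \<theta>) < \<delta> \<longrightarrow>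
     lyapunov \<alpha> A - 3 / 4 * \<epsilon> \<le> lyapunov \<alpha> B"
proof -
  define \<Gamma> where "\<Gamma> = gevrey_norm s \<rho> A + 1"
  have \<Gamma>: "1 \<le> \<Gamma>" "gevrey_norm s \<rho> A \<le> \<Gamma>" using gevrey_norm_nonneg[of s \<rho> A] by (auto simp: \<Gamma>_def)
  define \<gamma> where "\<gamma> = 2 - s - \<eta>"
  \<comment> \<open>\<gamma> is the slack in \<eta> < 2 - s, and \<sigma> is the midpoint between
    \<eta> and 2 - s. As s - 1 \<le> 1, the error exponent is at most -\<gamma>/2 + 2 \<tau>, which
    equals -\<tau> for \<tau> = \<gamma>/6. With \<delta> = \<gamma>/4 and \<eta> < 1, the gap
    exponent (1 + \<delta>) \<eta> stays below \<sigma>.\<close>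
  define \<tau> \<sigma> \<delta> where "\<tau> = \<gamma> / 6" and "\<sigma> = \<eta> + \<gamma> / 2" and "\<delta> = \<gamma> / 4"
  have \<gamma>: "0 < \<gamma>" using \<eta> by (simp add: \<gamma>_def)
  have t: "0 < \<tau>" "0 < \<sigma>" "0 < \<delta>" using \<gamma> \<eta> by (simp_all add: \<tau>_def \<sigma>_def \<delta>_def)
  have e: "(1 + 2 * \<tau>) * (s - 1) + \<sigma> - 1 \<le> - \<tau>"
  proof -
    have "2 * \<tau> * (s - 1) \<le> 2 * \<tau> * 1" using t s by (intro mult_left_mono) auto
    moreover have "(1 + 2 * \<tau>) * (s - 1) = (s - 1) + 2 * \<tau> * (s - 1)" by (simp add: algebra_simps)
    ultimately show ?thesis using \<tau>_def \<sigma>_def \<gamma>_def by linarith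
  qed
  have ds: "(1 + \<delta>) * \<eta> < \<sigma>"
  proof -
    have "\<gamma> * \<eta> < \<gamma> * 1" using \<gamma> \<eta> s by (intro mult_strict_left_mono) auto
    then show ?thesis using \<gamma> by (simp add: \<delta>_def \<sigma>_def algebra_simps)
  qed
  \<comment> \<open>Three quarters of \<epsilon> are spent: one on comparing B with A at the initial
    scales, one on the losses along the chain, and one on passing from the maximum to the mean. As
    \<epsilon> is at most the exponent of A, \<mu> stays positive.\<close>
  define L where "L = lyapunov \<alpha> A - \<epsilon> / 4"
  define \<mu> where "\<mu> = lyapunov \<alpha> A - \<epsilon> / 2"
  have \<mu>: "0 < \<mu>" using \<epsilon> by (simp add: \<mu>_def)
  define M where "M = ln 2 + ln (4 * \<Gamma>)"
  have M: "0 < M" using \<Gamma> by (simp add: M_def add_pos_nonneg)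
  have irr: "\<alpha> \<notin> \<rat>" using \<alpha> by (simp add: Omega_def)
  obtain C where C: "0 < C" and gapC: "\<And>q \<delta>. q \<in> cf_denoms \<alpha> \<Longrightarrow> 2 \<le> q \<Longrightarrow> 0 < \<delta> \<Longrightarrow>
    \<exists>q'\<in>cf_denoms \<alpha>. real q powr (1 + \<delta>) \<le> real q' \<and> ln (real q') \<le> C * real q powr ((1 + \<delta>) * \<eta>)"
    using Omega_gap[OF \<alpha> \<eta>(1)] by blast
  have good: "good_denom \<alpha> q" if "q \<in> cf_denoms \<alpha>" for q
    using that good_denom_cf[OF irr] by (auto simp: cf_denoms_def)
  define a where "a = (1 + \<delta>) * \<eta>"
  have a: "0 < a" "a < \<sigma>" using t \<eta> ds by (simp_all add: a_def)
  have "\<forall>\<^sub>F x in at_top. (1 + 2 * \<tau>) * (C * x powr a) \<le> x powr \<sigma> / 2"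
    using C t a by real_asymp
  note e1 = eventually_real_sequentially[OF this]
  have "\<forall>\<^sub>F x in at_top. 4 \<le> \<tau> * ln x \<and> 2 * M / (\<tau> * ln x) \<le> \<mu> / 8 \<and>
      (4 * M / \<tau> + 1) / ln x * ((1 + \<delta>) / \<delta>) \<le> \<epsilon> / 4"
  proof (intro eventually_conj)
    show "\<forall>\<^sub>F x in at_top. 4 \<le> \<tau> * ln x" using t by real_asymp
    show "\<forall>\<^sub>F x in at_top. 2 * M / (\<tau> * ln x) \<le> \<mu> / 8" using t M \<mu> by real_asymp
    have "0 < (4 * M / \<tau> + 1) * ((1 + \<delta>) / \<delta>)"
      using M t by (intro mult_pos_pos add_pos_pos divide_pos_pos) auto
    then have "\<forall>\<^sub>F x in at_top. (4 * M / \<tau> + 1) * ((1 + \<delta>) / \<delta>) / ln x \<le> \<epsilon> / 4"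
      using \<epsilon> by real_asymp
    then show "\<forall>\<^sub>F x in at_top. (4 * M / \<tau> + 1) / ln x * ((1 + \<delta>) / \<delta>) \<le> \<epsilon> / 4"
      by eventually_elim (simp add: mult.commute)
  qed
  note e2 = eventually_real_sequentially[OF this]
  have \<epsilon>4: "0 < \<epsilon> / 4" using \<epsilon> by simp
  have "\<forall>\<^sub>F x in at_top. 2 \<le> (x::real)" by (rule eventually_ge_at_top)
  note e3 = eventually_real_sequentially[OF this]
  define step where "step q \<longleftrightarrow> (\<forall>\<alpha> B i i'. good_denom \<alpha> q \<longrightarrow> B \<in> gevrey_SL2 s \<rho> \<longrightarrow> gevrey_norm s \<rho> B \<le> \<Gamma> \<longrightarrow>
     real q powr (1 + \<tau>) \<le> 2 ^ i \<longrightarrow> 2 ^ Suc i \<le> real q powr (1 + 2 * \<tau>) \<longrightarrow> i < i' \<longrightarrow> 2 ^ i' \<le> exp (real q powr \<sigma> / 2) \<longrightarrow>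
     \<mu> \<le> dyadic_sup \<alpha> B i \<longrightarrow> dyadic_sup \<alpha> B i - dyadic_sup \<alpha> B (Suc i) \<le> \<mu> / 8 \<longrightarrow>
     dyadic_sup \<alpha> B i - 2 * (dyadic_sup \<alpha> B i - dyadic_sup \<alpha> B (Suc i)) - 1 / ln (real q) \<le> dyadic_sup \<alpha> B i')" for q
  have e4: "\<forall>\<^sub>F q in sequentially. step q"
    unfolding step_def by (rule multiscale_step[OF r s \<Gamma>(1) t(1,2) e \<mu>])
  define window where "window q \<longleftrightarrow> (\<forall>\<alpha> B i. good_denom \<alpha> q \<longrightarrow> B \<in> gevrey_SL2 s \<rho> \<longrightarrow> gevrey_norm s \<rho> B \<le> \<Gamma> \<longrightarrow>
     real q powr (1 + \<tau>) \<le> 2 ^ i \<longrightarrow> 2 ^ Suc i \<le> real q powr (1 + 2 * \<tau>) \<longrightarrow>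
     dyadic_sup \<alpha> B i - \<epsilon> / 4 \<le> lyap_N \<alpha> B (2 ^ i))" for q
  have e5: "\<forall>\<^sub>F q in sequentially. window q"
    unfolding window_def by (rule lyap_window[OF r s \<Gamma>(1) t(1,2) e \<epsilon>4])
  from eventually_conj[OF e1 eventually_conj[OF e2 eventually_conj[OF e3 eventually_conj[OF e4 e5]]]]
  obtain n0 where n0:
    "\<And>q. n0 \<le> q \<Longrightarrow> (1 + 2 * \<tau>) * (C * real q powr a) \<le> real q powr \<sigma> / 2"
    "\<And>q. n0 \<le> q \<Longrightarrow> 4 \<le> \<tau> * ln (real q) \<and> 2 * M / (\<tau> * ln (real q)) \<le> \<mu> / 8 \<and>
      (4 * M / \<tau> + 1) / ln (real q) * ((1 + \<delta>) / \<delta>) \<le> \<epsilon> / 4"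
    "\<And>q. n0 \<le> q \<Longrightarrow> 2 \<le> real q" "\<And>q. n0 \<le> q \<Longrightarrow> step q" "\<And>q. n0 \<le> q \<Longrightarrow> window q"
    unfolding eventually_sequentially by blast
  note n0_step = n0(4)[unfolded step_def, rule_format] and n0_window = n0(5)[unfolded window_def, rule_format]
  obtain q0 where q0: "q0 \<in> cf_denoms \<alpha>" "n0 \<le> q0"
    using cf_denoms_unbounded[OF irr, of "real n0"] by auto
  define X where "X = real q0 powr (1 + 2 * \<tau>)"
  \<comment> \<open>With q0 fixed, the initial scales are bounded by X, so one \<beta> keeps the
    perturbation at all of them below \<epsilon>/4. The minimum with 1 keeps the norm of B below
    \<Gamma>.\<close>
  define \<beta> where "\<beta> = min 1 (\<epsilon> / (32 * (4 * \<Gamma>) powr X))"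
  have \<beta>: "0 < \<beta>" "\<beta> \<le> 1" using \<epsilon> \<Gamma> by (auto simp: \<beta>_def)
  show ?thesis
  proof (intro exI[of _ \<beta>] conjI ballI impI \<beta>(1))
    fix B assume B: "B \<in> gevrey_SL2 s \<rho>" and d: "gevrey_norm s \<rho> (\<lambda>\<theta>. A \<theta> - B \<theta>) < \<beta>"
    have B\<Gamma>: "gevrey_norm s \<rho> B \<le> \<Gamma>"
      using gevrey_norm_le[of A s \<rho> B] A B r d \<beta>(2) by (simp add: gevrey_SL2_def \<Gamma>_def)
    note Bb = gevrey_SL2_bounds[OF B B\<Gamma> r \<Gamma>(1)]
    have f: "\<mu> \<le> dyadic_sup \<alpha> B i" for i
    proof (rule multiscale_chain[where f="dyadic_sup \<alpha> B" and Q="cf_denoms \<alpha>" and M=M and \<tau>=\<tau> and \<sigma>=\<sigma> and \<delta>=\<delta> and ?q0.0=q0 and L=L])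
      show "0 \<le> dyadic_sup \<alpha> B i" for i
        using sup_ln_nonneg[of B "4 * \<Gamma>" \<alpha> "2 ^ i", OF Bb(1,2,3)] by (simp add: dyadic_sup_def)
      show "dyadic_sup \<alpha> B i \<le> M" for i
      proof -
        have "sup_ln \<alpha> B (2 ^ i) \<le> ln 2 + real (2 ^ i) * ln (4 * \<Gamma>)"
          by (intro sup_ln_least[of B "4 * \<Gamma>", OF Bb(1,2,3)] ln_entry_sum_cocycle_le[of B "4 * \<Gamma>", OF Bb(1,2,3)])
        also have "\<dots> \<le> 2 ^ i * M"
          using mult_right_mono[of 1 "2 ^ i" "ln 2 :: real"] by (simp add: M_def algebra_simps)
        finally show ?thesis by (simp add: dyadic_sup_def field_simps)
      qed
      show "dyadic_sup \<alpha> B (Suc i) \<le> dyadic_sup \<alpha> B i" for i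
      proof -
        have "sup_ln \<alpha> B (2 ^ Suc i) \<le> 2 * sup_ln \<alpha> B (2 ^ i)"
          using sup_ln_add[of B "4 * \<Gamma>" \<alpha> "2 ^ i" "2 ^ i", OF Bb(1,2,3)] by (simp only: power_Suc mult_2)
        then have "dyadic_sup \<alpha> B (Suc i) \<le> 2 * sup_ln \<alpha> B (2 ^ i) / 2 ^ Suc i"
          unfolding dyadic_sup_def by (rule divide_right_mono) simp
        then show ?thesis by (simp add: dyadic_sup_def)
      qed
      show "2 \<le> q0" using n0(3)[OF q0(2)] by simp
      show "\<exists>q'\<in>cf_denoms \<alpha>. real q powr (1 + \<delta>) \<le> real q' \<and> real q' powr (1 + 2 * \<tau>) \<le> exp (real q powr \<sigma> / 2)"
        if q: "q \<in> cf_denoms \<alpha>" "q0 \<le> q" for q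
      proof -
        have n: "n0 \<le> q" using q q0 by simp
        have q2: "2 \<le> q" using n0(3)[OF n] by simp
        obtain q' where q': "q' \<in> cf_denoms \<alpha>" "real q powr (1 + \<delta>) \<le> real q'" "ln (real q') \<le> C * real q powr a"
          using gapC[OF q(1) q2 t(3)] unfolding a_def by blast
        have "0 < real q powr (1 + \<delta>)" using q2 by simp
        then have q'0: "0 < real q'" using q'(2) by linarith
        have "(1 + 2 * \<tau>) * ln (real q') \<le> (1 + 2 * \<tau>) * (C * real q powr a)"
          using q'(3) t by (intro mult_left_mono) auto
        also have "\<dots> \<le> real q powr \<sigma> / 2" by (rule n0(1)[OF n])
        finally have "real q' powr (1 + 2 * \<tau>) \<le> exp (real q powr \<sigma> / 2)"
          using q'0 by (simp add: powr_def)
        then show ?thesis using q' by blast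
      qed
      show "L \<le> dyadic_sup \<alpha> B i" if i: "2 ^ i \<le> real q0 powr (1 + 2 * \<tau>)" for i
      proof -
        have "lyapunov \<alpha> A \<le> lyap_N \<alpha> A (2 ^ i)" by (rule lyapunov_limit(2)[OF r \<Gamma>(1) A]) simp
        also have "\<dots> \<le> sup_ln \<alpha> A (2 ^ i) / real (2 ^ i)" by (rule lyap_N_le_sup_ln[OF r \<Gamma>(1) A \<Gamma>(2)])
        also have "\<dots> \<le> sup_ln \<alpha> B (2 ^ i) / real (2 ^ i) + 8 * (4 * \<Gamma>) ^ (2 ^ i) * \<beta>"
          using d by (intro lyap_N_close(2)[OF r \<Gamma>(1) A \<Gamma>(2) B B\<Gamma>]) auto
        also have "8 * (4 * \<Gamma>) ^ (2 ^ i) * \<beta> \<le> \<epsilon> / 4"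
        proof -
          have "(4 * \<Gamma>) ^ (2 ^ i) = (4 * \<Gamma>) powr real (2 ^ i)" using \<Gamma> by (subst powr_realpow) auto
          also have "\<dots> \<le> (4 * \<Gamma>) powr X" using i \<Gamma> by (intro powr_mono) (auto simp: X_def)
          finally have "8 * (4 * \<Gamma>) ^ (2 ^ i) * \<beta> \<le> 8 * (4 * \<Gamma>) powr X * (\<epsilon> / (32 * (4 * \<Gamma>) powr X))"
            using \<beta> \<Gamma> by (intro mult_mono) (auto simp: \<beta>_def)
          then show ?thesis using \<Gamma> by simp
        qed
        finally show ?thesis by (simp add: dyadic_sup_def L_def)
      qed
      show "dyadic_sup \<alpha> B i - 2 * (dyadic_sup \<alpha> B i - dyadic_sup \<alpha> B (Suc i)) - 1 / ln (real q) \<le> dyadic_sup \<alpha> B i'"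
        if "q \<in> cf_denoms \<alpha>" "q0 \<le> q" "real q powr (1 + \<tau>) \<le> 2 ^ i" "2 ^ Suc i \<le> real q powr (1 + 2 * \<tau>)"
          "i < i'" "2 ^ i' \<le> exp (real q powr \<sigma> / 2)" "\<mu> \<le> dyadic_sup \<alpha> B i"
          "dyadic_sup \<alpha> B i - dyadic_sup \<alpha> B (Suc i) \<le> \<mu> / 8" for q i i'
        using q0(2) that by (intro n0_step[OF _ good B B\<Gamma>]) auto
    qed (use t q0(1) n0(2)[OF q0(2)] in \<open>auto simp: L_def \<mu>_def\<close>)
    show "lyapunov \<alpha> A - 3 / 4 * \<epsilon> \<le> lyapunov \<alpha> B"
    \<comment> \<open>Maxima and means are compared only inside windows. Since the means converge
      and windows occur at arbitrarily large scales, a single late window gives the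
      contradiction.\<close>
    proof (rule ccontr)
      assume "\<not> ?thesis"
      then have "\<forall>\<^sub>F N in sequentially. lyap_N \<alpha> B N < lyapunov \<alpha> A - 3 / 4 * \<epsilon>"
        by (intro order_tendstoD(2)[OF lyapunov_limit(1)[OF r \<Gamma>(1) B]]) simp
      then obtain N0 where N0: "\<And>N. N0 \<le> N \<Longrightarrow> lyap_N \<alpha> B N < lyapunov \<alpha> A - 3 / 4 * \<epsilon>"
        by (auto simp: eventually_sequentially)
      obtain q where q: "q \<in> cf_denoms \<alpha>" "n0 \<le> q" "N0 \<le> q"
        using cf_denoms_unbounded[OF irr, of "real (max n0 N0)"] by auto
      have q1: "1 \<le> real q" using n0(3)[OF q(2)] by simp
      have "4 \<le> \<tau> * ln (real q)" using n0(2)[OF q(2)] by blast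
      then obtain i m where im: "0 < m" "real q powr (1 + \<tau>) \<le> 2 ^ i" "2 ^ (i + m) \<le> real q powr (1 + 2 * \<tau>)"
        using dyadic_window[OF q1 t(1)] by metis
      have "(2::real) ^ Suc i \<le> 2 ^ (i + m)" using im(1) by (intro power_increasing) auto
      then have "2 ^ Suc i \<le> real q powr (1 + 2 * \<tau>)" using im(3) by linarith
      then have "dyadic_sup \<alpha> B i - \<epsilon> / 4 \<le> lyap_N \<alpha> B (2 ^ i)"
        by (rule n0_window[OF q(2) good[OF q(1)] B B\<Gamma> im(2)])
      moreover have "real q \<le> real q powr (1 + \<tau>)" using q1 t powr_mono[of 1 "1 + \<tau>" "real q"] by simp
      then have "real q \<le> 2 ^ i" using im(2) by linarith
      then have "real q \<le> real (2 ^ i)" by (simp only: of_nat_power of_nat_numeral)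
      then have "q \<le> 2 ^ i" by (simp only: of_nat_le_iff)
      then have "N0 \<le> 2 ^ i" using q(3) by (rule order.trans[rotated])
      then have "lyap_N \<alpha> B (2 ^ i) < lyapunov \<alpha> A - 3 / 4 * \<epsilon>" by (rule N0)
      ultimately show False using f[of i] by (simp add: \<mu>_def)
    qed
  qed
qed

lemma lyapunov_upper_bound:
  assumes r: "0 < \<rho>" and A: "A \<in> gevrey_SL2 s \<rho>" and \<epsilon>: "0 < \<epsilon>"
  shows "\<exists>\<delta>>0. \<forall>B\<in>gevrey_SL2 s \<rho>. gevrey_norm s \<rho> (\<lambda>\<theta>. A \<theta> - B \<theta>) < \<delta> \<longrightarrow>
     lyapunov \<alpha> B < lyapunov \<alpha> A + \<epsilon>"
proof -
  define \<Gamma> where "\<Gamma> = gevrey_norm s \<rho> A + 1"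
  have \<Gamma>: "1 \<le> \<Gamma>" "gevrey_norm s \<rho> A \<le> \<Gamma>" using gevrey_norm_nonneg[of s \<rho> A] by (auto simp: \<Gamma>_def)
  have "\<forall>\<^sub>F N in sequentially. lyap_N \<alpha> A N < lyapunov \<alpha> A + \<epsilon> / 2"
    using \<epsilon> by (intro order_tendstoD(2)[OF lyapunov_limit(1)[OF r \<Gamma>(1) A]]) simp
  then obtain N0 where N0: "\<And>N. N0 \<le> N \<Longrightarrow> lyap_N \<alpha> A N < lyapunov \<alpha> A + \<epsilon> / 2"
    by (auto simp: eventually_sequentially)
  define N where "N = Suc N0"
  have N: "1 \<le> N" "lyap_N \<alpha> A N < lyapunov \<alpha> A + \<epsilon> / 2" using N0[of N] by (auto simp: N_def)
  define \<beta> where "\<beta> = min 1 (\<epsilon> / (16 * (4 * \<Gamma>) ^ N))"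
  have \<beta>: "0 < \<beta>" "\<beta> \<le> 1" using \<epsilon> \<Gamma> by (auto simp: \<beta>_def)
  show ?thesis
  proof (intro exI[of _ \<beta>] conjI ballI impI \<beta>(1))
    fix B assume B: "B \<in> gevrey_SL2 s \<rho>" and d: "gevrey_norm s \<rho> (\<lambda>\<theta>. A \<theta> - B \<theta>) < \<beta>"
    have B\<Gamma>: "gevrey_norm s \<rho> B \<le> \<Gamma>"
      using gevrey_norm_le[of A s \<rho> B] A B r d \<beta>(2) by (simp add: gevrey_SL2_def \<Gamma>_def)
    have "lyapunov \<alpha> B \<le> lyap_N \<alpha> B N" by (rule lyapunov_limit(2)[OF r \<Gamma>(1) B N(1)])
    also have "\<dots> \<le> lyap_N \<alpha> A N + 8 * (4 * \<Gamma>) ^ N * \<beta>"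
      using d by (intro lyap_N_close(1)[OF r \<Gamma>(1) A \<Gamma>(2) B B\<Gamma> N(1)]) auto
    also have "8 * (4 * \<Gamma>) ^ N * \<beta> \<le> 8 * (4 * \<Gamma>) ^ N * (\<epsilon> / (16 * (4 * \<Gamma>) ^ N))"
      using \<Gamma> by (intro mult_left_mono) (auto simp: \<beta>_def)
    also have "\<dots> = \<epsilon> / 2" using \<Gamma> by simp
    finally show "lyapunov \<alpha> B < lyapunov \<alpha> A + \<epsilon>" using N(2) by simp
  qed
qed

theorem theorem1p1:
  fixes \<rho> s \<eta> \<alpha> :: real
  assumes "\<rho> > 0" and "1 < s" and "s < 2" and "0 < \<eta>" and "\<eta> < 2 - s" and "\<alpha> \<in> Omega \<eta>"
  shows "continuous_map (gevrey_SL2_topology s \<rho>) euclideanreal (lyapunov \<alpha>)"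
  unfolding continuous_map_gevrey_SL2_iff[OF less_imp_le[OF assms(1)]]
proof (intro ballI allI impI)
  fix A and \<epsilon> :: real
  assume A: "A \<in> gevrey_SL2 s \<rho>" and \<epsilon>: "0 < \<epsilon>"
  have pos: "0 \<le> lyapunov \<alpha> B" if "B \<in> gevrey_SL2 s \<rho>" for B
    by (rule lyapunov_limit(3)[OF assms(1) order.refl that])
  obtain \<delta>1 where \<delta>1: "0 < \<delta>1" "\<And>B. B \<in> gevrey_SL2 s \<rho> \<Longrightarrow> gevrey_norm s \<rho> (\<lambda>\<theta>. A \<theta> - B \<theta>) < \<delta>1 \<Longrightarrow>
     lyapunov \<alpha> B < lyapunov \<alpha> A + \<epsilon>"
    using lyapunov_upper_bound[OF assms(1) A \<epsilon>] by blast
  have "\<exists>\<delta>>0. \<forall>B\<in>gevrey_SL2 s \<rho>. gevrey_norm s \<rho> (\<lambda>\<theta>. A \<theta> - B \<theta>) < \<delta> \<longrightarrow> lyapunov \<alpha> A - \<epsilon> < lyapunov \<alpha> B"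
  proof (cases "\<epsilon> \<le> lyapunov \<alpha> A")
    case True
    obtain \<delta> where \<delta>: "0 < \<delta>" "\<And>B. B \<in> gevrey_SL2 s \<rho> \<Longrightarrow> gevrey_norm s \<rho> (\<lambda>\<theta>. A \<theta> - B \<theta>) < \<delta> \<Longrightarrow>
        lyapunov \<alpha> A - 3 / 4 * \<epsilon> \<le> lyapunov \<alpha> B"
      using lyapunov_lower_bound[OF assms A \<epsilon> True] by blast
    show ?thesis
    proof (intro exI[of _ \<delta>] conjI ballI impI \<delta>(1))
      fix B assume "B \<in> gevrey_SL2 s \<rho>" "gevrey_norm s \<rho> (\<lambda>\<theta>. A \<theta> - B \<theta>) < \<delta>"
      from \<delta>(2)[OF this] show "lyapunov \<alpha> A - \<epsilon> < lyapunov \<alpha> B" using \<epsilon> by linarith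
    qed
  next
    \<comment> \<open>The lower bound is negative here while the exponent of B is nonnegative, so
      any radius will do.\<close>
    case False
    show ?thesis
    proof (intro exI[of _ 1] conjI ballI impI)
      fix B assume "B \<in> gevrey_SL2 s \<rho>"
      then show "lyapunov \<alpha> A - \<epsilon> < lyapunov \<alpha> B" using pos[of B] False by linarith
    qed simp
  qed
  then obtain \<delta>2 where \<delta>2: "0 < \<delta>2" "\<And>B. B \<in> gevrey_SL2 s \<rho> \<Longrightarrow> gevrey_norm s \<rho> (\<lambda>\<theta>. A \<theta> - B \<theta>) < \<delta>2 \<Longrightarrow>
     lyapunov \<alpha> A - \<epsilon> < lyapunov \<alpha> B" by blast
  show "\<exists>\<delta>>0. \<forall>B\<in>gevrey_SL2 s \<rho>. gevrey_norm s \<rho> (\<lambda>\<theta>. A \<theta> - B \<theta>) < \<delta> \<longrightarrow> \<bar>lyapunov \<alpha> A - lyapunov \<alpha> B\<bar> < \<epsilon>"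
  proof (intro exI[of _ "min \<delta>1 \<delta>2"] conjI ballI impI)
    fix B assume B: "B \<in> gevrey_SL2 s \<rho>" and d: "gevrey_norm s \<rho> (\<lambda>\<theta>. A \<theta> - B \<theta>) < min \<delta>1 \<delta>2"
    show "\<bar>lyapunov \<alpha> A - lyapunov \<alpha> B\<bar> < \<epsilon>"
      using \<delta>1(2)[OF B] \<delta>2(2)[OF B] d by (simp add: abs_less_iff)
  qed (use \<delta>1 \<delta>2 in auto)
qed

end
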